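(* Consider the planar piecewise linear system $$\dot{\mathbf x}=\begin{cases}A_L\mathbf x+\mathbf b_L, & x_1\le 0,\\ A_R\mathbf x+\mathbf b_R, & x_1\ge 0,\end{cases}\qquad \mathbf x=(x_1,x_2)\in\mathbb R^2,$$ with $A_{L,R}=(a_{ij}^{L,R})$ real $2\times2$ matrices, $\mathbf b_{L,R}=(b_1^{L,R},b_2^{L,R})\in\mathbb R^2$ and $a_{12}^La_{12}^R>0$. Let $T_L,T_R$ and $D_L,D_R$ be the traces and determinants of $A_L,A_R$. Let $R(Y_1)$ be the resultant with respect to $Y_0$ of the polynomials $\widetilde F_{b^*}(Y_0,Y_1)$ and $\widetilde G_{b^*}(Y_0,Y_1)$ defined in the context (a polynomial of degree at most $6$). Assume that $T_L^2-4D_L<0$, $T_R^2-4D_R<0$, and that the coefficient of degree $6$ of $R(Y_1)$ is nonzero. Let $k$ be the number of non-positive (real) roots of $R(Y_1)$, counting multiplicity. Then the system has no more than $k+2$ (crossing) limit cycles.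
   Context: Parameters: $a_L=a_{12}^Lb_2^L-a_{22}^Lb_1^L$, $a_R=\dfrac{a_{12}^L}{a_{12}^R}(a_{12}^Rb_2^R-a_{22}^Rb_1^R)$, $b^*=a_{12}^Lb_1^R/a_{12}^R-b_1^L$. For $b\in\mathbb R$ put $m_0=a_L^2(a_R^2b+b^3D_R+a_Rb^2T_R)$, $m_1=-a_L^2b(2bD_R+a_RT_R)$, $m_2=-a_R^2(bD_L+a_LT_L)+bD_R(3a_L^2-b^2D_L+a_LbT_L)+a_R(a_L^2-b^2D_L)T_R$, $m_3=a_L^2bD_R$, $m_4=a_R^2D_L-D_R(a_L^2-b^2D_L+a_LbT_L)+a_RbD_LT_R$, $m_5=a_LD_RT_L-a_RD_LT_R-bD_LD_R$, and $F_b(y_0,y_1)=m_0+m_1(y_0+y_1)+m_2y_0y_1+m_3(y_0^2+y_1^2)+m_4(y_0y_1^2+y_0^2y_1)+m_5y_0^2y_1^2$. Let $W_L(y)=D_Ly^2-a_LT_Ly+a_L^2$ and $$G_b(y_0,y_1)=-\Big(y_1W_L(y_0)\frac{\partial F_b}{\partial y_0}(y_0,y_1)+y_0W_L(y_1)\frac{\partial F_b}{\partial y_1}(y_0,y_1)\Big).$$ Both $F_b$ and $G_b$ are symmetric in $(y_0,y_1)$; $\widetilde F_b,\widetilde G_b$ are the unique polynomials with $\widetilde F_b(y_0+y_1,y_0y_1)=F_b(y_0,y_1)$ and $\widetilde G_b(y_0+y_1,y_0y_1)=G_b(y_0,y_1)$. In particular $\widetilde F_b(Y_0,Y_1)=m_0+m_1Y_0+(m_2-2m_3)Y_1+m_3Y_0^2+m_4Y_0Y_1+m_5Y_1^2$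 and $\widetilde G_b$ has degree at most 3. Limit cycles: solutions are understood in Filippov's sense; a point of $\Sigma=\{x_1=0\}$ is a crossing point if the first components of the two linear fields there have strictly positive product. A crossing periodic orbit is a closed orbit meeting both sides of $\Sigma$ and meeting $\Sigma$ only at crossing points; a (crossing) limit cycle is a crossing periodic orbit isolated in the set of all crossing periodic orbits. *)

theory Defs
  imports "HOL-Analysis.Analysis" "Subresultants.Resultant_Prelim"
begin

no_notation Matrix.vec_index (infixl "$" 100)
hide_const (open) Determinant.det Matrix.vec Matrix.mat

section \<open>Polynomials in elementary symmetric coordinates\<close>

text \<open>A polynomial in \<open>Y0, Y1\<close> is an element of \<^typ>\<open>real poly poly\<close>: the outer variable is
  \<open>Y0\<close>, the coefficients are polynomials in \<open>Y1\<close>.  Hence \<^const>\<open>resultant\<close> on this type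
  eliminates \<open>Y0\<close>.\<close>

definition eval2 :: "real poly poly \<Rightarrow> real \<Rightarrow> real \<Rightarrow> real" where
  "eval2 q Y0 Y1 = poly (poly q [:Y0:]) Y1"

definition sym_coords :: "(real \<Rightarrow> real \<Rightarrow> real) \<Rightarrow> real poly poly" where
  "sym_coords f = (THE q. \<forall>y0 y1. eval2 q (y0 + y1) (y0 * y1) = f y0 y1)"

lemma sym_coords_unique:
  assumes "\<And>y0 y1. eval2 p (y0 + y1) (y0 * y1) = eval2 q (y0 + y1) (y0 * y1)"
  shows "p = q"
proof -
  have eq: "eval2 p s r = eval2 q s r" if "r \<le> 0" for s r
  proof -
    define w where "w = sqrt (s\<^sup>2 - 4 * r)"
    have w: "w\<^sup>2 = s\<^sup>2 - 4 * r"
      unfolding w_def using that by (intro real_sqrt_pow2) (smt (verit) zero_le_power2)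
    have "(s + w) / 2 + (s - w) / 2 = s" by (simp add: field_simps)
    moreover have "(s + w) / 2 * ((s - w) / 2) = r"
      using w by (simp add: field_simps power2_eq_square)
    ultimately show ?thesis using assms[of "(s + w) / 2" "(s - w) / 2"] by simp
  qed
  have inner: "poly p [:s:] = poly q [:s:]" for s
  proof (rule ccontr)
    assume "poly p [:s:] \<noteq> poly q [:s:]"
    then have "finite {r. poly (poly p [:s:] - poly q [:s:]) r = 0}"
      by (intro poly_roots_finite) simp
    moreover have "{..0} \<subseteq> {r. poly (poly p [:s:] - poly q [:s:]) r = 0}"
      using eq by (auto simp: eval2_def)
    ultimately have "finite {..0::real}" by (rule rev_finite_subset)
    then show False by (simp add: infinite_Iic)
  qed
  show ?thesis
  proof (rule ccontr)
    assume "p \<noteq> q"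
    then have "finite {c. poly (p - q) c = 0}" by (intro poly_roots_finite) simp
    moreover have "range (\<lambda>s. [:s:]) \<subseteq> {c. poly (p - q) c = 0}"
      using inner by auto
    ultimately have "finite (range (\<lambda>s::real. [:s:]))" by (rule rev_finite_subset)
    then have "finite (UNIV :: real set)" by (rule finite_imageD) (auto intro: injI)
    then show False by (simp add: infinite_UNIV_char_0)
  qed
qed

lemma sym_coords_eqI:
  assumes "\<And>y0 y1. eval2 q (y0 + y1) (y0 * y1) = f y0 y1"
  shows "sym_coords f = q"
  unfolding sym_coords_def
proof (rule the_equality)
  fix p assume "\<forall>y0 y1. eval2 p (y0 + y1) (y0 * y1) = f y0 y1"
  with assms show "p = q" by (intro sym_coords_unique) simp
qed (use assms in simp)

section \<open>The polynomials attached to a piecewise linear system\<close>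

context
  fixes AL :: "real^2^2" and bL :: "real^2" and AR :: "real^2^2" and bR :: "real^2"
begin

definition TL :: real where "TL = trace AL"
definition TR :: real where "TR = trace AR"
definition DL :: real where "DL = Determinants.det AL"
definition DR :: real where "DR = Determinants.det AR"

definition aL :: real where
  "aL = AL$1$2 * bL$2 - AL$2$2 * bL$1"

definition aR :: real where
  "aR = AL$1$2 / AR$1$2 * (AR$1$2 * bR$2 - AR$2$2 * bR$1)"

definition bstar :: real where
  "bstar = AL$1$2 * bR$1 / AR$1$2 - bL$1"

definition m0 :: "real \<Rightarrow> real" where
  "m0 b = aL^2 * (aR^2 * b + b^3 * DR + aR * b^2 * TR)"

definition m1 :: "real \<Rightarrow> real" where
  "m1 b = - (aL^2 * b * (2 * b * DR + aR * TR))"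

definition m2 :: "real \<Rightarrow> real" where
  "m2 b = - (aR^2 * (b * DL + aL * TL)) + b * DR * (3 * aL^2 - b^2 * DL + aL * b * TL)
          + aR * (aL^2 - b^2 * DL) * TR"

definition m3 :: "real \<Rightarrow> real" where
  "m3 b = aL^2 * b * DR"

definition m4 :: "real \<Rightarrow> real" where
  "m4 b = aR^2 * DL - DR * (aL^2 - b^2 * DL + aL * b * TL) + aR * b * DL * TR"

definition m5 :: "real \<Rightarrow> real" where
  "m5 b = aL * DR * TL - aR * DL * TR - b * DL * DR"

definition F :: "real \<Rightarrow> real \<Rightarrow> real \<Rightarrow> real" where
  "F b y0 y1 = m0 b + m1 b * (y0 + y1) + m2 b * y0 * y1 + m3 b * (y0^2 + y1^2)
               + m4 b * (y0 * y1^2 + y0^2 * y1) + m5 b * y0^2 * y1^2"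

definition WL :: "real \<Rightarrow> real" where
  "WL y = DL * y^2 - aL * TL * y + aL^2"

definition G :: "real \<Rightarrow> real \<Rightarrow> real \<Rightarrow> real" where
  "G b y0 y1 = - (y1 * WL y0 * deriv (\<lambda>s. F b s y1) y0 + y0 * WL y1 * deriv (\<lambda>s. F b y0 s) y1)"

definition Ftilde :: "real \<Rightarrow> real poly poly" where
  "Ftilde b = sym_coords (F b)"

definition Gtilde :: "real \<Rightarrow> real poly poly" where
  "Gtilde b = sym_coords (G b)"

text \<open>\<^const>\<open>resultant\<close> uses the actual \<open>Y0\<close>-degrees of its arguments.  Relative to the Sylvester
  determinant for the formal degrees 2 and 3 this changes \<open>R\<close> only by a nonzero constant factor,
  unless both degrees drop; in that case the coefficient of degree 6 vanishes for either
  convention.\<close>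

definition R :: "real poly" where
  "R = resultant (Ftilde bstar) (Gtilde bstar)"

lemma Ftilde_eq:
  "Ftilde b = [: [:m0 b, m2 b - 2 * m3 b, m5 b:], [:m1 b, m4 b:], [:m3 b:] :]"
  unfolding Ftilde_def
  by (rule sym_coords_eqI) (simp add: eval2_def F_def power2_eq_square algebra_simps)

lemma eval2_Ftilde: "eval2 (Ftilde b) (y0 + y1) (y0 * y1) = F b y0 y1"
  unfolding Ftilde_eq by (simp add: eval2_def F_def power2_eq_square algebra_simps)

lemma deriv_F_left:
  "deriv (\<lambda>s. F b s y1) y0
     = m1 b + m2 b * y1 + 2 * m3 b * y0 + m4 b * (y1^2 + 2 * y0 * y1) + 2 * m5 b * y0 * y1^2"
  by (rule DERIV_imp_deriv)
     (auto simp: F_def power2_eq_square algebra_simps intro!: derivative_eq_intros)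

lemma deriv_F_right:
  "deriv (\<lambda>s. F b y0 s) y1
     = m1 b + m2 b * y0 + 2 * m3 b * y1 + m4 b * (y0^2 + 2 * y0 * y1) + 2 * m5 b * y0^2 * y1"
  by (rule DERIV_imp_deriv)
     (auto simp: F_def power2_eq_square algebra_simps intro!: derivative_eq_intros)

lemma Gtilde_eq:
  "Gtilde b = - (let c = aL * TL; e = aL^2 in
     [: [: 0, - 2 * c * m1 b - 2 * e * m2 b + 4 * e * m3 b,
           2 * DL * m2 b - 4 * DL * m3 b - 2 * c * m4 b - 4 * e * m5 b,
           4 * DL * m5 b :],
        [: e * m1 b, DL * m1 b - c * m2 b - 2 * c * m3 b - e * m4 b,
           3 * DL * m4 b - 2 * c * m5 b :],
        [: e * m2 b, 2 * DL * m3 b - c * m4 b + 2 * e * m5 b :],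
        [: e * m4 b :] :])"
  unfolding Gtilde_def
  by (rule sym_coords_eqI)
     (simp add: eval2_def G_def WL_def deriv_F_left deriv_F_right Let_def
        power2_eq_square algebra_simps)

lemma eval2_Gtilde: "eval2 (Gtilde b) (y0 + y1) (y0 * y1) = G b y0 y1"
  unfolding Gtilde_eq
  by (simp add: eval2_def G_def WL_def deriv_F_left deriv_F_right Let_def
        power2_eq_square algebra_simps)

section \<open>Filippov solutions and crossing limit cycles\<close>

text \<open>On \<open>x$1 = 0\<close> the Filippov convention is the convex hull of both one-sided fields.\<close>

definition filippov_field :: "real^2 \<Rightarrow> (real^2) set" where
  "filippov_field x =
     (if x$1 < 0 then {AL *v x + bL}
      else if x$1 > 0 then {AR *v x + bR}
      else convex hull {AL *v x + bL, AR *v x + bR})"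

definition crossing_point :: "real^2 \<Rightarrow> bool" where
  "crossing_point x \<longleftrightarrow> x$1 = 0 \<and> (AL *v x + bL)$1 * (AR *v x + bR)$1 > 0"

end

text \<open>A pair \<open>(u, v)\<close> in \<open>I\<close> stands for the open interval from \<open>u\<close> to \<open>v\<close>.\<close>

definition abs_cont_on :: "real \<Rightarrow> real \<Rightarrow> (real \<Rightarrow> 'a::metric_space) \<Rightarrow> bool" where
  "abs_cont_on a b f \<longleftrightarrow>
     (\<forall>\<epsilon>>0. \<exists>\<delta>>0. \<forall>I.
        finite I \<and> (\<forall>(u, v)\<in>I. a \<le> u \<and> u < v \<and> v \<le> b) \<and>
        pairwise (\<lambda>(u, v) (u', v'). disjnt {u<..<v} {u'<..<v'}) I \<and>
        (\<Sum>(u, v)\<in>I. v - u) < \<delta>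
        \<longrightarrow> (\<Sum>(u, v)\<in>I. dist (f u) (f v)) < \<epsilon>)"

context
  fixes AL :: "real^2^2" and bL :: "real^2" and AR :: "real^2^2" and bR :: "real^2"
begin

definition filippov_solution :: "(real \<Rightarrow> real^2) \<Rightarrow> bool" where
  "filippov_solution \<gamma> \<longleftrightarrow>
     (\<forall>a b. abs_cont_on a b \<gamma>) \<and>
     (AE t in lebesgue. \<exists>v \<in> filippov_field AL bL AR bR (\<gamma> t). (\<gamma> has_vector_derivative v) (at t))"

definition crossing_periodic_orbit :: "(real^2) set \<Rightarrow> bool" where
  "crossing_periodic_orbit \<Gamma> \<longleftrightarrow>
     (\<exists>\<gamma> T. filippov_solution \<gamma> \<and> T > 0 \<and> (\<forall>t. \<gamma> (t + T) = \<gamma> t) \<and> \<Gamma> = range \<gamma>) \<and>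
     (\<exists>x\<in>\<Gamma>. x$1 < 0) \<and> (\<exists>x\<in>\<Gamma>. x$1 > 0) \<and>
     (\<forall>x\<in>\<Gamma>. x$1 = 0 \<longrightarrow> crossing_point AL bL AR bR x)"

definition crossing_limit_cycle :: "(real^2) set \<Rightarrow> bool" where
  "crossing_limit_cycle \<Gamma> \<longleftrightarrow>
     crossing_periodic_orbit \<Gamma> \<and>
     (\<exists>U. open U \<and> \<Gamma> \<subseteq> U \<and> (\<forall>\<Gamma>'. crossing_periodic_orbit \<Gamma>' \<and> \<Gamma>' \<subseteq> U \<longrightarrow> \<Gamma>' = \<Gamma>))"

end

end

theory Submission
  imports Defs
begin

text \<open>The bound comes from two applications of Rolle's theorem, one along a level curve of the left
  flow and one along the conic on which the polynomial \<open>F\<close> vanishes.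

  In suitable coordinates either field has the form \<open>x' = T x - y\<close>, \<open>y' = D x - a\<close> with switching
  line \<open>x = 0\<close>.  When the eigenvalues are not real, an arc that stays on one side and joins the height
  \<open>y0 > 0\<close> to the height \<open>y1 < 0\<close> satisfies \<open>\<Phi> y0 - \<Phi> y1 = c\<close>, where \<open>\<Phi>\<close> is an antiderivative of
  \<open>y / W y\<close> with \<open>W y = D y\<^sup>2 - a T y + a\<^sup>2\<close>, and \<open>c\<close> is the same for all arcs on that side
  (\<open>focus_flight\<close>).  The return map of the switching line is increasing, so a periodic orbit closes
  after one left and one right arc; it is then determined by a pair \<open>(y0, y1)\<close> that solves the left and
  the right matching equation (\<open>orbit_heights\<close>, \<open>orbit_subset\<close>).  It remains to count these pairs.

  Along the left curve \<open>\<Phi> y0 - \<Phi> y1 = c\<close> the derivative of the right matching function is a nonzero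
  multiple of \<open>F\<close> (\<open>F_dynamical\<close>), so between two pairs there is a zero of \<open>F\<close> on the left curve
  (\<open>left_curve_rolle\<close>).  Conversely, along \<open>F = 0\<close> the derivative of the left matching function is a
  nonzero multiple of \<open>G\<close> (\<open>level_deriv\<close>).  In the coordinates \<open>Y0 = y0 + y1\<close>, \<open>Y1 = y0 y1\<close> the curve
  \<open>F = 0\<close> is a conic.  For \<open>b \<noteq> 0\<close> the relevant part of it in \<open>Y1 \<le> 0\<close> consists of two graphs over
  an interval of \<open>Y1\<close> that are joined at one end; for \<open>b = 0\<close> it lies on a line.  Hence the number of
  its intersections with the left curve is at most one more than the number of common zeros of \<open>F\<close>
  and \<open>G\<close> on it (\<open>two_arc_rolle\<close>, \<open>rolle_count\<close>).  Each common zero gives a root \<open>Y1 \<le> 0\<close> of the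
  resultant \<open>R\<close>, and two common zeros over the same \<open>Y1\<close> give a double root
  (\<open>resultant_dvd_two_common_roots\<close>).  This yields at most \<open>k + 1\<close> intersections and at most \<open>k + 2\<close>
  pairs.

  The coefficient of degree 6 guarantees that \<open>R\<close> is not the zero polynomial and that \<open>a\<^sub>L \<noteq> 0\<close>
  (\<open>aL_nonzero\<close>); the latter makes \<open>W\<close> positive everywhere, so that the left matching function extends
  continuously to \<open>Y1 = 0\<close>.\<close>

section \<open>Growth of absolutely continuous functions\<close>

text \<open>A mean value inequality in which the derivative bound may fail on a null set.  The increment of
  \<open>f\<close> is split along a fine tagged division: intervals tagged at a point with a good derivative grow
  at rate at least \<open>k - e\<close>, and the intervals tagged in the null set lie in an open set of
  small measure, where absolute continuity makes the total variation small.\<close>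

lemma abs_cont_on_growth:
  fixes f :: "real \<Rightarrow> real"
  assumes ac: "abs_cont_on a b f" and ab: "a \<le> b"
    and ae: "AE t in lebesgue. a < t \<and> t < b \<longrightarrow> (\<exists>v\<ge>k. (f has_real_derivative v) (at t))"
  shows "k * (b - a) \<le> f b - f a"
proof (rule field_le_epsilon)
  fix \<eta> :: real assume \<eta>: "\<eta> > 0"
  define e where "e = \<eta> / ((b - a) + \<bar>k\<bar> + 1)"
  have den: "(b - a) + \<bar>k\<bar> + 1 > 0" using ab by linarith
  have e: "e > 0" unfolding e_def using \<eta> den by simp
  obtain \<delta>0 where \<delta>0: "\<delta>0 > 0"
    and ac': "\<And>I. finite I \<Longrightarrow> (\<forall>(u, v)\<in>I. a \<le> u \<and> u < v \<and> v \<le> b) \<Longrightarrow>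
        pairwise (\<lambda>(u, v) (u', v'). disjnt {u<..<v} {u'<..<v'}) I \<Longrightarrow>
        (\<Sum>(u, v)\<in>I. v - u) < \<delta>0 \<Longrightarrow> (\<Sum>(u, v)\<in>I. dist (f u) (f v)) < e"
    using ac e unfolding abs_cont_on_def by meson
  define \<delta> where "\<delta> = min \<delta>0 e"
  have \<delta>: "\<delta> > 0" "\<delta> \<le> \<delta>0" "\<delta> \<le> e" using \<delta>0 e by (auto simp: \<delta>_def)
  obtain N where N: "N \<in> null_sets lebesgue"
    and good: "\<And>t. t \<notin> N \<Longrightarrow> a < t \<Longrightarrow> t < b \<Longrightarrow> \<exists>v\<ge>k. (f has_real_derivative v) (at t)"
    using ae by (auto elim!: AE_E3)
  \<comment> \<open>The endpoints are treated as exceptional, since no derivative is assumed there.\<close>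
  define B where "B = N \<union> {a, b}"
  have "{a, b} \<in> null_sets lebesgue"
    by (simp add: finite_imp_null_set_lborel null_sets_completionI)
  then have B: "B \<in> null_sets lebesgue" unfolding B_def using N by auto
  obtain U where U: "open U" "B \<subseteq> U" "U - B \<in> lmeasurable" "emeasure lebesgue (U - B) < ennreal \<delta>"
    using sets_lebesgue_outer_open[OF _ \<delta>(1)] B by blast
  have "emeasure lebesgue U = emeasure lebesgue (U - B)"
    using B U by (simp add: emeasure_Diff_null_set borel_open)
  then have Um: "emeasure lebesgue U < ennreal \<delta>" using U by simp
  then have Ulm: "U \<in> lmeasurable"
    using U(1) by (intro fmeasurableI) (auto simp: borel_open, metis ennreal_less_top infinity_ennreal_def order.strict_trans)
  have Um': "measure lebesgue U < \<delta>"
    using Um \<delta>(1) Ulm by (simp add: emeasure_eq_measure2 ennreal_less_iff)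
  have "\<exists>r>0. (t \<in> B \<longrightarrow> ball t r \<subseteq> U) \<and>
      (t \<notin> B \<longrightarrow> a < t \<longrightarrow> t < b \<longrightarrow> (\<forall>u w. u \<le> t \<longrightarrow> t \<le> w \<longrightarrow> u \<in> ball t r \<longrightarrow> w \<in> ball t r \<longrightarrow>
            (k - e) * (w - u) \<le> f w - f u))" for t
  proof (cases "t \<in> B \<or> \<not> (a < t \<and> t < b)")
    case True
    show ?thesis
    proof (cases "t \<in> B")
      case True
      then obtain r where "r > 0" "ball t r \<subseteq> U" using U(1,2) openE[of U t] by blast
      then show ?thesis using True by blast
    next
      case False
      then show ?thesis using True by (intro exI[of _ 1]) auto
    qed
  next
    case False
    then obtain v where v: "v \<ge> k" "(f has_real_derivative v) (at t)"
      using good[of t] by (auto simp: B_def)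
    then have "(f has_derivative (\<lambda>h. h * v)) (at t)"
      by (simp add: has_field_derivative_def mult_commute_abs)
    then obtain r where r: "r > 0"
      "\<And>s. \<bar>s - t\<bar> < r \<Longrightarrow> \<bar>f s - f t - (s - t) * v\<bar> \<le> e * \<bar>s - t\<bar>"
      using e unfolding has_derivative_at_alt by (auto simp: real_norm_def)
    have "(k - e) * (w - u) \<le> f w - f u"
      if "u \<le> t" "t \<le> w" "u \<in> ball t r" "w \<in> ball t r" for u w
    proof -
      have "\<bar>f w - f t - (w - t) * v\<bar> \<le> e * (w - t)" "\<bar>f u - f t - (u - t) * v\<bar> \<le> e * (t - u)"
        using r(2)[of w] r(2)[of u] that by (auto simp: dist_real_def abs_minus_commute)
      then have "f w - f u \<ge> (w - u) * v - e * (w - u)" by (simp add: algebra_simps abs_le_iff)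
      moreover have "(w - u) * v \<ge> (w - u) * k" using that v by (intro mult_left_mono) auto
      ultimately show ?thesis by (simp add: algebra_simps)
    qed
    then show ?thesis using False r(1) by blast
  qed
  then obtain r where r: "\<And>t. r t > 0" "\<And>t. t \<in> B \<Longrightarrow> ball t (r t) \<subseteq> U"
    "\<And>t u w. t \<notin> B \<Longrightarrow> a < t \<Longrightarrow> t < b \<Longrightarrow> u \<le> t \<Longrightarrow> t \<le> w \<Longrightarrow> u \<in> ball t (r t) \<Longrightarrow> w \<in> ball t (r t) \<Longrightarrow>
            (k - e) * (w - u) \<le> f w - f u"
    by metis
  \<comment> \<open>Around an exceptional tag the gauge stays inside \<open>U\<close>; elsewhere it is fine enough for the
    derivative to control the increment.\<close>
  have "gauge (\<lambda>t. ball t (r t))" using r(1) by (simp add: gauge_def)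
  then obtain p where p: "p tagged_division_of {a..b}" and fine: "(\<lambda>t. ball t (r t)) fine p"
    using fine_division_exists_real by blast
  have K: "K = {Inf K..Sup K} \<and> x \<in> K \<and> a \<le> Inf K \<and> Inf K \<le> x \<and> x \<le> Sup K \<and> Sup K \<le> b \<and> K \<subseteq> ball x (r x)"
    if xK: "(x, K) \<in> p" for x K
  proof -
    obtain u w where uw: "K = {u..w}" using tagged_division_ofD(4)[OF p xK] by auto
    have x: "x \<in> K" "K \<subseteq> {a..b}" "K \<subseteq> ball x (r x)"
      using tagged_division_ofD(2,3)[OF p xK] fineD[OF fine xK] by auto
    then have "u \<le> w" using uw by auto
    then show ?thesis using x uw by auto
  qed
  have finp: "finite p" using p by auto
  define P where "P = {(x, K) \<in> p. x \<in> B \<and> Inf K < Sup K}"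
  have finP: "finite P" unfolding P_def by (rule finite_subset[OF _ finp]) auto
  have disj: "{Inf K<..<Sup K} \<inter> {Inf K'<..<Sup K'} = {}"
    if "(x, K) \<in> p" "(x', K') \<in> p" "(x, K) \<noteq> (x', K')" for x K x' K'
  proof -
    have "interior K \<inter> interior K' = {}" using tagged_division_ofD(5)[OF p that] .
    moreover have "interior K = {Inf K<..<Sup K}" "interior K' = {Inf K'<..<Sup K'}"
      using K[OF that(1)] K[OF that(2)] by (metis interior_atLeastAtMost_real)+
    ultimately show ?thesis by simp
  qed
  define \<phi> where "\<phi> = (\<lambda>(x::real, K::real set). (Inf K, Sup K))"
  have inj: "inj_on \<phi> P"
  proof (rule inj_onI, rule ccontr)
    fix y z assume yz: "y \<in> P" "z \<in> P" "\<phi> y = \<phi> z" "y \<noteq> z"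
    obtain x K x' K' where eq: "y = (x, K)" "z = (x', K')" by (metis surj_pair)
    have "{Inf K<..<Sup K} \<inter> {Inf K'<..<Sup K'} = {}"
      using yz eq by (intro disj[of x K x' K']) (auto simp: P_def)
    then show False using yz eq by (auto simp: \<phi>_def P_def)
  qed
  define I where "I = \<phi> ` P"
  have sumI: "(\<Sum>(u, v)\<in>I. h u v) = (\<Sum>(x, K)\<in>P. h (Inf K) (Sup K))" for h :: "real \<Rightarrow> real \<Rightarrow> real"
    unfolding I_def by (subst sum.reindex[OF inj]) (simp add: \<phi>_def case_prod_beta' o_def)
  have len: "(\<Sum>(x, K)\<in>P. Sup K - Inf K) < \<delta>"
  proof -
    let ?J = "\<lambda>(x::real, K::real set). {Inf K<..<Sup K}"
    have "(\<Sum>y\<in>P. measure lebesgue (?J y)) = measure lebesgue (\<Union>y\<in>P. ?J y)"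
    proof (rule measure_finite_Union[symmetric, OF finP])
      show "?J ` P \<subseteq> sets lebesgue" by auto
      show "disjoint_family_on ?J P"
        unfolding disjoint_family_on_def using disj by (fastforce simp: P_def)
      show "emeasure lebesgue (?J y) \<noteq> \<infinity>" for y
        using emeasure_bounded_finite[of "?J y"] by (cases y) auto
    qed
    also have "\<dots> \<le> measure lebesgue U"
    proof (rule measure_mono_fmeasurable[OF _ _ Ulm])
      show "(\<Union>y\<in>P. ?J y) \<subseteq> U"
      proof safe
        fix x K z assume "(x, K) \<in> P" "z \<in> {Inf K<..<Sup K}"
        then have "z \<in> ball x (r x)" "x \<in> B" using K[of x K] unfolding P_def
          by (auto simp del: mem_ball)
        then show "z \<in> U" using r(2) by blast
      qed
      show "(\<Union>y\<in>P. ?J y) \<in> sets lebesgue" using finP by auto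
    qed
    finally have "(\<Sum>y\<in>P. measure lebesgue (?J y)) < \<delta>" using Um' by linarith
    moreover have "(\<Sum>y\<in>P. measure lebesgue (?J y)) = (\<Sum>(x, K)\<in>P. Sup K - Inf K)"
      by (rule sum.cong) (auto simp: P_def)
    ultimately show ?thesis by simp
  qed
  have "(\<Sum>(u, v)\<in>I. dist (f u) (f v)) < e"
  proof (rule ac')
    show "finite I" unfolding I_def using finP by simp
    show "\<forall>(u, v)\<in>I. a \<le> u \<and> u < v \<and> v \<le> b"
      unfolding I_def \<phi>_def P_def using K by fastforce
    show "pairwise (\<lambda>(u, v) (u', v'). disjnt {u<..<v} {u'<..<v'}) I"
      unfolding pairwise_def I_def \<phi>_def P_def disjnt_def using disj by fastforce
    show "(\<Sum>(u, v)\<in>I. v - u) < \<delta>0" unfolding sumI using len \<delta> by simp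
  qed
  then have var: "(\<Sum>(x, K)\<in>P. \<bar>f (Sup K) - f (Inf K)\<bar>) < e"
    unfolding sumI by (simp add: dist_real_def abs_minus_commute)
  define g where "g t = f t - k * t" for t
  \<comment> \<open>After subtracting \<open>k t\<close>, neither part of the division can contribute a large negative increment.\<close>
  have "g b - g a = (\<Sum>(x, K)\<in>p. g (Sup K) - g (Inf K))"
    using additive_tagged_division_1[OF ab p, of g] by simp
  also have "\<dots> = (\<Sum>(x, K)\<in>P. g (Sup K) - g (Inf K)) + (\<Sum>(x, K)\<in>p - P. g (Sup K) - g (Inf K))"
    by (subst sum.subset_diff[of P p]) (auto simp: P_def finp)
  also have "\<dots> \<ge> - (e + \<bar>k\<bar> * e) + - (e * (b - a))"
  proof (rule add_mono)
    have "(\<Sum>(x, K)\<in>P. g (Sup K) - g (Inf K))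
        \<ge> (\<Sum>(x, K)\<in>P. - \<bar>f (Sup K) - f (Inf K)\<bar> - \<bar>k\<bar> * (Sup K - Inf K))"
    proof (rule sum_mono, safe)
      fix x K assume "(x, K) \<in> P"
      then have "Inf K < Sup K" by (simp add: P_def)
      then have "k * (Sup K - Inf K) \<le> \<bar>k\<bar> * (Sup K - Inf K)" by (intro mult_right_mono) auto
      then show "- \<bar>f (Sup K) - f (Inf K)\<bar> - \<bar>k\<bar> * (Sup K - Inf K) \<le> g (Sup K) - g (Inf K)"
        unfolding g_def by (simp add: algebra_simps)
    qed
    also have "(\<Sum>(x, K)\<in>P. - \<bar>f (Sup K) - f (Inf K)\<bar> - \<bar>k\<bar> * (Sup K - Inf K))
       = - (\<Sum>(x, K)\<in>P. \<bar>f (Sup K) - f (Inf K)\<bar>) - \<bar>k\<bar> * (\<Sum>(x, K)\<in>P. Sup K - Inf K)"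
      by (simp add: case_prod_beta' sum_subtractf sum_negf sum_distrib_left right_diff_distrib)
    finally have *: "(\<Sum>(x, K)\<in>P. g (Sup K) - g (Inf K))
      \<ge> - (\<Sum>(x, K)\<in>P. \<bar>f (Sup K) - f (Inf K)\<bar>) - \<bar>k\<bar> * (\<Sum>(x, K)\<in>P. Sup K - Inf K)" .
    have "\<bar>k\<bar> * (\<Sum>(x, K)\<in>P. Sup K - Inf K) \<le> \<bar>k\<bar> * e"
      using len \<delta>(3) by (intro mult_left_mono) auto
    with * var show "- (e + \<bar>k\<bar> * e) \<le> (\<Sum>(x, K)\<in>P. g (Sup K) - g (Inf K))" by linarith
  next
    have "(\<Sum>(x, K)\<in>p - P. - e * (Sup K - Inf K)) \<le> (\<Sum>(x, K)\<in>p - P. g (Sup K) - g (Inf K))"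
    proof (rule sum_mono, safe)
      fix x K assume xK: "(x, K) \<in> p" "(x, K) \<notin> P"
      note KK = K[OF xK(1)]
      show "- e * (Sup K - Inf K) \<le> g (Sup K) - g (Inf K)"
      proof (cases "Inf K < Sup K")
        case True
        then have xB: "x \<notin> B" using xK by (auto simp: P_def)
        then have "a < x" "x < b" using KK by (auto simp: B_def)
        moreover have "Inf K \<in> ball x (r x)" "Sup K \<in> ball x (r x)"
          using KK True by (metis atLeastAtMost_iff less_eq_real_def subsetD)+
        ultimately have "(k - e) * (Sup K - Inf K) \<le> f (Sup K) - f (Inf K)"
          using xB KK by (intro r(3)[of x]) auto
        then show ?thesis by (simp add: g_def algebra_simps)
      next
        case False
        then have "Inf K = Sup K" using KK by linarith
        then show ?thesis by simp
      qed
    qed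
    moreover have "(\<Sum>(x, K)\<in>p - P. Sup K - Inf K) \<le> (\<Sum>(x, K)\<in>p. Sup K - Inf K)"
      by (rule sum_mono2[OF finp]) (use K in force)+
    then have "(\<Sum>(x, K)\<in>p - P. Sup K - Inf K) \<le> b - a"
      using additive_tagged_division_1[OF ab p, of "\<lambda>x. x"] by simp
    then have "e * (\<Sum>(x, K)\<in>p - P. Sup K - Inf K) \<le> e * (b - a)" using e by simp
    ultimately show "- (e * (b - a)) \<le> (\<Sum>(x, K)\<in>p - P. g (Sup K) - g (Inf K))"
      by (simp add: sum_distrib_left case_prod_beta' sum_negf)
  qed
  finally have "g b - g a \<ge> - (e * ((b - a) + \<bar>k\<bar> + 1))" by (simp add: algebra_simps)
  also have "e * ((b - a) + \<bar>k\<bar> + 1) = \<eta>" unfolding e_def using den by simp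
  finally show "k * (b - a) \<le> f b - f a + \<eta>" by (simp add: g_def algebra_simps)
qed

lemma abs_cont_on_mono_dist:
  assumes ac: "abs_cont_on a b f" and d: "\<And>u v. dist (g u) (g v) \<le> dist (f u) (f v)"
  shows "abs_cont_on a b g"
  unfolding abs_cont_on_def
proof (intro allI impI)
  fix \<epsilon> :: real assume "\<epsilon> > 0"
  then obtain \<delta> where \<delta>: "\<delta> > 0"
    and H: "\<And>I. finite I \<and> (\<forall>(u, v)\<in>I. a \<le> u \<and> u < v \<and> v \<le> b) \<and>
        pairwise (\<lambda>(u, v) (u', v'). disjnt {u<..<v} {u'<..<v'}) I \<and>
        (\<Sum>(u, v)\<in>I. v - u) < \<delta> \<Longrightarrow> (\<Sum>(u, v)\<in>I. dist (f u) (f v)) < \<epsilon>"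
    using ac unfolding abs_cont_on_def by meson
  show "\<exists>\<delta>>0. \<forall>I. finite I \<and> (\<forall>(u, v)\<in>I. a \<le> u \<and> u < v \<and> v \<le> b) \<and>
        pairwise (\<lambda>(u, v) (u', v'). disjnt {u<..<v} {u'<..<v'}) I \<and>
        (\<Sum>(u, v)\<in>I. v - u) < \<delta> \<longrightarrow> (\<Sum>(u, v)\<in>I. dist (g u) (g v)) < \<epsilon>"
  proof (intro exI[of _ \<delta>] conjI allI impI, fact \<delta>)
    fix I :: "(real \<times> real) set"
    assume I: "finite I \<and> (\<forall>(u, v)\<in>I. a \<le> u \<and> u < v \<and> v \<le> b) \<and>
        pairwise (\<lambda>(u, v) (u', v'). disjnt {u<..<v} {u'<..<v'}) I \<and>
        (\<Sum>(u, v)\<in>I. v - u) < \<delta>"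
    have "(\<Sum>(u, v)\<in>I. dist (g u) (g v)) \<le> (\<Sum>(u, v)\<in>I. dist (f u) (f v))"
      by (rule sum_mono) (auto simp: d)
    also have "\<dots> < \<epsilon>" by (rule H[OF I])
    finally show "(\<Sum>(u, v)\<in>I. dist (g u) (g v)) < \<epsilon>" .
  qed
qed

lemma abs_cont_on_imp_continuous_on:
  assumes ac: "abs_cont_on a b f"
  shows "continuous_on {a..b} f"
  unfolding continuous_on_iff
proof (intro ballI allI impI)
  fix t and \<epsilon> :: real assume t: "t \<in> {a..b}" and "\<epsilon> > 0"
  then obtain \<delta> where \<delta>: "\<delta> > 0"
    and H: "\<And>I. finite I \<and> (\<forall>(u, v)\<in>I. a \<le> u \<and> u < v \<and> v \<le> b) \<and>
        pairwise (\<lambda>(u, v) (u', v'). disjnt {u<..<v} {u'<..<v'}) I \<and>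
        (\<Sum>(u, v)\<in>I. v - u) < \<delta> \<Longrightarrow> (\<Sum>(u, v)\<in>I. dist (f u) (f v)) < \<epsilon>"
    using ac unfolding abs_cont_on_def by meson
  have "dist (f u) (f v) < \<epsilon>" if "a \<le> u" "u < v" "v \<le> b" "v - u < \<delta>" for u v
    using H[of "{(u, v)}"] that by simp
  note step = this
  have "dist (f u) (f t) < \<epsilon>" if u: "u \<in> {a..b}" "dist u t < \<delta>" for u
  proof (cases u t rule: linorder_cases)
    case less
    then show ?thesis using step[of u t] u t by (auto simp: dist_real_def)
  next
    case greater
    then have "dist (f t) (f u) < \<epsilon>" using step[of t u] u t by (auto simp: dist_real_def)
    then show ?thesis by (metis dist_commute)
  qed (use \<open>\<epsilon> > 0\<close> in simp)
  then show "\<exists>d>0. \<forall>u\<in>{a..b}. dist u t < d \<longrightarrow> dist (f u) (f t) < \<epsilon>" using \<delta> by blast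
qed

text \<open>An absolutely continuous function with a continuous a.e. derivative \<open>\<phi>\<close> is differentiable
  everywhere: near \<open>t\<close> the derivative lies a.e. within \<open>\<epsilon>\<close> of \<open>\<phi> t\<close>, and \<open>abs_cont_on_growth\<close>,
  applied to \<open>f\<close> and to \<open>- f\<close>, transfers this to difference quotients.  This turns a Filippov solution
  into a classical one on each side, up to the endpoints of an arc.\<close>

lemma abs_cont_on_deriv_within:
  fixes f \<phi> :: "real \<Rightarrow> real"
  assumes ac: "\<And>a b. abs_cont_on a b f" and cont: "continuous_on {s..e} \<phi>"
    and ae: "AE t in lebesgue. s < t \<and> t < e \<longrightarrow> (f has_real_derivative \<phi> t) (at t)"
    and t: "t \<in> {s..e}"
  shows "(f has_real_derivative \<phi> t) (at t within {s..e})"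
proof -
  have acm: "abs_cont_on a b (\<lambda>t. - f t)" for a b
    by (rule abs_cont_on_mono_dist[OF ac]) (simp add: dist_minus)
  have "(f has_derivative (\<lambda>h. \<phi> t * h)) (at t within {s..e})"
    unfolding has_derivative_within_alt
  proof (intro conjI allI impI)
    show "bounded_linear ((*) (\<phi> t))" by (rule bounded_linear_mult_right)
    fix \<epsilon> :: real assume \<epsilon>: "\<epsilon> > 0"
    then obtain \<delta> where \<delta>: "\<delta> > 0" and near: "\<And>u. u \<in> {s..e} \<Longrightarrow> \<bar>u - t\<bar> < \<delta> \<Longrightarrow> \<bar>\<phi> u - \<phi> t\<bar> < \<epsilon>"
      using cont t unfolding continuous_on_iff dist_real_def by meson
    have inc: "\<bar>f v - f u - \<phi> t * (v - u)\<bar> \<le> \<epsilon> * (v - u)"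
      if uv: "u \<le> v" "u \<in> {s..e}" "v \<in> {s..e}" "\<bar>u - t\<bar> < \<delta>" "\<bar>v - t\<bar> < \<delta>" for u v
    proof -
      have "AE x in lebesgue. u < x \<and> x < v \<longrightarrow> (\<exists>d\<ge>\<phi> t - \<epsilon>. (f has_real_derivative d) (at x))"
        using ae
      proof eventually_elim
        case (elim x)
        show ?case
        proof
          assume x: "u < x \<and> x < v"
          then have "\<bar>\<phi> x - \<phi> t\<bar> < \<epsilon>" using uv by (intro near) auto
          then show "\<exists>d\<ge>\<phi> t - \<epsilon>. (f has_real_derivative d) (at x)"
            using elim x uv by (intro exI[of _ "\<phi> x"]) auto
        qed
      qed
      from abs_cont_on_growth[OF ac uv(1) this]
      have 1: "(\<phi> t - \<epsilon>) * (v - u) \<le> f v - f u" .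
      have "AE x in lebesgue. u < x \<and> x < v \<longrightarrow> (\<exists>d\<ge>- \<phi> t - \<epsilon>. ((\<lambda>t. - f t) has_real_derivative d) (at x))"
        using ae
      proof eventually_elim
        case (elim x)
        show ?case
        proof
          assume x: "u < x \<and> x < v"
          then have "\<bar>\<phi> x - \<phi> t\<bar> < \<epsilon>" using uv by (intro near) auto
          then show "\<exists>d\<ge>- \<phi> t - \<epsilon>. ((\<lambda>t. - f t) has_real_derivative d) (at x)"
            using elim x uv by (intro exI[of _ "- \<phi> x"]) (auto intro!: DERIV_minus)
        qed
      qed
      from abs_cont_on_growth[OF acm uv(1) this]
      have 2: "(- \<phi> t - \<epsilon>) * (v - u) \<le> - f v - (- f u)" .
      show ?thesis using 1 2 by (simp add: algebra_simps abs_le_iff)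
    qed
    show "\<exists>d>0. \<forall>y\<in>{s..e}. norm (y - t) < d \<longrightarrow> norm (f y - f t - \<phi> t * (y - t)) \<le> \<epsilon> * norm (y - t)"
    proof (intro exI[of _ \<delta>] conjI ballI impI, fact \<delta>)
      fix y assume y: "y \<in> {s..e}" "norm (y - t) < \<delta>"
      show "norm (f y - f t - \<phi> t * (y - t)) \<le> \<epsilon> * norm (y - t)"
      proof (cases "t \<le> y")
        case True
        then show ?thesis using inc[of t y] y t \<delta> by simp
      next
        case False
        have "f t - f y - \<phi> t * (t - y) = - (f y - f t - \<phi> t * (y - t))" by (simp add: algebra_simps)
        then have "\<bar>f t - f y - \<phi> t * (t - y)\<bar> = \<bar>f y - f t - \<phi> t * (y - t)\<bar>" by (metis abs_minus_cancel)
        moreover have "\<bar>f t - f y - \<phi> t * (t - y)\<bar> \<le> \<epsilon> * (t - y)"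
          using False y t \<delta> by (intro inc) auto
        ultimately show ?thesis using False by simp
      qed
    qed
  qed
  then show ?thesis by (simp add: has_field_derivative_def)
qed

section \<open>Linear foci and their first integral\<close>

definition focus_freq :: "real \<Rightarrow> real \<Rightarrow> real" where
  "focus_freq T D = sqrt (4 * D - T\<^sup>2) / 2"

definition focus_quadratic :: "real \<Rightarrow> real \<Rightarrow> real \<Rightarrow> real \<Rightarrow> real" where
  "focus_quadratic T D a y = D * y\<^sup>2 - a * T * y + a\<^sup>2"

text \<open>An antiderivative of \<open>y / W y\<close>.  For \<open>a = 0\<close> the argument of \<open>arctan\<close> is \<open>0\<close> because of
  \<open>x / 0 = 0\<close>, and what remains, \<open>ln (D y\<^sup>2) / (2 D)\<close>, is the correct antiderivative away from \<open>0\<close>.\<close>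

definition focus_potential :: "real \<Rightarrow> real \<Rightarrow> real \<Rightarrow> real \<Rightarrow> real" where
  "focus_potential T D a y =
     (ln (focus_quadratic T D a y)
       + T / focus_freq T D * arctan ((2 * D * y - a * T) / (2 * focus_freq T D * a))) / (2 * D)"

text \<open>The three values \<open>0\<close>, \<open>1\<close>, \<open>2\<close> of \<open>1 - sgn a\<close> belong to a virtual, a boundary and a real focus: the
  flow angle of an arc exceeds the difference of the two \<open>arctan\<close> terms by that many half turns.\<close>

definition flight_const :: "real \<Rightarrow> real \<Rightarrow> real \<Rightarrow> real" where
  "flight_const T D a = - (T * pi / (2 * D * focus_freq T D)) * (1 - sgn a)"

lemma focus_freq_pos: "T\<^sup>2 < 4 * D \<Longrightarrow> focus_freq T D > 0"
  by (simp add: focus_freq_def)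

lemma focus_freq_sq: "T\<^sup>2 < 4 * D \<Longrightarrow> (focus_freq T D)\<^sup>2 = D - T\<^sup>2 / 4"
  by (simp add: focus_freq_def power_divide diff_divide_distrib)

lemma focus_det_pos: "T\<^sup>2 < 4 * D \<Longrightarrow> D > (0::real)"
  using zero_le_power2[of T] by linarith

text \<open>Completing the square; the second square has the negative of the discriminant of the field as a
  factor, which is where the focus condition enters.\<close>

lemma focus_quadratic_square:
  assumes "T\<^sup>2 < 4 * D"
  shows "4 * D * focus_quadratic T D a y = (2 * D * y - a * T)\<^sup>2 + (2 * focus_freq T D * a)\<^sup>2"
proof -
  have "(2 * focus_freq T D * a)\<^sup>2 = (4 * D - T\<^sup>2) * a\<^sup>2"
    unfolding power_mult_distrib focus_freq_sq[OF assms] by (simp add: algebra_simps)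
  then show ?thesis unfolding focus_quadratic_def by (simp add: power2_eq_square algebra_simps)
qed

lemma focus_quadratic_pos:
  assumes "T\<^sup>2 < 4 * D" "a \<noteq> 0 \<or> y \<noteq> 0"
  shows "focus_quadratic T D a y > 0"
proof -
  have "(2 * D * y - a * T)\<^sup>2 + (2 * focus_freq T D * a)\<^sup>2 > 0"
    using assms focus_det_pos[OF assms(1)] focus_freq_pos[OF assms(1)]
    unfolding sum_power2_gt_zero_iff by auto
  then show ?thesis
    using focus_quadratic_square[OF assms(1), of a y] focus_det_pos[OF assms(1)]
    by (intro zero_less_mult_pos[of "4 * D" "focus_quadratic T D a y"]) auto
qed

lemma focus_potential_deriv:
  assumes "T\<^sup>2 < 4 * D" "a \<noteq> 0 \<or> y \<noteq> 0"
  shows "(focus_potential T D a has_real_derivative y / focus_quadratic T D a y) (at y)"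
proof -
  let ?w = "focus_freq T D" let ?W = "focus_quadratic T D a y"
  have D: "D > 0" and w: "?w > 0" and W: "?W > 0"
    using assms focus_det_pos focus_freq_pos focus_quadratic_pos by blast+
  have 1: "((\<lambda>y. ln (focus_quadratic T D a y)) has_real_derivative (2 * D * y - a * T) / ?W) (at y)"
    using W unfolding focus_quadratic_def
    by (auto intro!: derivative_eq_intros simp: divide_inverse)
  have 2: "((\<lambda>y. T / ?w * arctan ((2 * D * y - a * T) / (2 * ?w * a))) has_real_derivative
      a * T / ?W) (at y)"
  proof (cases "a = 0")
    case True
    then show ?thesis by simp
  next
    case False
    let ?v = "2 * ?w * a"
    have v: "?v \<noteq> 0" using w False by simp
    have 3: "1 + ((2 * D * y - a * T) / ?v)\<^sup>2 = 4 * D * ?W / ?v\<^sup>2"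
      unfolding focus_quadratic_square[OF assms(1)] power_divide using v by (simp add: add_divide_distrib)
    have lin: "((\<lambda>y. (2 * D * y - a * T) / ?v) has_real_derivative 2 * D / ?v) (at y)"
      by (rule DERIV_cdivide) (auto intro!: derivative_eq_intros)
    have "((\<lambda>y. T / ?w * arctan ((2 * D * y - a * T) / ?v)) has_real_derivative
      T / ?w * (inverse (1 + ((2 * D * y - a * T) / ?v)\<^sup>2) * (2 * D / ?v))) (at y)"
      by (rule DERIV_cmult[OF DERIV_chain2[OF DERIV_arctan lin]])
    then have "((\<lambda>y. T / ?w * arctan ((2 * D * y - a * T) / ?v)) has_real_derivative
      T / ?w * ((2 * D / ?v) / (1 + ((2 * D * y - a * T) / ?v)\<^sup>2))) (at y)"
      by (simp only: divide_inverse mult.commute mult.left_commute)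
    moreover have "T / ?w * ((2 * D / ?v) / (1 + ((2 * D * y - a * T) / ?v)\<^sup>2)) = a * T / ?W"
    proof -
      have "(2 * D / ?v) / (4 * D * ?W / ?v\<^sup>2) = ?v / (2 * ?W)"
        using v D W by (simp add: power2_eq_square)
      then show ?thesis unfolding 3 using w by simp
    qed
    ultimately show ?thesis by simp
  qed
  have "(focus_potential T D a has_real_derivative ((2 * D * y - a * T) / ?W + a * T / ?W) / (2 * D)) (at y)"
    unfolding focus_potential_def[abs_def] by (rule DERIV_cdivide[OF DERIV_add[OF 1 2]])
  moreover have "((2 * D * y - a * T) / ?W + a * T / ?W) / (2 * D) = y / ?W"
    using D by (simp add: add_divide_distrib[symmetric])
  ultimately show ?thesis by simp
qed

lemma focus_potential_continuous:
  assumes "T\<^sup>2 < 4 * D" "a \<noteq> 0"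
  shows "continuous_on A (focus_potential T D a)"
  using focus_potential_deriv[OF assms(1)] assms(2)
  by (meson DERIV_isCont continuous_at_imp_continuous_on)

lemma focus_potential_strict_mono:
  assumes "T\<^sup>2 < 4 * D" "0 < u" "u < v"
  shows "focus_potential T D a u < focus_potential T D a v"
proof (rule DERIV_pos_imp_increasing[OF assms(3)])
  fix y assume "u \<le> y" "y \<le> v"
  then show "\<exists>d. DERIV (focus_potential T D a) y :> d \<and> d > 0"
    using assms focus_potential_deriv[OF assms(1), of a y] focus_quadratic_pos[OF assms(1), of a y]
    by (intro exI[of _ "y / focus_quadratic T D a y"]) auto
qed

lemma focus_potential_strict_antimono:
  assumes "T\<^sup>2 < 4 * D" "u < v" "v < 0"
  shows "focus_potential T D a v < focus_potential T D a u"
proof (rule DERIV_neg_imp_decreasing[OF assms(2)])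
  fix y assume "u \<le> y" "y \<le> v"
  then show "\<exists>d. DERIV (focus_potential T D a) y :> d \<and> d < 0"
    using assms focus_potential_deriv[OF assms(1), of a y] focus_quadratic_pos[OF assms(1), of a y]
    by (intro exI[of _ "y / focus_quadratic T D a y"]) (auto simp: divide_less_0_iff)
qed

lemma focus_quadratic_reflect: "focus_quadratic T D (- a) (- y) = focus_quadratic T D a y"
  by (simp add: focus_quadratic_def)

text \<open>The rotation by a half turn maps the system with parameter \<open>a\<close> to the one with \<open>- a\<close>.\<close>

lemma focus_potential_reflect: "focus_potential T D (- a) (- y) = focus_potential T D a y"
proof -
  have "(2 * D * (- y) - (- a) * T) / (2 * focus_freq T D * (- a))
      = (2 * D * y - a * T) / (2 * focus_freq T D * a)"
    using minus_divide_divide[of "2 * D * y - a * T" "2 * focus_freq T D * a"] by simp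
  then show ?thesis unfolding focus_potential_def focus_quadratic_reflect by simp
qed

lemma linear_complex_ode:
  fixes \<zeta> :: "real \<Rightarrow> complex"
  assumes "\<And>t. 0 \<le> t \<Longrightarrow> t \<le> \<tau> \<Longrightarrow> (\<zeta> has_vector_derivative \<mu> * \<zeta> t) (at t within {0..\<tau>})"
    and "0 \<le> t" "t \<le> \<tau>"
  shows "\<zeta> t = \<zeta> 0 * exp (\<mu> * of_real t)"
proof -
  have "((\<lambda>t. exp (- (\<mu> * of_real t)) * \<zeta> t) has_vector_derivative 0) (at s within {0..\<tau>})"
    if "s \<in> {0..\<tau>}" for s
  proof -
    have e: "((\<lambda>t. exp (- (\<mu> * complex_of_real t))) has_vector_derivative - \<mu> * exp (- (\<mu> * of_real s)))
        (at s within {0..\<tau>})"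
      by (rule has_vector_derivative_real_field) (auto intro!: derivative_eq_intros)
    show ?thesis
      using has_vector_derivative_mult[OF e assms(1)[of s]] that by (simp add: mult_ac)
  qed
  then obtain c where c: "\<And>s. s \<in> {0..\<tau>} \<Longrightarrow> exp (- (\<mu> * of_real s)) * \<zeta> s = c"
    using has_vector_derivative_zero_constant[of "{0..\<tau>}" "\<lambda>t. exp (- (\<mu> * of_real t)) * \<zeta> t"]
      convex_real_interval(5)[of 0 \<tau>] by (metis (lifting))
  have "exp (- (\<mu> * of_real t)) * \<zeta> t = \<zeta> 0"
    using c[of t] c[of 0] assms(2,3) by simp
  then have "exp (\<mu> * of_real t) * (exp (- (\<mu> * of_real t)) * \<zeta> t) = exp (\<mu> * of_real t) * \<zeta> 0"
    by (rule arg_cong)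
  then have "(exp (\<mu> * of_real t) * exp (- (\<mu> * of_real t))) * \<zeta> t = exp (\<mu> * of_real t) * \<zeta> 0"
    by (simp only: mult.assoc)
  then have "\<zeta> t = exp (\<mu> * of_real t) * \<zeta> 0" by (simp only: exp_minus_inverse mult_1_left)
  then show ?thesis by (simp only: mult.commute)
qed

text \<open>In the coordinates \<open>p\<close>, \<open>q\<close> centred at the equilibrium the complex number \<open>p + \<i> q\<close> is multiplied by
  \<open>exp ((T / 2 + \<i> w) t)\<close>.\<close>

lemma focus_flow:
  assumes foc: "T\<^sup>2 < 4 * D"
    and dx: "\<And>t. 0 \<le> t \<Longrightarrow> t \<le> \<tau> \<Longrightarrow> (x has_real_derivative T * x t - y t) (at t within {0..\<tau>})"
    and dy: "\<And>t. 0 \<le> t \<Longrightarrow> t \<le> \<tau> \<Longrightarrow> (y has_real_derivative D * x t - a) (at t within {0..\<tau>})"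
  defines "w \<equiv> focus_freq T D"
  defines "p \<equiv> \<lambda>t. x t - a / D"
  defines "q \<equiv> \<lambda>t. (y t - a * T / D - T / 2 * p t) / w"
  assumes t: "0 \<le> t" "t \<le> \<tau>"
  shows "p t = exp (T * t / 2) * (cos (w * t) * p 0 - sin (w * t) * q 0)"
    and "q t = exp (T * t / 2) * (sin (w * t) * p 0 + cos (w * t) * q 0)"
proof -
  have w: "w > 0" and D: "D > 0" and w2: "w * w = D - T * T / 4"
    using focus_freq_pos[OF foc] focus_det_pos[OF foc] focus_freq_sq[OF foc]
    by (auto simp: w_def power2_eq_square)
  define \<zeta> where "\<zeta> t = complex_of_real (p t) + \<i> * complex_of_real (q t)" for t
  define \<mu> where "\<mu> = complex_of_real (T / 2) + \<i> * complex_of_real w"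
  have "(\<zeta> has_vector_derivative \<mu> * \<zeta> s) (at s within {0..\<tau>})" if s: "0 \<le> s" "s \<le> \<tau>" for s
  proof -
    have p: "(p has_real_derivative T * x s - y s) (at s within {0..\<tau>})"
      unfolding p_def using dx[OF s] by (auto intro!: derivative_eq_intros)
    have q: "(q has_real_derivative (D * x s - a - T / 2 * (T * x s - y s)) / w) (at s within {0..\<tau>})"
      unfolding q_def
      by (intro DERIV_cdivide) (auto intro!: derivative_eq_intros dy[OF s] p)
    have "(\<zeta> has_vector_derivative complex_of_real (T * x s - y s)
        + \<i> * complex_of_real ((D * x s - a - T / 2 * (T * x s - y s)) / w)) (at s within {0..\<tau>})"
      unfolding \<zeta>_def
      by (intro has_vector_derivative_add has_vector_derivative_mult_right has_vector_derivative_of_real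
          p q)
    moreover have "T * x s - y s = T / 2 * p s - w * q s"
    proof -
      have "w * q s = y s - T * (a / D) - T / 2 * p s" using w by (simp add: q_def)
      then show ?thesis unfolding p_def by (simp add: algebra_simps)
    qed
    moreover have "(D * x s - a - T / 2 * (T * x s - y s)) / w = w * p s + T / 2 * q s"
    proof -
      have wq: "w * q s = y s - a * T / D - T / 2 * p s" using w by (simp add: q_def)
      have "w * (w * p s + T / 2 * q s) = (w * w) * p s + T / 2 * (w * q s)"
        by (simp add: algebra_simps)
      also have "\<dots> = D * x s - a - T / 2 * (T * x s - y s)"
        unfolding wq w2 p_def using D by (simp add: field_simps)
      finally show ?thesis using w by (simp add: field_simps)
    qed
    moreover have "complex_of_real (T / 2 * p s - w * q s) + \<i> * complex_of_real (w * p s + T / 2 * q s) = \<mu> * \<zeta> s"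
      by (simp add: \<mu>_def \<zeta>_def complex_eq_iff)
    ultimately show ?thesis by (simp only:)
  qed
  from linear_complex_ode[of \<tau> \<zeta> \<mu>, OF this t]
  have eq: "\<zeta> t = \<zeta> 0 * exp (\<mu> * of_real t)" .
  have e: "exp (\<mu> * of_real t) = of_real (exp (T * t / 2)) * (of_real (cos (w * t)) + \<i> * of_real (sin (w * t)))"
    by (simp add: complex_eq_iff Re_exp Im_exp \<mu>_def)
  have re: "Re (\<zeta> t) = p t" "Im (\<zeta> t) = q t" for t by (simp_all add: \<zeta>_def)
  have "p t = Re (\<zeta> 0 * exp (\<mu> * of_real t))" "q t = Im (\<zeta> 0 * exp (\<mu> * of_real t))"
    using re eq by metis+
  then show "p t = exp (T * t / 2) * (cos (w * t) * p 0 - sin (w * t) * q 0)"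
    "q t = exp (T * t / 2) * (sin (w * t) * p 0 + cos (w * t) * q 0)"
    unfolding e by (simp_all add: re algebra_simps)
qed

lemma focus_quadratic_modulus:
  assumes foc: "T\<^sup>2 < 4 * D"
  shows "focus_quadratic T D a y
    = D * (focus_freq T D)\<^sup>2 * ((a / D)\<^sup>2 + ((y - a * T / (2 * D)) / focus_freq T D)\<^sup>2)"
proof -
  have w: "focus_freq T D > 0" and D: "D > 0" using focus_freq_pos[OF foc] focus_det_pos[OF foc] .
  have "D * (focus_freq T D)\<^sup>2 * ((a / D)\<^sup>2 + ((y - a * T / (2 * D)) / focus_freq T D)\<^sup>2)
    = (focus_freq T D)\<^sup>2 * (a\<^sup>2 / D) + D * (y - a * T / (2 * D))\<^sup>2"
    using w D by (simp add: power2_eq_square field_simps)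
  also have "\<dots> = focus_quadratic T D a y"
    unfolding focus_freq_sq[OF foc] focus_quadratic_def using D
    by (simp add: power2_eq_square field_simps)
  finally show ?thesis by simp
qed

lemma sin_zero_cases:
  assumes "sin (\<theta>::real) = 0" "cos \<theta> > 0"
  shows "- pi < \<theta> \<Longrightarrow> \<theta> < 2 * pi \<Longrightarrow> \<theta> = 0" and "0 < \<theta> \<Longrightarrow> \<theta> < 3 * pi \<Longrightarrow> \<theta> = 2 * pi"
proof -
  obtain i :: int where i: "\<theta> = of_int i * pi" using assms(1) sin_zero_iff_int2 by blast
  have i1: "i \<noteq> 1" using assms(2) i by auto
  {
    assume "- pi < \<theta>" "\<theta> < 2 * pi"
    then have "(-1) * pi < of_int i * pi" "of_int i * pi < 2 * pi" using i by auto
    then have "(-1::real) < of_int i" "of_int i < (2::real)"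
      using pi_gt_zero by (simp_all only: mult_less_cancel_right_pos)
    then have "i = 0" using i1 by linarith
    then show "\<theta> = 0" using i by simp
  }
  {
    assume "0 < \<theta>" "\<theta> < 3 * pi"
    then have "0 * pi < of_int i * pi" "of_int i * pi < 3 * pi" using i by auto
    then have "(0::real) < of_int i" "of_int i < (3::real)"
      using pi_gt_zero by (simp_all only: mult_less_cancel_right_pos)
    then have "i = 2" using i1 by linarith
    then show "\<theta> = 2 * pi" using i by simp
  }
qed

text \<open>The modulus of the rotating complex number gives the change of \<open>ln W\<close>, and its argument gives the
  change of the \<open>arctan\<close> term modulo \<open>2 \<pi>\<close>.  The number of turns is fixed by the fact that
  the arc stays on one side: it covers less than a full turn.\<close>

theorem focus_flight:
  assumes foc: "T\<^sup>2 < 4 * D" and \<tau>: "\<tau> > 0"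
    and dx: "\<And>t. 0 \<le> t \<Longrightarrow> t \<le> \<tau> \<Longrightarrow> (x has_real_derivative T * x t - y t) (at t within {0..\<tau>})"
    and dy: "\<And>t. 0 \<le> t \<Longrightarrow> t \<le> \<tau> \<Longrightarrow> (y has_real_derivative D * x t - a) (at t within {0..\<tau>})"
    and ends: "x 0 = 0" "x \<tau> = 0" and neg: "\<And>t. 0 < t \<Longrightarrow> t < \<tau> \<Longrightarrow> x t < 0"
    and y: "y 0 > 0" "y \<tau> < 0"
  shows "focus_potential T D a (y 0) - focus_potential T D a (y \<tau>) = flight_const T D a"
proof -
  define w where "w = focus_freq T D"
  define p where "p t = x t - a / D" for t
  define q where "q t = (y t - a * T / D - T / 2 * p t) / w" for t
  have w: "w > 0" and D: "D > 0"
    using focus_freq_pos[OF foc] focus_det_pos[OF foc] by (auto simp: w_def)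
  have flow: "p t = exp (T * t / 2) * (cos (w * t) * p 0 - sin (w * t) * q 0)"
    "q t = exp (T * t / 2) * (sin (w * t) * p 0 + cos (w * t) * q 0)" if "0 \<le> t" "t \<le> \<tau>" for t
    using focus_flow[OF foc dx dy that] unfolding w_def q_def p_def by blast+
  define c where "c = - a / D"
  have pc: "p 0 = c" "p \<tau> = c" by (simp_all add: p_def c_def ends)
  have qy: "q 0 = (y 0 - a * T / (2 * D)) / w" "q \<tau> = (y \<tau> - a * T / (2 * D)) / w"
    using D by (simp_all add: q_def pc c_def field_simps)
  have q_less: "q \<tau> < q 0" unfolding qy using y w by (intro divide_strict_right_mono) auto
  \<comment> \<open>After a full turn of duration \<open>P\<close> \<open>p\<close> and \<open>q\<close> are multiplied by \<open>E\<close>.  Following one turn from the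
    start and one turn back from the end, one of the two points would not have negative \<open>x\<close>.\<close>
  have angle: "w * \<tau> < 2 * pi"
  proof (rule ccontr)
    assume "\<not> w * \<tau> < 2 * pi"
    define P where "P = 2 * pi / w"
    have P: "P > 0" "P \<le> \<tau>" "w * P = 2 * pi"
      using w \<open>\<not> w * \<tau> < 2 * pi\<close> by (auto simp: P_def field_simps)
    define E where "E = exp (T * P / 2)"
    have E: "E > 0" by (simp add: E_def)
    have per: "p (t + P) = E * p t" "q (t + P) = E * q t" if "0 \<le> t" "t + P \<le> \<tau>" for t
    proof -
      have e: "exp (T * (t + P) / 2) = E * exp (T * t / 2)"
        by (simp add: E_def exp_add[symmetric] algebra_simps add_divide_distrib)
      have cs: "cos (w * (t + P)) = cos (w * t)" "sin (w * (t + P)) = sin (w * t)"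
        using P(3) by (simp_all add: distrib_left)
      show "p (t + P) = E * p t" "q (t + P) = E * q t"
        using flow[of "t + P"] flow[of t] that P(1) unfolding e cs by simp_all
    qed
    have E0: "p P = E * c" "q P = E * q 0" using per[of 0] P by (simp_all add: pc)
    show False
    proof (cases "P = \<tau>")
      case True
      then have "c = E * c" "q \<tau> = E * q 0" using E0 pc by auto
      then have "c = 0" using q_less by auto
      then have "a = 0" using D by (simp add: c_def)
      then have "y \<tau> = E * y 0" using \<open>q \<tau> = E * q 0\<close> w unfolding qy by simp
      then show False using y E by (metis mult_pos_pos not_less_iff_gr_or_eq)
    next
      case False
      then have "P < \<tau>" using P by simp
      then have "x P < 0" "x (\<tau> - P) < 0" using neg P by auto
      then have "p P < c" "p (\<tau> - P) < c" by (auto simp: p_def c_def)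
      moreover have "E * p (\<tau> - P) = c" using per(1)[of "\<tau> - P"] P pc by simp
      moreover have "E * p (\<tau> - P) < E * c" using \<open>p (\<tau> - P) < c\<close> E by simp
      ultimately show False using E0 by linarith
    qed
  qed
  have wt: "0 < w * \<tau>" using w \<tau> by simp
  define e where "e = exp (T * \<tau> / 2)"
  have e: "e > 0" by (simp add: e_def)
  define C where "C = cos (w * \<tau>)" define S where "S = sin (w * \<tau>)"
  have CS: "C\<^sup>2 + S\<^sup>2 = 1" by (simp add: C_def S_def)
  have rot: "c = e * (C * c - S * q 0)" "q \<tau> = e * (S * c + C * q 0)"
    using flow[of \<tau>] \<tau> by (simp_all add: pc e_def C_def S_def)
  have "c\<^sup>2 + (q \<tau>)\<^sup>2 = (e * (C * c - S * q 0))\<^sup>2 + (e * (S * c + C * q 0))\<^sup>2"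
    using rot by simp
  also have "\<dots> = e\<^sup>2 * ((C\<^sup>2 + S\<^sup>2) * (c\<^sup>2 + (q 0)\<^sup>2))"
    by (simp add: power2_eq_square algebra_simps)
  finally have modulus: "c\<^sup>2 + (q \<tau>)\<^sup>2 = e\<^sup>2 * (c\<^sup>2 + (q 0)\<^sup>2)" using CS by simp
  have W: "focus_quadratic T D a (y t) = D * w\<^sup>2 * (c\<^sup>2 + (q t)\<^sup>2)" if "t \<in> {0, \<tau>}" for t
    unfolding focus_quadratic_modulus[OF foc] using that by (auto simp: qy c_def w_def)
  have W1: "focus_quadratic T D a (y \<tau>) = e\<^sup>2 * focus_quadratic T D a (y 0)"
    using W[of 0] W[of \<tau>] modulus by simp
  have "focus_quadratic T D a (y 0) > 0" using y by (intro focus_quadratic_pos[OF foc]) auto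
  then have "ln (focus_quadratic T D a (y \<tau>)) = ln (e\<^sup>2) + ln (focus_quadratic T D a (y 0))"
    unfolding W1 using e by (intro ln_mult_pos) auto
  moreover have "ln (e\<^sup>2) = T * \<tau>" unfolding e_def by (simp add: exp_double[symmetric])
  ultimately have lnW: "ln (focus_quadratic T D a (y \<tau>)) = T * \<tau> + ln (focus_quadratic T D a (y 0))" by simp
  define \<beta> where "\<beta> t = arctan ((2 * D * y t - a * T) / (2 * w * a))" for t
  \<comment> \<open>The argument equation, with the multiple of \<open>2 \<pi>\<close> pinned down by the bounds on \<open>w \<tau>\<close> and on \<open>arctan\<close>.\<close>
  have ang: "w * \<tau> - (\<beta> 0 - \<beta> \<tau>) = pi * (1 - sgn a)"
  proof (cases "a = 0")
    case True
    then have "S * q 0 = 0" using rot(1) e D by (simp add: c_def)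
    moreover have "q 0 \<noteq> 0" using True y w by (simp add: qy)
    ultimately have "S = 0" by simp
    then have "w * \<tau> = pi" unfolding S_def
      using wt angle sin_gt_zero[of "w * \<tau>"] sin_lt_zero[of "w * \<tau>"] by linarith
    then show ?thesis using True by (simp add: \<beta>_def)
  next
    case False
    then have c: "c \<noteq> 0" using D by (simp add: c_def)
    have tan\<beta>: "tan (\<beta> t) = - q t / c" if "t \<in> {0, \<tau>}" for t
    proof -
      have "(2 * D * y t - a * T) / (2 * w * a) = - q t / c"
        using that D w False by (auto simp: qy c_def field_simps)
      then show ?thesis by (simp add: \<beta>_def tan_arctan)
    qed
    have cos\<beta>: "cos (\<beta> t) > 0" for t
      unfolding \<beta>_def using arctan_lbound arctan_ubound by (intro cos_gt_zero_pi) auto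
    have q\<beta>: "cos (\<beta> t) * q t = - c * sin (\<beta> t)" if "t \<in> {0, \<tau>}" for t
      using tan\<beta>[OF that] cos\<beta>[of t] c unfolding tan_def by (simp add: field_simps)
    have "c * cos (\<beta> 0) = e * (C * c * cos (\<beta> 0) - S * (cos (\<beta> 0) * q 0))"
      using rot(1) by (metis (no_types, opaque_lifting) left_diff_distrib mult.assoc mult.commute)
    also have "\<dots> = c * (e * (C * cos (\<beta> 0) + S * sin (\<beta> 0)))"
      using q\<beta>[of 0] by (simp add: algebra_simps)
    finally have 1: "cos (\<beta> 0) = e * cos (w * \<tau> - \<beta> 0)"
      using c by (simp add: cos_diff C_def S_def)
    have "cos (\<beta> 0) * (cos (\<beta> \<tau>) * q \<tau>) = cos (\<beta> \<tau>) * (e * (S * c * cos (\<beta> 0) + C * (cos (\<beta> 0) * q 0)))"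
      unfolding rot(2) by (simp add: algebra_simps)
    also have "\<dots> = c * (cos (\<beta> \<tau>) * (e * (S * cos (\<beta> 0) - C * sin (\<beta> 0))))"
      using q\<beta>[of 0] by (simp add: algebra_simps)
    finally have "c * (- cos (\<beta> 0) * sin (\<beta> \<tau>)) = c * (cos (\<beta> \<tau>) * (e * sin (w * \<tau> - \<beta> 0)))"
      using q\<beta>[of \<tau>] by (simp add: sin_diff C_def S_def mult.left_commute)
    then have 2: "- cos (\<beta> 0) * sin (\<beta> \<tau>) = cos (\<beta> \<tau>) * (e * sin (w * \<tau> - \<beta> 0))"
      using c by (metis mult_cancel_left)
    define \<theta> where "\<theta> = w * \<tau> - \<beta> 0 + \<beta> \<tau>"
    have "e * sin \<theta> = cos (\<beta> \<tau>) * (e * sin (w * \<tau> - \<beta> 0)) + (e * cos (w * \<tau> - \<beta> 0)) * sin (\<beta> \<tau>)"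
      unfolding \<theta>_def sin_add by (simp add: algebra_simps)
    also have "\<dots> = 0" unfolding 2[symmetric] 1[symmetric] by simp
    finally have s: "sin \<theta> = 0" using e by simp
    have "cos (w * \<tau> - \<beta> 0) = cos (\<theta> - \<beta> \<tau>)" by (simp add: \<theta>_def)
    also have "\<dots> = cos \<theta> * cos (\<beta> \<tau>)" by (simp add: cos_diff s)
    finally have "e * (cos \<theta> * cos (\<beta> \<tau>)) = cos (\<beta> 0)" using 1 by simp
    then have cth: "cos \<theta> > 0" using cos\<beta>[of 0] cos\<beta>[of \<tau>] e by (metis zero_less_mult_pos zero_less_mult_pos2)
    have bd: "- pi / 2 < \<beta> t" "\<beta> t < pi / 2" for t
      unfolding \<beta>_def using arctan_lbound arctan_ubound by auto
    show ?thesis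
    proof (cases "a > 0")
      case True
      then have "\<beta> \<tau> < \<beta> 0" unfolding \<beta>_def arctan_less_iff using w D y
        by (intro divide_strict_right_mono) auto
      then have "- pi < \<theta>" "\<theta> < 2 * pi" using wt angle bd[of 0] bd[of \<tau>] by (auto simp: \<theta>_def)
      then have "\<theta> = 0" using sin_zero_cases(1)[OF s cth] by blast
      then show ?thesis using True by (simp add: \<theta>_def)
    next
      case neg: False
      then have a: "a < 0" using False by simp
      have "2 * w * a < 0" using a w by (simp add: mult_pos_neg)
      then have "\<beta> 0 < \<beta> \<tau>" unfolding \<beta>_def arctan_less_iff using D y
        by (intro divide_strict_right_mono_neg) auto
      then have "0 < \<theta>" "\<theta> < 3 * pi" using wt angle bd[of 0] bd[of \<tau>] by (auto simp: \<theta>_def)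
      then have "\<theta> = 2 * pi" using sin_zero_cases(2)[OF s cth] by blast
      then show ?thesis using a by (simp add: \<theta>_def)
    qed
  qed
  have "focus_potential T D a (y 0) - focus_potential T D a (y \<tau>)
     = (T / w * (\<beta> 0 - \<beta> \<tau>) - T * \<tau>) / (2 * D)"
    unfolding focus_potential_def lnW w_def[symmetric] \<beta>_def by (simp add: diff_divide_distrib[symmetric] right_diff_distrib)
  also have "T / w * (\<beta> 0 - \<beta> \<tau>) - T * \<tau> = T / w * (- (pi * (1 - sgn a)))"
    unfolding ang[symmetric] using w by (simp add: field_simps)
  finally show ?thesis unfolding flight_const_def w_def by (simp add: mult_ac)
qed

section \<open>Arcs on one side of the switching line\<close>

lemma focus_flow_unique:
  assumes foc: "T\<^sup>2 < 4 * D"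
    and dx: "\<And>t. 0 \<le> t \<Longrightarrow> t \<le> \<tau> \<Longrightarrow> (x has_real_derivative T * x t - y t) (at t within {0..\<tau>})"
    and dy: "\<And>t. 0 \<le> t \<Longrightarrow> t \<le> \<tau> \<Longrightarrow> (y has_real_derivative D * x t - a) (at t within {0..\<tau>})"
    and dx': "\<And>t. 0 \<le> t \<Longrightarrow> t \<le> \<tau>' \<Longrightarrow> (x' has_real_derivative T * x' t - y' t) (at t within {0..\<tau>'})"
    and dy': "\<And>t. 0 \<le> t \<Longrightarrow> t \<le> \<tau>' \<Longrightarrow> (y' has_real_derivative D * x' t - a) (at t within {0..\<tau>'})"
    and start: "x 0 = x' 0" "y 0 = y' 0" and t: "0 \<le> t" "t \<le> \<tau>" "t \<le> \<tau>'"
  shows "x t = x' t" "y t = y' t"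
proof -
  have w: "focus_freq T D \<noteq> 0" using focus_freq_pos[OF foc] by simp
  note f = focus_flow[OF foc dx dy t(1,2)] and f' = focus_flow[OF foc dx' dy' t(1,3)]
  have "x t - a / D = x' t - a / D"
    by (rule trans[OF f(1) sym[OF f'(1)[folded start]]])
  then show 1: "x t = x' t" by simp
  have "(y t - a * T / D - T / 2 * (x t - a / D)) / focus_freq T D
      = (y' t - a * T / D - T / 2 * (x' t - a / D)) / focus_freq T D"
    by (rule trans[OF f(2) sym[OF f'(2)[folded start]]])
  then show "y t = y' t" using w by (simp add: 1)
qed

text \<open>The second coordinate of the normal form \<open>x' = T x - y\<close>, \<open>y' = D x - a\<close> whose first coordinate is
  \<open>\<kappa> x\<^sub>1\<close>.  A negative \<open>\<kappa>\<close> turns an arc on the right into one on the left, and its modulus matches the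
  scales of the two sides.\<close>

definition side_coord :: "real \<Rightarrow> real^2^2 \<Rightarrow> real^2 \<Rightarrow> real^2 \<Rightarrow> real" where
  "side_coord \<kappa> A \<beta> z = \<kappa> * (A$2$2 * z$1 - A$1$2 * z$2 - \<beta>$1)"

definition side_arc :: "real \<Rightarrow> real^2^2 \<Rightarrow> real^2 \<Rightarrow> (real \<Rightarrow> real^2) \<Rightarrow> real \<Rightarrow> real \<Rightarrow> bool" where
  "side_arc \<kappa> A \<beta> \<gamma> s e \<longleftrightarrow> s < e \<and> \<gamma> s $ 1 = 0 \<and> \<gamma> e $ 1 = 0 \<and>
     (\<forall>t. s < t \<longrightarrow> t < e \<longrightarrow> \<kappa> * \<gamma> t $ 1 < 0) \<and>
     (\<forall>t\<in>{s..e}. \<forall>i. ((\<lambda>t. \<gamma> t $ i) has_real_derivative (A *v \<gamma> t + \<beta>) $ i) (at t within {s..e}))"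

lemma affine_component: "(A *v z + \<beta>) $ i = A$i$1 * z$1 + A$i$2 * z$2 + \<beta>$i" for A :: "real^2^2"
  by (simp add: matrix_vector_mult_def sum_2)

lemma side_arc_lienard:
  assumes arc: "side_arc \<kappa> A \<beta> \<gamma> s e" and r: "0 \<le> r" "r \<le> e - s"
  shows "((\<lambda>r. \<kappa> * \<gamma> (s + r) $ 1) has_real_derivative
      trace A * (\<kappa> * \<gamma> (s + r) $ 1) - side_coord \<kappa> A \<beta> (\<gamma> (s + r))) (at r within {0..e - s})"
    and "((\<lambda>r. side_coord \<kappa> A \<beta> (\<gamma> (s + r))) has_real_derivative
      Determinants.det A * (\<kappa> * \<gamma> (s + r) $ 1) - \<kappa> * (A$1$2 * \<beta>$2 - A$2$2 * \<beta>$1)) (at r within {0..e - s})"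
proof -
  have comp: "((\<lambda>r. \<gamma> (s + r) $ i) has_real_derivative (A *v \<gamma> (s + r) + \<beta>) $ i) (at r within {0..e - s})" for i
  proof -
    have "((\<lambda>t. \<gamma> t $ i) has_real_derivative (A *v \<gamma> (s + r) + \<beta>) $ i) (at (s + r) within (\<lambda>r. s + r) ` {0..e - s})"
      using arc r unfolding side_arc_def by simp
    moreover have "((\<lambda>r. s + r) has_real_derivative 1) (at r within {0..e - s})"
      by (auto intro!: derivative_eq_intros)
    ultimately show ?thesis using DERIV_image_chain by (fastforce simp: o_def)
  qed
  have "((\<lambda>r. \<kappa> * \<gamma> (s + r) $ 1) has_real_derivative \<kappa> * (A *v \<gamma> (s + r) + \<beta>) $ 1) (at r within {0..e - s})"
    by (rule DERIV_cmult[OF comp])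
  moreover have "\<kappa> * (A *v \<gamma> (s + r) + \<beta>) $ 1
      = trace A * (\<kappa> * \<gamma> (s + r) $ 1) - side_coord \<kappa> A \<beta> (\<gamma> (s + r))"
    unfolding affine_component side_coord_def trace_def sum_2 by (simp add: algebra_simps)
  ultimately show "((\<lambda>r. \<kappa> * \<gamma> (s + r) $ 1) has_real_derivative
      trace A * (\<kappa> * \<gamma> (s + r) $ 1) - side_coord \<kappa> A \<beta> (\<gamma> (s + r))) (at r within {0..e - s})" by simp
  have "((\<lambda>r. side_coord \<kappa> A \<beta> (\<gamma> (s + r))) has_real_derivative
      \<kappa> * (A$2$2 * (A *v \<gamma> (s + r) + \<beta>) $ 1 - A$1$2 * (A *v \<gamma> (s + r) + \<beta>) $ 2)) (at r within {0..e - s})"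
    unfolding side_coord_def
    using DERIV_cmult[OF DERIV_diff[OF DERIV_diff[OF DERIV_cmult[OF comp[of 1], of "A$2$2"] DERIV_cmult[OF comp[of 2], of "A$1$2"]] DERIV_const[of "\<beta>$1"]], of \<kappa>]
    by simp
  moreover have "\<kappa> * (A$2$2 * (A *v \<gamma> (s + r) + \<beta>) $ 1 - A$1$2 * (A *v \<gamma> (s + r) + \<beta>) $ 2)
    = Determinants.det A * (\<kappa> * \<gamma> (s + r) $ 1) - \<kappa> * (A$1$2 * \<beta>$2 - A$2$2 * \<beta>$1)"
    unfolding affine_component det_2 by (simp add: algebra_simps)
  ultimately show "((\<lambda>r. side_coord \<kappa> A \<beta> (\<gamma> (s + r))) has_real_derivative
      Determinants.det A * (\<kappa> * \<gamma> (s + r) $ 1) - \<kappa> * (A$1$2 * \<beta>$2 - A$2$2 * \<beta>$1)) (at r within {0..e - s})" by simp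
qed

lemma side_arc_flight:
  assumes arc: "side_arc \<kappa> A \<beta> \<gamma> s e" and foc: "(trace A)\<^sup>2 < 4 * Determinants.det A"
    and y: "side_coord \<kappa> A \<beta> (\<gamma> s) > 0" "side_coord \<kappa> A \<beta> (\<gamma> e) < 0"
  defines "a \<equiv> \<kappa> * (A$1$2 * \<beta>$2 - A$2$2 * \<beta>$1)"
  shows "focus_potential (trace A) (Determinants.det A) a (side_coord \<kappa> A \<beta> (\<gamma> s))
    - focus_potential (trace A) (Determinants.det A) a (side_coord \<kappa> A \<beta> (\<gamma> e))
    = flight_const (trace A) (Determinants.det A) a"
  using focus_flight[OF foc, of "e - s" "\<lambda>r. \<kappa> * \<gamma> (s + r) $ 1" "\<lambda>r. side_coord \<kappa> A \<beta> (\<gamma> (s + r))" a,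
      OF _ side_arc_lienard(1)[OF arc] side_arc_lienard(2)[OF arc, folded a_def]] arc y
  unfolding side_arc_def by simp

text \<open>Two arcs with the same initial point follow the same solution, and neither can be longer, because its
  first coordinate would vanish in the interior.\<close>

lemma side_arc_determined:
  assumes arc: "side_arc \<kappa> A \<beta> \<gamma> s e" "side_arc \<kappa> A \<beta> \<gamma>' s' e'"
    and foc: "(trace A)\<^sup>2 < 4 * Determinants.det A" and nz: "\<kappa> \<noteq> 0" "A$1$2 \<noteq> 0"
    and start: "side_coord \<kappa> A \<beta> (\<gamma> s) = side_coord \<kappa> A \<beta> (\<gamma>' s')"
    and t: "t \<in> {s..e}"
  shows "\<gamma> t \<in> range \<gamma>'"
proof -
  have same: "\<gamma> (s + r) = \<gamma>' (s' + r)" if r: "0 \<le> r" "r \<le> e - s" "r \<le> e' - s'" for r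
  proof -
    have z: "\<gamma> s $ 1 = 0" "\<gamma>' s' $ 1 = 0" using arc by (auto simp: side_arc_def)
    note same = focus_flow_unique[OF foc side_arc_lienard(1)[OF arc(1)] side_arc_lienard(2)[OF arc(1)]
        side_arc_lienard(1)[OF arc(2)] side_arc_lienard(2)[OF arc(2)]]
    have 1: "\<kappa> * \<gamma> (s + r) $ 1 = \<kappa> * \<gamma>' (s' + r) $ 1"
      by (rule same(1)) (use z start r in simp_all)
    have 2: "side_coord \<kappa> A \<beta> (\<gamma> (s + r)) = side_coord \<kappa> A \<beta> (\<gamma>' (s' + r))"
      by (rule same(2)) (use z start r in simp_all)
    have "\<gamma> (s + r) $ 1 = \<gamma>' (s' + r) $ 1" using 1 nz by simp
    moreover from this have "\<gamma> (s + r) $ 2 = \<gamma>' (s' + r) $ 2" using 2 nz by (simp add: side_coord_def)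
    ultimately show ?thesis by (simp add: Finite_Cartesian_Product.vec_eq_iff forall_2)
  qed
  have len: "e - s = e' - s'"
  proof (rule ccontr)
    assume "e - s \<noteq> e' - s'"
    then consider "e - s < e' - s'" | "e' - s' < e - s" by linarith
    then show False
    proof cases
      case 1
      have "\<kappa> * \<gamma>' (s' + (e - s)) $ 1 < 0" using arc 1 unfolding side_arc_def by auto
      moreover have "\<gamma>' (s' + (e - s)) = \<gamma> e" using same[of "e - s"] 1 arc by (auto simp: side_arc_def)
      ultimately show False using arc by (auto simp: side_arc_def)
    next
      case 2
      have "\<kappa> * \<gamma> (s + (e' - s')) $ 1 < 0" using arc 2 unfolding side_arc_def by auto
      moreover have "\<gamma> (s + (e' - s')) = \<gamma>' e'" using same[of "e' - s'"] 2 arc by (auto simp: side_arc_def)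
      ultimately show False using arc by (auto simp: side_arc_def)
    qed
  qed
  have "\<gamma> t = \<gamma>' (s' + (t - s))" using same[of "t - s"] t len by simp
  then show ?thesis by blast
qed

section \<open>Multiple roots of resultants\<close>

text \<open>Every term of the Leibniz expansion contains one entry from each column of \<open>J\<close>.\<close>

lemma det_dvd_power_of_dvd_columns:
  fixes M :: "'a :: idom Matrix.mat"
  assumes M: "M \<in> carrier_mat n n" and J: "J \<subseteq> {..<n}"
    and dv: "\<And>i j. i < n \<Longrightarrow> j \<in> J \<Longrightarrow> c dvd M $$ (i, j)"
  shows "c ^ card J dvd Determinant.det M"
proof -
  define d where "d i j = (if j \<in> J then (SOME r. M $$ (i, j) = c * r) else M $$ (i, j))" for i j
  have d: "M $$ (i, j) = (if j \<in> J then c else 1) * d i j" if "i < n" "j < n" for i j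
    using someI_ex[of "\<lambda>r. M $$ (i, j) = c * r"] dv[OF that(1), of j] by (auto simp: d_def dvd_def)
  have "Determinant.det M = (\<Sum>\<pi> \<in> {\<pi>. \<pi> permutes {0..<n}}. signof \<pi> * (\<Prod>i = 0..<n. M $$ (i, \<pi> i)))"
    by (rule det_def'[OF M])
  also have "c ^ card J dvd \<dots>"
  proof (rule dvd_sum)
    fix \<pi> assume "\<pi> \<in> {\<pi>. \<pi> permutes {0..<n}}"
    then have \<pi>: "\<pi> permutes {0..<n}" by simp
    have "(\<Prod>i = 0..<n. M $$ (i, \<pi> i)) = (\<Prod>i = 0..<n. (if \<pi> i \<in> J then c else 1) * d i (\<pi> i))"
      using d permutes_in_image[OF \<pi>] by (intro prod.cong) auto
    also have "\<dots> = (\<Prod>i = 0..<n. if \<pi> i \<in> J then c else 1) * (\<Prod>i = 0..<n. d i (\<pi> i))"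
      by (rule prod.distrib)
    also have "(\<Prod>i = 0..<n. if \<pi> i \<in> J then c else 1) = (\<Prod>i = 0..<n. if i \<in> J then c else 1)"
      by (rule prod.permute[OF \<pi>, symmetric, unfolded o_def])
    also have "\<dots> = c ^ card J"
      using J by (subst prod.If_cases) (auto intro!: arg_cong[of _ _ card] simp: Int_absorb1 lessThan_atLeast0)
    finally have "c ^ card J dvd (\<Prod>i = 0..<n. M $$ (i, \<pi> i))" by simp
    then show "c ^ card J dvd signof \<pi> * (\<Prod>i = 0..<n. M $$ (i, \<pi> i))" by simp
  qed
  finally show ?thesis .
qed

text \<open>The hypothesis on combinations of columns reduces to divisibility of columns after multiplication by the
  unitriangular matrix \<open>u\<close>.\<close>

lemma det_dvd_power_of_dvd_combinations:
  fixes M :: "'a :: idom Matrix.mat" and u :: "nat \<Rightarrow> nat \<Rightarrow> 'a"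
  assumes M: "M \<in> carrier_mat n n" and J: "J \<subseteq> {..<n}"
    and tri: "\<And>i j. j < i \<Longrightarrow> i < n \<Longrightarrow> u i j = 0" and diag: "\<And>i. i < n \<Longrightarrow> u i i = 1"
    and dv: "\<And>i j. i < n \<Longrightarrow> j \<in> J \<Longrightarrow> c dvd (\<Sum>k<n. M $$ (i, k) * u k j)"
  shows "c ^ card J dvd Determinant.det M"
proof -
  define U where "U = Matrix.mat n n (\<lambda>(i, j). u i j)"
  have U: "U \<in> carrier_mat n n" by (simp add: U_def)
  have "Determinant.det U = prod_list (diag_mat U)"
    by (rule det_upper_triangular[OF _ U]) (auto simp: U_def upper_triangular_def tri)
  also have "diag_mat U = replicate n 1"
    by (rule nth_equalityI) (auto simp: diag_mat_def U_def diag)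
  finally have detU: "Determinant.det U = 1" by simp
  have "c ^ card J dvd Determinant.det (M * U)"
  proof (rule det_dvd_power_of_dvd_columns[OF _ J])
    show "M * U \<in> carrier_mat n n" using M U by simp
    fix i j assume ij: "i < n" "j \<in> J"
    then have j: "j < n" using J by auto
    have "(M * U) $$ (i, j) = (\<Sum>k<n. M $$ (i, k) * u k j)"
      using M U ij(1) j by (auto simp: scalar_prod_def U_def lessThan_atLeast0 intro!: sum.cong)
    then show "c dvd (M * U) $$ (i, j)" using dv[OF ij] by simp
  qed
  then show ?thesis using det_mult[OF M U] detU by simp
qed

lemma poly_eq_sum_rev:
  fixes Q :: "'a :: comm_ring_1 poly"
  assumes "degree Q < N"
  shows "poly Q \<alpha> = (\<Sum>k<N. coeff Q (N - Suc k) * \<alpha> ^ (N - Suc k))"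
proof -
  have "poly Q \<alpha> = (\<Sum>d<N. coeff Q d * \<alpha> ^ d)"
    unfolding poly_altdef using assms by (intro sum.mono_neutral_left) (auto simp: coeff_eq_0)
  then show ?thesis using sum.nat_diff_reindex[of "\<lambda>d. coeff Q d * \<alpha> ^ d" N] by simp
qed

text \<open>A row of the Sylvester matrix lists the coefficients of a power of the variable times \<open>p\<close> or \<open>q\<close>;
  pairing it with powers of \<open>\<alpha>\<close> evaluates that polynomial.\<close>

lemma sylvester_row_value:
  fixes p q :: "'a :: comm_ring_1 poly"
  assumes "i < degree p + degree q"
  shows "(\<Sum>k<degree p + degree q. sylvester_mat p q $$ (i, k) * \<alpha> ^ (degree p + degree q - Suc k))
    = (if i < degree q then \<alpha> ^ (degree q - Suc i) * poly p \<alpha>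
       else \<alpha> ^ (degree p + degree q - Suc i) * poly q \<alpha>)"
proof -
  let ?N = "degree p + degree q"
  define Q where "Q = (if i < degree q then monom 1 (degree q - Suc i) * p else monom 1 (?N - Suc i) * q)"
  have "sylvester_mat p q $$ (i, k) = coeff Q (?N - Suc k)" if "k < ?N" for k
    unfolding sylvester_index_mat[OF assms that] Q_def
    using assms that by (auto simp: coeff_monom_mult coeff_eq_0)
  moreover have "degree Q < ?N"
  proof -
    have "degree Q \<le> ?N - 1"
    proof (cases "i < degree q")
      case True
      have "degree Q \<le> (degree q - Suc i) + degree p"
        unfolding Q_def using True degree_monom_le[of "1::'a" "degree q - Suc i"]
          degree_mult_le[of "monom 1 (degree q - Suc i)" p] by auto
      then show ?thesis using True by linarith
    next
      case False
      have "degree Q \<le> (?N - Suc i) + degree q"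
        unfolding Q_def using False degree_monom_le[of "1::'a" "?N - Suc i"]
          degree_mult_le[of "monom 1 (?N - Suc i)" q] by auto
      then show ?thesis using False assms by linarith
    qed
    then show ?thesis using assms by linarith
  qed
  ultimately have "(\<Sum>k<?N. sylvester_mat p q $$ (i, k) * \<alpha> ^ (?N - Suc k)) = poly Q \<alpha>"
    by (simp add: poly_eq_sum_rev)
  then show ?thesis by (simp add: Q_def poly_monom)
qed

lemma resultant_dvd_common_root:
  fixes p q :: "'a :: idom poly"
  assumes N: "degree p + degree q > 0" and "c dvd poly p \<alpha>" "c dvd poly q \<alpha>"
  shows "c dvd resultant p q"
proof -
  let ?N = "degree p + degree q"
  define u where "u i j = (if Suc j = ?N then \<alpha> ^ (?N - Suc i) else if i = j then 1 else 0)" for i j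
  have "c ^ card {?N - 1} dvd Determinant.det (sylvester_mat p q)"
  proof (rule det_dvd_power_of_dvd_combinations[where u = u])
    show "sylvester_mat p q \<in> carrier_mat ?N ?N" by (rule sylvester_carrier_mat)
    fix i j assume "i < ?N" "j \<in> {?N - 1}"
    then have "(\<Sum>k<?N. sylvester_mat p q $$ (i, k) * u k j)
      = (\<Sum>k<?N. sylvester_mat p q $$ (i, k) * \<alpha> ^ (?N - Suc k))"
      by (intro sum.cong) (auto simp: u_def)
    then show "c dvd (\<Sum>k<?N. sylvester_mat p q $$ (i, k) * u k j)"
      unfolding sylvester_row_value[OF \<open>i < ?N\<close>] using assms by simp
  qed (use N in \<open>auto simp: u_def\<close>)
  then show ?thesis by (simp add: resultant_def)
qed

text \<open>Modulo \<open>c\<close>, a common root \<open>\<alpha>\<close> makes the vector of powers of \<open>\<alpha>\<close> a null vector of the Sylvester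
  matrix.  Two roots give two null vectors, which are independent as \<open>\<alpha> - \<beta>\<close> is a unit; replacing the
  second by the divided difference keeps the change of columns unitriangular.\<close>

lemma resultant_dvd_two_common_roots:
  fixes p q :: "'a :: idom poly"
  assumes N: "degree p + degree q \<ge> 2" and unit: "\<alpha> - \<beta> dvd 1"
    and "c dvd poly p \<alpha>" "c dvd poly q \<alpha>" "c dvd poly p \<beta>" "c dvd poly q \<beta>"
  shows "c\<^sup>2 dvd resultant p q"
proof -
  let ?N = "degree p + degree q"
  obtain \<kappa> where \<kappa>: "1 = (\<alpha> - \<beta>) * \<kappa>" using unit by (elim dvdE)
  \<comment> \<open>The last column holds the powers of \<open>\<alpha>\<close>, the one before it the divided differences.\<close>
  define u where "u i j = (if Suc j = ?N then \<alpha> ^ (?N - Suc i)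
    else if Suc (Suc j) = ?N then \<kappa> * (\<alpha> ^ (?N - Suc i) - \<beta> ^ (?N - Suc i))
    else if i = j then 1 else 0)" for i j
  have "c ^ card {?N - 2, ?N - 1} dvd Determinant.det (sylvester_mat p q)"
  proof (rule det_dvd_power_of_dvd_combinations[where u = u])
    show "sylvester_mat p q \<in> carrier_mat ?N ?N" by (rule sylvester_carrier_mat)
    fix i j assume i: "i < ?N" and j: "j \<in> {?N - 2, ?N - 1}"
    let ?s = "\<lambda>\<gamma>. (\<Sum>k<?N. sylvester_mat p q $$ (i, k) * \<gamma> ^ (?N - Suc k))"
    have s: "c dvd ?s \<alpha>" "c dvd ?s \<beta>"
      unfolding sylvester_row_value[OF i] using assms by auto
    have "(\<Sum>k<?N. sylvester_mat p q $$ (i, k) * u k j)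
      = (if j = ?N - 1 then ?s \<alpha> else \<kappa> * (?s \<alpha> - ?s \<beta>))"
      using j N by (auto simp: u_def sum_distrib_left right_diff_distrib sum_subtractf[symmetric] mult.left_commute intro!: sum.cong)
    then show "c dvd (\<Sum>k<?N. sylvester_mat p q $$ (i, k) * u k j)" using s by simp
  next
    fix i assume "i < ?N"
    then show "u i i = 1" using \<kappa> by (auto simp: u_def mult.commute Suc_diff_Suc numeral_2_eq_2 dest!: sym[of "Suc _" ?N])
  next
    fix i j assume "j < i" "i < ?N"
    then show "u i j = 0" by (auto simp: u_def)
  qed (use N in auto)
  moreover have "card {?N - 2, ?N - 1} = 2" using N by auto
  ultimately show ?thesis by (simp add: resultant_def)
qed

lemma degree_resultant_linear_le:
  fixes p q :: "'a :: comm_ring_1 poly poly"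
  assumes "degree p = 1" "degree q = 1" "\<And>i. degree (coeff p i) \<le> m" "\<And>i. degree (coeff q i) \<le> n"
  shows "degree (resultant p q) \<le> m + n"
proof -
  let ?M = "sylvester_mat p q"
  have M: "?M \<in> carrier_mat 2 2" using sylvester_carrier_mat[of p q] assms by (simp add: numeral_2_eq_2)
  have ent: "degree (?M $$ (0, j)) \<le> m" "degree (?M $$ (1, j)) \<le> n" if "j < 2" for j
    using that assms(3,4) by (auto simp: sylvester_index_mat assms(1,2))
  have "degree (signof \<pi> * (\<Prod>i = 0..<2. ?M $$ (i, \<pi> i))) \<le> m + n" if \<pi>: "\<pi> permutes {0..<2}" for \<pi>
  proof -
    have b: "\<pi> 0 < 2" "\<pi> 1 < 2" using permutes_in_image[OF \<pi>] by auto
    have s: "(signof \<pi> :: 'a poly) = 1 \<or> (signof \<pi> :: 'a poly) = - 1" by (simp add: sign_def)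
    have "(\<Prod>i = 0..<2. ?M $$ (i, \<pi> i)) = ?M $$ (0, \<pi> 0) * ?M $$ (1, \<pi> 1)"
      by (simp add: numeral_2_eq_2)
    then have "degree (\<Prod>i = 0..<2. ?M $$ (i, \<pi> i)) \<le> m + n"
      using degree_mult_le[of "?M $$ (0, \<pi> 0)" "?M $$ (1, \<pi> 1)"] ent(1)[OF b(1)] ent(2)[OF b(2)]
      by simp
    then show ?thesis using s by auto
  qed
  then show ?thesis unfolding resultant_def det_def'[OF M]
    by (intro degree_sum_le) (auto simp: finite_permutations)
qed

text \<open>Points of \<open>B\<close> are counted twice on the left, as double roots are on the right.\<close>

lemma mset_roots_bound:
  fixes p :: "real poly"
  assumes "p \<noteq> 0" "finite A" "\<And>t. t \<in> A \<Longrightarrow> t \<le> 0 \<and> poly p t = 0" "B \<subseteq> A"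
    "\<And>t. t \<in> B \<Longrightarrow> [:- t, 1:]\<^sup>2 dvd p"
  shows "card A + card B \<le> size (filter_mset (\<lambda>y. y \<le> 0) (proots p))"
proof -
  have finB: "finite B" using assms finite_subset by blast
  have "mset_set A + mset_set B \<subseteq># filter_mset (\<lambda>y. y \<le> 0) (proots p)"
  proof (rule mset_subset_eqI)
    fix t
    show "count (mset_set A + mset_set B) t \<le> count (filter_mset (\<lambda>y. y \<le> 0) (proots p)) t"
    proof (cases "t \<in> A")
      case True
      then have t: "t \<le> 0" "poly p t = 0" using assms by auto
      have "order t p \<ge> (if t \<in> B then 2 else 1)"
        using assms(1,5) t(2) by (auto simp: order_divides Suc_le_eq order_root)
      then show ?thesis using True t assms(1,2) finB by (cases "t \<in> B") auto
    next
      case False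
      then have "t \<notin> B" using assms(4) by auto
      then show ?thesis using False assms(2) finB by simp
    qed
  qed
  from size_mset_mono[OF this] show ?thesis by simp
qed

section \<open>Counting zeros by Rolle's theorem\<close>

text \<open>The counting part of Rolle's theorem: consecutive points of \<open>S\<close> are separated by points with
  property \<open>Q\<close>.\<close>

lemma separated_points_count:
  fixes S :: "real set"
  assumes "finite S" "\<And>s t. s \<in> S \<Longrightarrow> t \<in> S \<Longrightarrow> s < t \<Longrightarrow> \<exists>z. s < z \<and> z < t \<and> Q z"
  shows "\<exists>Z. finite Z \<and> card S \<le> card Z + 1 \<and> (\<forall>z\<in>Z. Q z \<and> (\<exists>s\<in>S. s < z) \<and> (\<exists>t\<in>S. z < t))"
  using assms
proof (induction S rule: finite_linorder_max_induct)
  case empty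
  then show ?case by (intro exI[of _ "{}"]) auto
next
  case (insert b A)
  have "\<And>s t. s \<in> A \<Longrightarrow> t \<in> A \<Longrightarrow> s < t \<Longrightarrow> \<exists>z. s < z \<and> z < t \<and> Q z"
    using insert.prems by blast
  from insert.IH[OF this] obtain Z where Z: "finite Z" "card A \<le> card Z + 1"
    "\<And>z. z \<in> Z \<Longrightarrow> Q z \<and> (\<exists>s\<in>A. s < z) \<and> (\<exists>t\<in>A. z < t)" by auto
  show ?case
  proof (cases "A = {}")
    case True
    then show ?thesis by (intro exI[of _ "{}"]) auto
  next
    case False
    then have "Max A \<in> A" using insert.hyps by simp
    then obtain z where z: "Max A < z" "z < b" "Q z" using insert by blast
    then have "z \<notin> Z" using Z(3) insert.hyps(1) Max_ge by fastforce
    then have "card (insert b A) \<le> card (insert z Z) + 1"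
      using Z insert.hyps by auto
    moreover have "\<forall>y\<in>insert z Z. Q y \<and> (\<exists>s\<in>insert b A. s < y) \<and> (\<exists>t\<in>insert b A. y < t)"
      using z Z(3) \<open>Max A \<in> A\<close> by blast
    ultimately show ?thesis using Z(1) by (intro exI[of _ "insert z Z"]) auto
  qed
qed

lemma rolle_count:
  fixes h h' :: "real \<Rightarrow> real"
  assumes S: "finite S" "S \<subseteq> {a..r}" "\<And>t. t \<in> S \<Longrightarrow> h t = c"
    and cont: "continuous_on {a..r} h"
    and der: "\<And>t. a < t \<Longrightarrow> t < r \<Longrightarrow> (h has_real_derivative h' t) (at t)"
  shows "\<exists>Z. finite Z \<and> card S \<le> card Z + 1 \<and>
    (\<forall>z\<in>Z. a < z \<and> z < r \<and> h' z = 0 \<and> (\<exists>t\<in>S. z < t))"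
proof -
  have "\<exists>z. s < z \<and> z < t \<and> h' z = 0" if S': "s \<in> S" "t \<in> S" "s < t" for s t
  proof -
    have st: "a \<le> s" "t \<le> r" using S S' by auto
    have c: "continuous_on {s..t} h" using st by (intro continuous_on_subset[OF cont]) auto
    have d: "(h has_derivative (\<lambda>d. h' z * d)) (at z)" if "s < z" "z < t" for z
      using der[of z] st that by (simp add: has_field_derivative_def)
    obtain z where z: "s < z" "z < t" "h t - h s = h' z * (t - s)"
      using mvt[OF S'(3) c d] by blast
    then show ?thesis using S(3) S' by auto
  qed
  from separated_points_count[OF S(1) this] obtain Z where Z: "finite Z" "card S \<le> card Z + 1"
    "\<And>z. z \<in> Z \<Longrightarrow> h' z = 0 \<and> (\<exists>s\<in>S. s < z) \<and> (\<exists>t\<in>S. z < t)" by blast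
  have "a < z \<and> z < r" if "z \<in> Z" for z
    using Z(3)[OF that] S(2) by force
  then show ?thesis using Z by blast
qed

lemma same_sign_no_zero:
  fixes g :: "real \<Rightarrow> real"
  assumes "continuous_on {m..r} g" "m \<le> r" "\<And>t. m < t \<Longrightarrow> t < r \<Longrightarrow> g t \<noteq> 0" "g r \<noteq> 0"
    and t: "m < t" "t < r"
  shows "g t * g r > 0"
proof (rule ccontr)
  assume neg: "\<not> g t * g r > 0"
  have c: "continuous_on {t..r} g" using assms(1) t by (rule_tac continuous_on_subset) auto
  consider "g t \<le> 0" "0 \<le> g r" | "g r \<le> 0" "0 \<le> g t" using neg by (metis linear mult_pos_pos mult_neg_neg not_less)
  then obtain z where "t \<le> z" "z \<le> r" "g z = 0"
    using IVT'[of g t 0 r, OF _ _ _ c] IVT2'[of g r 0 t, OF _ _ _ c] t by (metis less_imp_le)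
  then show False using assms by (metis dual_order.strict_trans1 order_le_less)
qed

text \<open>Two graphs \<open>hp\<close>, \<open>hm\<close> over \<open>[a, r]\<close> form one curve through their common end at \<open>r\<close>, and \<open>gp\<close>, \<open>gm\<close>
  give the derivative along this curve up to positive factors and up to the sign with which each graph
  is traversed.  Rolle's theorem on each graph loses one zero too many, and the missing one comes
  from the passage through \<open>r\<close>: if the derivative had no zero beyond the last level points, one graph
  would leave the level \<open>c\<close> upwards and the other downwards, although they meet at \<open>r\<close>, unless
  the derivative vanishes at \<open>r\<close>.\<close>

lemma two_arc_rolle:
  fixes hp hm gp gm kp km :: "real \<Rightarrow> real"
  assumes cont: "continuous_on {a..r} hp" "continuous_on {a..r} hm"
      "continuous_on {a..r} gp" "continuous_on {a..r} gm"
    and join: "hp r = hm r" "gp r = gm r"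
    and der: "\<And>t. a < t \<Longrightarrow> t < r \<Longrightarrow> (hp has_real_derivative kp t * gp t) (at t)"
      "\<And>t. a < t \<Longrightarrow> t < r \<Longrightarrow> (hm has_real_derivative - km t * gm t) (at t)"
    and k: "\<And>t. a < t \<Longrightarrow> t < r \<Longrightarrow> kp t > 0" "\<And>t. a < t \<Longrightarrow> t < r \<Longrightarrow> km t > 0"
    and S: "finite S" "S \<subseteq> {a..r}" "\<And>t. t \<in> S \<Longrightarrow> hp t = c \<or> hm t = c"
    and fin: "finite {t. a < t \<and> t < r \<and> gp t = 0}" "finite {t. a < t \<and> t < r \<and> gm t = 0}"
  shows "card S \<le> 1 + card {t. a < t \<and> t < r \<and> gp t = 0} + card {t. a < t \<and> t < r \<and> gm t = 0}
    + (if gp r = 0 then 1 else 0)"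
proof -
  define Zp where "Zp = {t. a < t \<and> t < r \<and> gp t = 0}"
  define Zm where "Zm = {t. a < t \<and> t < r \<and> gm t = 0}"
  define Sp where "Sp = {t\<in>S. hp t = c}"
  define Sm where "Sm = {t\<in>S. hm t = c}"
  note fin = fin[folded Zp_def Zm_def]
  have Sfin: "finite Sp" "finite Sm" and Ssub: "Sp \<subseteq> {a..r}" "Sm \<subseteq> {a..r}" and SU: "S = Sp \<union> Sm"
    using S by (auto simp: Sp_def Sm_def)
  obtain Yp where Yp: "finite Yp" "card Sp \<le> card Yp + 1"
    "\<And>z. z \<in> Yp \<Longrightarrow> a < z \<and> z < r \<and> kp z * gp z = 0 \<and> (\<exists>t\<in>Sp. z < t)"
    using rolle_count[OF Sfin(1) Ssub(1) _ cont(1) der(1), of c] by (auto simp: Sp_def)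
  obtain Ym where Ym: "finite Ym" "card Sm \<le> card Ym + 1"
    "\<And>z. z \<in> Ym \<Longrightarrow> a < z \<and> z < r \<and> - km z * gm z = 0 \<and> (\<exists>t\<in>Sm. z < t)"
    using rolle_count[OF Sfin(2) Ssub(2) _ cont(2) der(2), of c] by (auto simp: Sm_def)
  have YZ: "Yp \<subseteq> Zp" "Ym \<subseteq> Zm" using Yp(3) Ym(3) k unfolding Zp_def Zm_def by fastforce+
  then have cY: "card Yp \<le> card Zp" "card Ym \<le> card Zm" using fin by (auto intro: card_mono)
  have cS: "card S + card (Sp \<inter> Sm) = card Sp + card Sm"
    unfolding SU using card_Un_Int[OF Sfin] by simp
  have main: "card S \<le> 1 + card Zp + card Zm + (if gp r = 0 then 1 else 0)"
  proof (cases "Sp = {} \<or> Sm = {} \<or> r \<in> S")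
    case True
    then consider "Sp = {}" | "Sm = {}" | "r \<in> S" by blast
    then show ?thesis
    proof cases
      case 3
      \<comment> \<open>A level point at the common end is counted on both graphs, which makes up for the lost zero.\<close>
      then have "r \<in> Sp \<inter> Sm" using S(3)[of r] join by (auto simp: Sp_def Sm_def)
      then have "card (Sp \<inter> Sm) \<ge> 1" using Sfin by (metis One_nat_def Suc_leI card_gt_0_iff empty_iff finite_Int)
      then show ?thesis using cS Yp(2) Ym(2) cY by linarith
    qed (use cS Yp(2) Ym(2) cY in auto)
  next
    case False
    define mp where "mp = Max Sp" define mm where "mm = Max Sm"
    have m: "mp \<in> Sp" "mm \<in> Sm" using False Sfin by (auto simp: mp_def mm_def)
    have mr: "a \<le> mp" "mp < r" "a \<le> mm" "mm < r"
      using m Ssub False SU by (auto simp: subset_iff order_less_le)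
    have Ylt: "z < mp" if "z \<in> Yp" for z
      using Yp(3)[OF that] Sfin unfolding mp_def by (meson Max_ge order_less_le_trans)
    have Ylt': "z < mm" if "z \<in> Ym" for z
      using Ym(3)[OF that] Sfin unfolding mm_def by (meson Max_ge order_less_le_trans)
    show ?thesis
    proof (cases "(\<exists>t. mp < t \<and> t < r \<and> gp t = 0) \<or> (\<exists>t. mm < t \<and> t < r \<and> gm t = 0)")
      case True
      then show ?thesis
      proof
        assume "\<exists>t. mp < t \<and> t < r \<and> gp t = 0"
        then obtain t where t: "mp < t" "t < r" "gp t = 0" by blast
        then have "t \<in> Zp" "t \<notin> Yp" using mr Ylt[of t] by (auto simp: Zp_def)
        then have "card Yp < card Zp" using YZ fin by (metis psubset_card_mono psubsetI)
        then show ?thesis using cS Yp(2) Ym(2) cY by linarith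
      next
        assume "\<exists>t. mm < t \<and> t < r \<and> gm t = 0"
        then obtain t where t: "mm < t" "t < r" "gm t = 0" by blast
        then have "t \<in> Zm" "t \<notin> Ym" using mr Ylt'[of t] by (auto simp: Zm_def)
        then have "card Ym < card Zm" using YZ fin by (metis psubset_card_mono psubsetI)
        then show ?thesis using cS Yp(2) Ym(2) cY by linarith
      qed
    next
      case noz: False
      \<comment> \<open>The remaining case: no zero of the derivative between the last level points and \<open>r\<close>.\<close>
      have "gp r = 0"
      proof (rule ccontr)
        assume g: "gp r \<noteq> 0"
        have cp: "continuous_on {mp..r} gp" "continuous_on {mp..r} hp"
          and cm: "continuous_on {mm..r} gm" "continuous_on {mm..r} hm"
          using mr by (auto intro: continuous_on_subset[OF cont(1)] continuous_on_subset[OF cont(2)]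
              continuous_on_subset[OF cont(3)] continuous_on_subset[OF cont(4)])
        have sp: "gp t * gp r > 0" if "mp < t" "t < r" for t
          using noz g that mr by (intro same_sign_no_zero[OF cp(1)]) auto
        have sm: "gm t * gp r > 0" if "mm < t" "t < r" for t
          using noz g that mr unfolding join by (intro same_sign_no_zero[OF cm(1)]) (auto simp: join)
        have e: "hp mp = c" "hm mm = c" using m by (auto simp: Sp_def Sm_def)
        have "hp mp * gp r < hp r * gp r"
        proof (rule DERIV_pos_imp_increasing_open[OF mr(2)])
          fix t assume t: "mp < t" "t < r"
          show "\<exists>d. DERIV (\<lambda>t. hp t * gp r) t :> d \<and> d > 0"
            using DERIV_cmult_right[OF der(1)[of t], of "gp r"] sp[OF t] k(1)[of t] mr t
            by (intro exI[of _ "kp t * gp t * gp r"]) (auto simp: mult.assoc)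
        qed (intro continuous_intros cp)
        moreover have "hm mm * gp r > hm r * gp r"
        proof (rule DERIV_neg_imp_decreasing_open[OF mr(4)])
          fix t assume t: "mm < t" "t < r"
          show "\<exists>d. DERIV (\<lambda>t. hm t * gp r) t :> d \<and> d < 0"
            using DERIV_cmult_right[OF der(2)[of t], of "gp r"] sm[OF t] k(2)[of t] mr t
            by (intro exI[of _ "- km t * gm t * gp r"]) (auto simp: mult.assoc)
        qed (intro continuous_intros cm)
        ultimately show False using e join by simp
      qed
      then show ?thesis using cS Yp(2) Ym(2) cY by simp
    qed
  qed
  then show ?thesis unfolding Zp_def Zm_def .
qed

text \<open>The signs of a nonzero quadratic polynomial cannot alternate weakly over four points, as its third divided
  difference vanishes.\<close>

lemma quadratic_sign_pattern:
  fixes \<alpha> \<beta> \<gamma> :: real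
  defines "\<Delta> \<equiv> \<lambda>t. \<alpha> * t\<^sup>2 + \<beta> * t + \<gamma>"
  assumes "x1 < x2" "x2 < x3" "x3 < x4" "\<Delta> x1 \<ge> 0" "\<Delta> x2 \<le> 0" "\<Delta> x3 \<ge> 0" "\<Delta> x4 \<le> 0"
  shows "\<alpha> = 0 \<and> \<beta> = 0 \<and> \<gamma> = 0"
proof -
  define V where "V a b c = (b - a) * (c - a) * (c - b)" for a b c :: real
  have V: "V a b c > 0" if "a < b" "b < c" for a b c using that by (simp add: V_def)
  \<comment> \<open>The third divided difference, multiplied by the full Vandermonde product.\<close>
  have id: "\<Delta> x1 * V x2 x3 x4 - \<Delta> x2 * V x1 x3 x4 + \<Delta> x3 * V x1 x2 x4 - \<Delta> x4 * V x1 x2 x3 = 0"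
    unfolding \<Delta>_def V_def by (simp add: power2_eq_square algebra_simps)
  have V4: "V x2 x3 x4 > 0" "V x1 x3 x4 > 0" "V x1 x2 x4 > 0" "V x1 x2 x3 > 0"
    using assms by (auto intro!: V)
  then have "\<Delta> x1 * V x2 x3 x4 \<ge> 0" "\<Delta> x2 * V x1 x3 x4 \<le> 0" "\<Delta> x3 * V x1 x2 x4 \<ge> 0" "\<Delta> x4 * V x1 x2 x3 \<le> 0"
    using assms by (auto intro: mult_nonneg_nonneg mult_nonpos_nonneg)
  then have "\<Delta> x1 * V x2 x3 x4 = 0" "\<Delta> x2 * V x1 x3 x4 = 0" "\<Delta> x3 * V x1 x2 x4 = 0"
    using id by linarith+
  then have z: "\<Delta> x1 = 0" "\<Delta> x2 = 0" "\<Delta> x3 = 0" using V4 by auto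
  have "(\<alpha> * (x1 + x2) + \<beta>) * (x1 - x2) = 0" "(\<alpha> * (x2 + x3) + \<beta>) * (x2 - x3) = 0"
    using z unfolding \<Delta>_def by (simp_all add: power2_eq_square algebra_simps)
  then have e: "\<alpha> * (x1 + x2) + \<beta> = 0" "\<alpha> * (x2 + x3) + \<beta> = 0" using assms by auto
  have "\<alpha> * (x1 - x3) = (\<alpha> * (x1 + x2) + \<beta>) - (\<alpha> * (x2 + x3) + \<beta>)" by (simp add: algebra_simps)
  then have "\<alpha> * (x1 - x3) = 0" unfolding e by simp
  then have "\<alpha> = 0" using assms by auto
  then show ?thesis using e z by (simp add: \<Delta>_def)
qed

section \<open>The polynomials of the system along the left level curves\<close>

locale focus_focus =
  fixes AL AR :: "real^2^2" and bL bR :: "real^2"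
  assumes a12: "AL$1$2 * AR$1$2 > 0"
    and focL: "(TL AL)\<^sup>2 < 4 * DL AL" and focR: "(TR AR)\<^sup>2 < 4 * DR AR"
    and coeff6: "coeff (R AL bL AR bR) 6 \<noteq> 0"
begin

abbreviation "b \<equiv> bstar AL bL AR bR"
abbreviation "\<mu>0 \<equiv> m0 AL bL AR bR b"
abbreviation "\<mu>1 \<equiv> m1 AL bL AR bR b"
abbreviation "\<mu>2 \<equiv> m2 AL bL AR bR b"
abbreviation "\<mu>3 \<equiv> m3 AL bL AR b"
abbreviation "\<mu>4 \<equiv> m4 AL bL AR bR b"
abbreviation "\<mu>5 \<equiv> m5 AL bL AR bR b"
abbreviation "Ft \<equiv> Ftilde AL bL AR bR b"
abbreviation "Gt \<equiv> Gtilde AL bL AR bR b"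
abbreviation "Res \<equiv> R AL bL AR bR"
abbreviation "W \<equiv> focus_quadratic (TL AL) (DL AL) (aL AL bL)"
abbreviation "WR \<equiv> focus_quadratic (TR AR) (DR AR) (aR AL AR bR)"
abbreviation "\<Phi> \<equiv> focus_potential (TL AL) (DL AL) (aL AL bL)"
abbreviation "\<Phi>R \<equiv> focus_potential (TR AR) (DR AR) (aR AL AR bR)"

lemma Res_nonzero: "Res \<noteq> 0" using coeff6 by auto

lemma Res_eq: "Res = resultant Ft Gt" by (simp add: R_def)

lemma Ft_eq: "Ft = [: [:\<mu>0, \<mu>2 - 2 * \<mu>3, \<mu>5:], [:\<mu>1, \<mu>4:], [:\<mu>3:] :]" by (rule Ftilde_eq)

lemma WL_eq: "WL AL bL y = W y" by (simp add: WL_def focus_quadratic_def mult_ac)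

text \<open>The left-hand side is, up to a nonzero factor, the derivative of the right matching function along
  the left level curve; this identity is the origin of \<open>F\<close>.\<close>

lemma F_dynamical:
  "(y0 - b) * WR (y1 - b) * (y1 * W y0) - (y1 - b) * WR (y0 - b) * (y0 * W y1)
    = (y0 - y1) * F AL bL AR bR b y0 y1"
  unfolding F_def m0_def m1_def m2_def m3_def m4_def m5_def focus_quadratic_def
  by (simp add: power2_eq_square power3_eq_cube algebra_simps)

text \<open>The two parentheses are the partial derivatives of \<open>F\<close>, expressed through those of the polynomial in
  the symmetric coordinates.\<close>

lemma G_gradient:
  "G AL bL AR bR b y0 y1 =
     - (y1 * W y0 * ((2 * \<mu>3 * (y0 + y1) + \<mu>1 + \<mu>4 * (y0 * y1))
          + y1 * (\<mu>4 * (y0 + y1) + (\<mu>2 - 2 * \<mu>3) + 2 * \<mu>5 * (y0 * y1)))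
      + y0 * W y1 * ((2 * \<mu>3 * (y0 + y1) + \<mu>1 + \<mu>4 * (y0 * y1))
          + y0 * (\<mu>4 * (y0 + y1) + (\<mu>2 - 2 * \<mu>3) + 2 * \<mu>5 * (y0 * y1))))"
  unfolding G_def WL_eq deriv_F_left deriv_F_right
  by (simp add: power2_eq_square algebra_simps)

lemma eval2_Ft: "eval2 Ft Y t = \<mu>3 * Y\<^sup>2 + (\<mu>1 + \<mu>4 * t) * Y + (\<mu>0 + (\<mu>2 - 2 * \<mu>3) * t + \<mu>5 * t\<^sup>2)"
  unfolding Ft_eq by (simp add: eval2_def power2_eq_square algebra_simps)

lemma eval2_dvd: "eval2 q Y t = 0 \<longleftrightarrow> [:- t, 1:] dvd poly q [:Y:]"
  by (simp add: eval2_def poly_eq_0_iff_dvd)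

lemma degree_sum_pos: "degree Ft + degree Gt > 0"
proof (rule ccontr)
  assume "\<not> ?thesis"
  then have "degree Ft = 0" "degree Gt = 0" by auto
  then obtain c where "Ft = [:c:]" by (meson degree_eq_zeroE)
  then have "Res = 1" using \<open>degree Gt = 0\<close> by (simp add: Res_eq)
  then show False using coeff6 by simp
qed

lemma common_zero_root: "eval2 Ft Y t = 0 \<Longrightarrow> eval2 Gt Y t = 0 \<Longrightarrow> poly Res t = 0"
  unfolding eval2_dvd poly_eq_0_iff_dvd Res_eq
  by (rule resultant_dvd_common_root[OF degree_sum_pos])

lemma two_common_zeros_double_root:
  assumes "Y \<noteq> Y'" "b \<noteq> 0" "aL AL bL \<noteq> 0"
    "eval2 Ft Y t = 0" "eval2 Gt Y t = 0" "eval2 Ft Y' t = 0" "eval2 Gt Y' t = 0"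
  shows "[:- t, 1:]\<^sup>2 dvd Res"
  unfolding Res_eq
proof (rule resultant_dvd_two_common_roots)
  have "DR AR \<noteq> 0" using focus_det_pos[OF focR] by simp
  then have "\<mu>3 \<noteq> 0" using assms by (simp add: m3_def)
  then show "degree Ft + degree Gt \<ge> 2" unfolding Ft_eq by simp
  have "[:Y:] - [:Y':] = [:Y - Y':]" by simp
  then show "[:Y:] - [:Y':] dvd 1" using assms(1) by (simp add: is_unit_const_poly_iff)
qed (use assms in \<open>simp_all add: eval2_dvd\<close>)

text \<open>For \<open>a\<^sub>L = 0\<close> only few coefficients survive, and the resultant of the remaining polynomials, which are
  at most linear in \<open>Y0\<close>, has degree at most 5.\<close>

lemma aL_nonzero: "aL AL bL \<noteq> 0"
proof
  assume aL0: "aL AL bL = 0"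
  have m: "\<mu>0 = 0" "\<mu>1 = 0" "\<mu>3 = 0" using aL0 by (simp_all add: m0_def m1_def m3_def)
  have F: "Ft = [: [:0, \<mu>2, \<mu>5:], [:0, \<mu>4:] :]" unfolding Ft_eq m by simp
  have G: "Gt = - [: [:0, 0, 2 * DL AL * \<mu>2, 4 * DL AL * \<mu>5:], [:0, 0, 3 * DL AL * \<mu>4:] :]"
    unfolding Gtilde_eq m aL0 by simp
  show False
  proof (cases "\<mu>4 = 0")
    case True
    then have "Ft = [: [:0, \<mu>2, \<mu>5:] :]" "degree Gt = 0" unfolding F G by simp_all
    then have "Res = 1" by (simp add: Res_eq)
    then show False using coeff6 by simp
  next
    case False
    have DL: "DL AL \<noteq> 0" using focus_det_pos[OF focL] by simp
    have "degree (resultant Ft Gt) \<le> 2 + 3"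
    proof (rule degree_resultant_linear_le)
      show "degree Ft = 1" "degree Gt = 1" unfolding F G using False DL by simp_all
      show "degree (coeff Ft i) \<le> 2" for i unfolding F
        by (auto simp: coeff_pCons split: nat.split)
      show "degree (coeff Gt i) \<le> 3" for i unfolding G
        by (auto simp: coeff_pCons split: nat.split)
    qed
    then have "coeff Res 6 = 0" unfolding Res_eq by (intro coeff_eq_0) simp
    then show False using coeff6 by simp
  qed
qed

end

text \<open>The pair \<open>y0, y1\<close> is recovered from sum and product; a negative product separates the signs.\<close>

lemma vieta_roots:
  fixes Y t :: real
  assumes "t \<le> 0"
  defines "s \<equiv> sqrt (Y\<^sup>2 - 4 * t)"
  shows "(Y + s) / 2 + (Y - s) / 2 = Y" "(Y + s) / 2 * ((Y - s) / 2) = t"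
    and "t < 0 \<Longrightarrow> s > 0" and "t < 0 \<Longrightarrow> (Y + s) / 2 > 0" and "t < 0 \<Longrightarrow> (Y - s) / 2 < 0"
proof -
  have "s\<^sup>2 = Y\<^sup>2 - 4 * t" unfolding s_def using assms(1) by (intro real_sqrt_pow2) (smt (verit) zero_le_power2)
  then show "(Y + s) / 2 + (Y - s) / 2 = Y" and pr: "(Y + s) / 2 * ((Y - s) / 2) = t"
    by (simp_all add: field_simps power2_eq_square)
  assume t: "t < 0"
  show "s > 0" unfolding s_def using t by (smt (verit) real_sqrt_gt_zero zero_le_power2)
  then have gt: "(Y - s) / 2 < (Y + s) / 2" by simp
  have "(Y + s) / 2 * ((Y - s) / 2) < 0" using pr t by simp
  then show "(Y + s) / 2 > 0" "(Y - s) / 2 < 0"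
    using gt by (auto simp: mult_less_0_iff)
qed

lemma eval2_continuous:
  assumes "continuous_on X p"
  shows "continuous_on X (\<lambda>t. eval2 q (p t) t)"
proof (induction q)
  case 0
  then show ?case by (simp add: eval2_def)
next
  case (pCons a q)
  have "eval2 (pCons a q) (p t) t = poly a t + p t * eval2 q (p t) t" for t by (simp add: eval2_def)
  then show ?case using pCons.IH assms by (simp add: continuous_intros)
qed

context focus_focus
begin

text \<open>The left matching function in symmetric coordinates.\<close>

definition level :: "real \<Rightarrow> real \<Rightarrow> real" where
  "level Y t = \<Phi> ((Y + sqrt (Y\<^sup>2 - 4 * t)) / 2) - \<Phi> ((Y - sqrt (Y\<^sup>2 - 4 * t)) / 2)"

text \<open>The positive factor in the denominator of the derivative of \<open>level\<close> along a curve \<open>F = 0\<close>.\<close>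

definition weight :: "real \<Rightarrow> real \<Rightarrow> real" where
  "weight Y t = sqrt (Y\<^sup>2 - 4 * t) * W ((Y + sqrt (Y\<^sup>2 - 4 * t)) / 2) * W ((Y - sqrt (Y\<^sup>2 - 4 * t)) / 2)"

lemma W_pos: "W y > 0" using focus_quadratic_pos[OF focL] aL_nonzero by blast

lemma weight_pos: "t < 0 \<Longrightarrow> weight Y t > 0"
  unfolding weight_def using vieta_roots(3)[of t Y] W_pos by simp

lemma level_continuous:
  assumes "continuous_on A p"
  shows "continuous_on A (\<lambda>t. level (p t) t)"
  unfolding level_def
  by (intro continuous_intros continuous_on_compose2[OF focus_potential_continuous[OF focL aL_nonzero, of UNIV]] assms) auto

text \<open>Along a graph \<open>Y0 = p Y1\<close> on which \<open>F\<close> is constant, the implicit derivative \<open>p'\<close> can be eliminated, and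
  what remains is \<open>G\<close>, divided by positive quantities and by the \<open>Y0\<close>-derivative of \<open>F\<close>.\<close>

lemma level_deriv:
  assumes t: "t < 0" and p: "(p has_real_derivative p') (at t)"
    and tangent: "(2 * \<mu>3 * p t + \<mu>1 + \<mu>4 * t) * p' + (\<mu>4 * p t + (\<mu>2 - 2 * \<mu>3) + 2 * \<mu>5 * t) = 0"
    and transv: "2 * \<mu>3 * p t + \<mu>1 + \<mu>4 * t \<noteq> 0"
  shows "((\<lambda>t. level (p t) t) has_real_derivative
     eval2 Gt (p t) t / (weight (p t) t * (2 * \<mu>3 * p t + \<mu>1 + \<mu>4 * t))) (at t)"
proof -
  define s where "s = sqrt ((p t)\<^sup>2 - 4 * t)"
  define y0 where "y0 = (p t + s) / 2" define y1 where "y1 = (p t - s) / 2"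
  define f0 where "f0 = 2 * \<mu>3 * p t + \<mu>1 + \<mu>4 * t"
  define f1 where "f1 = \<mu>4 * p t + (\<mu>2 - 2 * \<mu>3) + 2 * \<mu>5 * t"
  have s: "s > 0" and y: "y0 > 0" "y1 < 0" and sum: "y0 + y1 = p t" and prod: "y0 * y1 = t"
    using vieta_roots[of t "p t"] t by (auto simp: s_def y0_def y1_def)
  have pos: "(p t)\<^sup>2 - 4 * t > 0" using t by (smt (verit) zero_le_power2)
  have ds: "((\<lambda>t. sqrt ((p t)\<^sup>2 - 4 * t)) has_real_derivative (p t * p' - 2) / s) (at t)"
    using pos unfolding s_def
    by (auto intro!: derivative_eq_intros p simp: field_simps)
  have d0: "((\<lambda>t. (p t + sqrt ((p t)\<^sup>2 - 4 * t)) / 2) has_real_derivative (y0 * p' - 1) / s) (at t)"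
  proof -
    have "(p' + (p t * p' - 2) / s) / 2 = (y0 * p' - 1) / s"
      using s by (simp add: y0_def field_simps)
    then show ?thesis by (rule DERIV_cong[OF DERIV_cdivide[OF DERIV_add[OF p ds]]])
  qed
  have d1: "((\<lambda>t. (p t - sqrt ((p t)\<^sup>2 - 4 * t)) / 2) has_real_derivative (1 - y1 * p') / s) (at t)"
  proof -
    have "(p' - (p t * p' - 2) / s) / 2 = (1 - y1 * p') / s"
      using s by (simp add: y1_def field_simps)
    then show ?thesis by (rule DERIV_cong[OF DERIV_cdivide[OF DERIV_diff[OF p ds]]])
  qed
  have W: "W y0 > 0" "W y1 > 0" by (rule W_pos)+
  have d: "(\<Phi> has_real_derivative y / W y) (at y)" for y
    using focus_potential_deriv[OF focL] aL_nonzero by blast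
  have d0': "(\<Phi> has_real_derivative y0 / W y0) (at ((p t + sqrt ((p t)\<^sup>2 - 4 * t)) / 2))"
    using d[of y0] by (simp only: y0_def s_def)
  have d1': "(\<Phi> has_real_derivative y1 / W y1) (at ((p t - sqrt ((p t)\<^sup>2 - 4 * t)) / 2))"
    using d[of y1] by (simp only: y1_def s_def)
  have "((\<lambda>t. level (p t) t) has_real_derivative
      y0 / W y0 * ((y0 * p' - 1) / s) - y1 / W y1 * ((1 - y1 * p') / s)) (at t)"
    unfolding level_def
    by (rule DERIV_diff[OF DERIV_chain2[OF d0' d0] DERIV_chain2[OF d1' d1]])
  moreover have "y0 / W y0 * ((y0 * p' - 1) / s) - y1 / W y1 * ((1 - y1 * p') / s)
      = eval2 Gt (p t) t / (weight (p t) t * f0)"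
  proof -
    have w: "weight (p t) t = s * W y0 * W y1" by (simp add: weight_def s_def y0_def y1_def)
    have G: "eval2 Gt (p t) t = - (y1 * W y0 * (f0 + y1 * f1) + y0 * W y1 * (f0 + y0 * f1))"
      using eval2_Gtilde[of AL bL AR bR b y0 y1] unfolding G_gradient sum prod
      by (simp add: f0_def f1_def)
    have f0: "f0 \<noteq> 0" using transv by (simp add: f0_def)
    have f1: "f1 = - (f0 * p')" using tangent by (simp add: f0_def f1_def)
    have "y0 / W y0 * ((y0 * p' - 1) / s) - y1 / W y1 * ((1 - y1 * p') / s)
      = (y0 * (y0 * p' - 1) * W y1 - y1 * (1 - y1 * p') * W y0) / (s * W y0 * W y1)"
      using W s by (simp add: field_simps)
    also have "\<dots> = f0 * (y0 * (y0 * p' - 1) * W y1 - y1 * (1 - y1 * p') * W y0) / (s * W y0 * W y1 * f0)"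
      using f0 by simp
    also have "f0 * (y0 * (y0 * p' - 1) * W y1 - y1 * (1 - y1 * p') * W y0) = eval2 Gt (p t) t"
      unfolding G f1 by (simp add: algebra_simps)
    finally show ?thesis unfolding w .
  qed
  ultimately show ?thesis unfolding f0_def by simp
qed

abbreviation "root_count \<equiv> size (filter_mset (\<lambda>y. y \<le> 0) (proots Res))"

text \<open>For \<open>b = 0\<close> the conic splits off the line \<open>Y1 = 0\<close>; the zeros of the other factor form a graph over
  \<open>Y1\<close> or lie over at most one value of \<open>Y1\<close>.\<close>

lemma curve_points_bound_line:
  assumes b0: "b = 0" and S: "finite S"
    "\<And>t. t \<in> S \<Longrightarrow> t < 0 \<and> (\<exists>Y. eval2 Ft Y t = 0 \<and> level Y t = c)"
  shows "card S \<le> root_count + 1"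
proof -
  have m: "\<mu>0 = 0" "\<mu>1 = 0" "\<mu>3 = 0" using b0 by (simp_all add: m0_def m1_def m3_def)
  have ev: "eval2 Ft Y t = t * (\<mu>2 + \<mu>4 * Y + \<mu>5 * t)" for Y t
    unfolding eval2_Ft m by (simp add: power2_eq_square algebra_simps)
  show ?thesis
  proof (cases "\<mu>4 = 0")
    case True
    have nz: "\<mu>2 \<noteq> 0 \<or> \<mu>5 \<noteq> 0"
    proof (rule ccontr)
      assume "\<not> ?thesis"
      then have "Ft = 0" unfolding Ft_eq m True by simp
      then have "Res = (if degree Gt = 0 then 1 else 0)" unfolding Res_eq by (simp add: resultant_def)
      then show False using coeff6 by (simp split: if_splits)
    qed
    have "t = - \<mu>2 / \<mu>5" if "t \<in> S" for t
    proof -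
      have "\<mu>2 + \<mu>5 * t = 0" using S(2)[OF that] unfolding ev True by auto
      moreover from this have "\<mu>5 \<noteq> 0" using nz by auto
      ultimately have "t * \<mu>5 = - \<mu>2" "\<mu>5 \<noteq> 0" by (simp_all add: add_eq_0_iff mult.commute)
      then show ?thesis by (metis nonzero_mult_div_cancel_right)
    qed
    then have "S \<subseteq> {- \<mu>2 / \<mu>5}" by blast
    then have "card S \<le> card {- \<mu>2 / \<mu>5}" by (intro card_mono) auto
    then show ?thesis by simp
  next
    case False
    define p where "p t = - (\<mu>2 + \<mu>5 * t) / \<mu>4" for t
    have onp: "eval2 Ft (p t) t = 0" for t using False unfolding ev p_def by simp
    have lev: "level (p t) t = c" if tS: "t \<in> S" for t
    proof -
      obtain Y where Y: "eval2 Ft Y t = 0" "level Y t = c" "t < 0" using S(2)[OF tS] by blast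
      then have "\<mu>2 + \<mu>4 * Y + \<mu>5 * t = 0" unfolding ev by auto
      then have "(\<mu>2 + \<mu>5 * t) + Y * \<mu>4 = 0" by (simp add: algebra_simps)
      then have "Y * \<mu>4 = - (\<mu>2 + \<mu>5 * t)" by (simp only: add_eq_0_iff)
      then have "Y = p t" using False by (simp add: p_def eq_divide_eq)
      then show ?thesis using Y by simp
    qed
    show ?thesis
    proof (cases "S = {}")
      case False
      define h' where "h' t = eval2 Gt (p t) t / (weight (p t) t * (2 * \<mu>3 * p t + \<mu>1 + \<mu>4 * t))" for t
      have mx: "Max S < 0" using S False by simp
      have "\<exists>Z. finite Z \<and> card S \<le> card Z + 1 \<and>
        (\<forall>z\<in>Z. Min S < z \<and> z < Max S \<and> h' z = 0 \<and> (\<exists>t\<in>S. z < t))"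
      proof (rule rolle_count)
        show "S \<subseteq> {Min S..Max S}" using S(1) by auto
        show "continuous_on {Min S..Max S} (\<lambda>t. level (p t) t)"
          unfolding p_def by (intro level_continuous continuous_intros) (use \<open>\<mu>4 \<noteq> 0\<close> in auto)
        fix t assume "Min S < t" "t < Max S"
        then have t: "t < 0" using mx by simp
        show "((\<lambda>t. level (p t) t) has_real_derivative h' t) (at t)"
          unfolding h'_def
        proof (rule level_deriv[OF t])
          show "(p has_real_derivative - \<mu>5 / \<mu>4) (at t)"
            unfolding p_def[abs_def] using \<open>\<mu>4 \<noteq> 0\<close> by (auto intro!: derivative_eq_intros)
          have "\<mu>4 * p t = - (\<mu>2 + \<mu>5 * t)" "\<mu>4 * t * (- \<mu>5 / \<mu>4) = - (\<mu>5 * t)"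
            using \<open>\<mu>4 \<noteq> 0\<close> by (simp_all add: p_def)
          then show "(2 * \<mu>3 * p t + \<mu>1 + \<mu>4 * t) * (- \<mu>5 / \<mu>4)
              + (\<mu>4 * p t + (\<mu>2 - 2 * \<mu>3) + 2 * \<mu>5 * t) = 0"
            unfolding m by simp
          show "2 * \<mu>3 * p t + \<mu>1 + \<mu>4 * t \<noteq> 0" using \<open>\<mu>4 \<noteq> 0\<close> t unfolding m by simp
        qed
      qed (use S(1) lev in auto)
      then obtain Z where Z: "finite Z" "card S \<le> card Z + 1" "\<And>z. z \<in> Z \<Longrightarrow> z < Max S \<and> h' z = 0" by blast
      have root: "z \<le> 0 \<and> poly Res z = 0" if "z \<in> Z" for z
      proof -
        have z: "z < 0" "h' z = 0" using Z(3)[OF that] mx by auto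
        then have "eval2 Gt (p z) z = 0"
          using weight_pos[OF z(1), of "p z"] \<open>\<mu>4 \<noteq> 0\<close> by (auto simp: h'_def m)
        then show ?thesis using common_zero_root[OF onp] z by auto
      qed
      have "card Z + card ({} :: real set) \<le> root_count"
        by (rule mset_roots_bound[OF Res_nonzero Z(1)]) (use root in auto)
      then show ?thesis using Z(2) by simp
    qed simp
  qed
qed

text \<open>For \<open>b \<noteq> 0\<close> the conic has two points over \<open>Y1\<close> when the discriminant \<open>\<Delta>\<close> is positive.  The value
  \<open>\<Delta> 0\<close> is not positive because the right field has a focus, so \<open>\<Delta>\<close> has a root \<open>r \<le> 0\<close> that
  no point of \<open>S\<close> exceeds.  The two arcs meet at \<open>r\<close>, and by its sign pattern \<open>\<Delta>\<close> is positive between the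
  lowest point of \<open>S\<close> and \<open>r\<close>, so that \<open>two_arc_rolle\<close> applies.\<close>

lemma curve_points_bound_conic:
  assumes b0: "b \<noteq> 0" and S: "finite S"
    "\<And>t. t \<in> S \<Longrightarrow> t < 0 \<and> (\<exists>Y. eval2 Ft Y t = 0 \<and> level Y t = c)"
  shows "card S \<le> root_count + 1"
proof (cases "card S \<le> 1")
  case False
  have m3: "\<mu>3 \<noteq> 0" using b0 aL_nonzero focus_det_pos[OF focR] by (simp add: m3_def)
  define B where "B t = \<mu>1 + \<mu>4 * t" for t
  define C where "C t = \<mu>0 + (\<mu>2 - 2 * \<mu>3) * t + \<mu>5 * t\<^sup>2" for t
  define \<Delta> where "\<Delta> t = (B t)\<^sup>2 - 4 * \<mu>3 * C t" for t
  have ev: "4 * \<mu>3 * eval2 Ft Y t = (2 * \<mu>3 * Y + B t)\<^sup>2 - \<Delta> t" for Y t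
    unfolding eval2_Ft \<Delta>_def B_def C_def by (simp add: power2_eq_square algebra_simps)
  have ev0: "eval2 Ft Y t = 0 \<longleftrightarrow> (2 * \<mu>3 * Y + B t)\<^sup>2 = \<Delta> t" for Y t
    using ev[of Y t] m3 by auto
  define q2 where "q2 = \<mu>4\<^sup>2 - 4 * \<mu>3 * \<mu>5"
  define q1 where "q1 = 2 * \<mu>1 * \<mu>4 - 4 * \<mu>3 * (\<mu>2 - 2 * \<mu>3)"
  define q0 where "q0 = \<mu>1\<^sup>2 - 4 * \<mu>3 * \<mu>0"
  have \<Delta>q: "\<Delta> t = q2 * t\<^sup>2 + q1 * t + q0" for t
    by (simp add: \<Delta>_def B_def C_def q2_def q1_def q0_def power2_eq_square algebra_simps)
  have cont\<Delta>: "continuous_on X \<Delta>" for X unfolding \<Delta>q[abs_def] by (intro continuous_intros)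
  have "\<Delta> 0 = (aL AL bL ^ 2 * b * aR AL AR bR)\<^sup>2 * ((TR AR)\<^sup>2 - 4 * DR AR)"
    by (simp add: \<Delta>_def B_def C_def m0_def m1_def m3_def power2_eq_square power3_eq_cube algebra_simps)
  moreover have "(aL AL bL ^ 2 * b * aR AL AR bR)\<^sup>2 * ((TR AR)\<^sup>2 - 4 * DR AR) \<le> 0"
    using focR by (intro mult_nonneg_nonpos) auto
  ultimately have \<Delta>0: "\<Delta> 0 \<le> 0" by simp
  have S\<Delta>: "\<Delta> t \<ge> 0" if "t \<in> S" for t using S(2)[OF that] unfolding ev0 by (metis zero_le_power2)
  \<comment> \<open>If \<open>\<Delta>\<close> vanished identically, the conic would be a double line: all its points would be
    singular, so \<open>G\<close> would vanish on all of it and \<open>R\<close> would be zero.\<close>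
  have not_zero: "\<not> (q2 = 0 \<and> q1 = 0 \<and> q0 = 0)"
  proof
    assume q: "q2 = 0 \<and> q1 = 0 \<and> q0 = 0"
    have "poly Res t = 0" if t: "t < 0" for t
    proof (rule common_zero_root)
      define Y where "Y = - B t / (2 * \<mu>3)"
      have Y: "2 * \<mu>3 * Y + B t = 0" using m3 by (simp add: Y_def)
      have f0: "2 * \<mu>3 * Y + \<mu>1 + \<mu>4 * t = 0" using Y by (simp add: B_def)
      show "eval2 Ft Y t = 0" unfolding ev0 Y \<Delta>q using q by simp
      have "2 * \<mu>3 * (\<mu>4 * Y + (\<mu>2 - 2 * \<mu>3) + 2 * \<mu>5 * t)
        = \<mu>4 * (2 * \<mu>3 * Y) + 2 * \<mu>3 * (\<mu>2 - 2 * \<mu>3) + 4 * \<mu>3 * \<mu>5 * t" by (simp add: algebra_simps)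
      also have "2 * \<mu>3 * Y = - B t" using Y by simp
      also have "\<mu>4 * (- B t) + 2 * \<mu>3 * (\<mu>2 - 2 * \<mu>3) + 4 * \<mu>3 * \<mu>5 * t = - q1 / 2 - q2 * t"
        by (simp add: B_def q1_def q2_def power2_eq_square field_simps)
      finally have f1: "\<mu>4 * Y + (\<mu>2 - 2 * \<mu>3) + 2 * \<mu>5 * t = 0" using q m3 by simp
      define s where "s = sqrt (Y\<^sup>2 - 4 * t)"
      have v: "(Y + s) / 2 + (Y - s) / 2 = Y" "(Y + s) / 2 * ((Y - s) / 2) = t"
        using vieta_roots(1,2)[of t Y] t by (auto simp: s_def)
      show "eval2 Gt Y t = 0"
        using eval2_Gtilde[of AL bL AR bR b "(Y + s) / 2" "(Y - s) / 2"]
        unfolding G_gradient v f0 f1 by simp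
    qed
    then have "{..<0} \<subseteq> {t. poly Res t = 0}" by auto
    then have "finite {..<(0::real)}" using poly_roots_finite[OF Res_nonzero] finite_subset by blast
    then show False by (simp add: infinite_Iio)
  qed
  define lo where "lo = Min S" define hi where "hi = Max S"
  have S1: "S \<noteq> {}" using False by auto
  have lohi: "lo \<in> S" "hi \<in> S" "lo < hi" "hi < 0"
  proof -
    show "lo \<in> S" "hi \<in> S" using S(1) S1 by (auto simp: lo_def hi_def)
    then show "hi < 0" using S(2) by blast
    show "lo < hi"
    proof (rule ccontr)
      assume "\<not> lo < hi"
      have "S \<subseteq> {lo}"
      proof
        fix t assume "t \<in> S"
        then have "lo \<le> t" "t \<le> hi" using S(1) by (simp_all add: lo_def hi_def)
        then show "t \<in> {lo}" using \<open>\<not> lo < hi\<close> by simp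
      qed
      then have "card S \<le> card {lo}" by (intro card_mono) auto
      then show False using False by simp
    qed
  qed
  \<comment> \<open>The least root above \<open>S\<close>, so that \<open>\<Delta>\<close> does not change sign before \<open>r\<close>.\<close>
  define A where "A = {t \<in> {hi..0}. \<Delta> t = 0}"
  have "compact A" unfolding A_def
    using continuous_closed_preimage_constant[OF cont\<Delta> closed_atLeastAtMost, of hi 0 0]
      bounded_subset[OF bounded_closed_interval[of hi 0], of "{t \<in> {hi..0}. \<Delta> t = 0}"]
    by (simp add: compact_eq_bounded_closed subset_iff)
  moreover have "A \<noteq> {}"
  proof -
    obtain z where "hi \<le> z" "z \<le> 0" "\<Delta> z = 0"
      using IVT2'[of \<Delta> 0 0 hi, OF \<Delta>0 S\<Delta>[OF lohi(2)] _ cont\<Delta>] lohi by auto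
    then show ?thesis unfolding A_def by auto
  qed
  ultimately obtain r where "r \<in> A" and least: "\<And>z. z \<in> A \<Longrightarrow> r \<le> z"
    using compact_attains_inf by meson
  then have r: "hi \<le> r" "r \<le> 0" "\<Delta> r = 0" by (auto simp: A_def)
  have \<Delta>pos: "\<Delta> t > 0" if t: "lo < t" "t < r" for t
  proof (rule ccontr)
    assume neg: "\<not> \<Delta> t > 0"
    show False
    proof (cases "t < hi")
      case True
      have "q2 = 0 \<and> q1 = 0 \<and> q0 = 0"
        by (rule quadratic_sign_pattern[of lo t hi 0 q2 q1 q0, folded \<Delta>q]) (use t True lohi S\<Delta> neg \<Delta>0 in auto)
      then show False using not_zero by simp
    next
      case False
      obtain z where "hi \<le> z" "z \<le> t" "\<Delta> z = 0"
        using IVT2'[of \<Delta> t 0 hi, OF _ S\<Delta>[OF lohi(2)] _ cont\<Delta>] neg False by auto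
      then have "z \<in> A" using t r by (auto simp: A_def)
      then show False using least \<open>z \<le> t\<close> t by fastforce
    qed
  qed
  define p where "p \<sigma> t = (- B t + \<sigma> * sqrt (\<Delta> t)) / (2 * \<mu>3)" for \<sigma> t
  have p_eq: "2 * \<mu>3 * p \<sigma> t + B t = \<sigma> * sqrt (\<Delta> t)" for \<sigma> t using m3 by (simp add: p_def)
  have contp: "continuous_on X (p \<sigma>)" for X \<sigma>
    unfolding p_def[abs_def] B_def using m3 by (intro continuous_intros cont\<Delta>) auto
  have onp: "eval2 Ft (p \<sigma> t) t = 0" if "\<sigma>\<^sup>2 = 1" "\<Delta> t \<ge> 0" for \<sigma> t
    unfolding ev0 p_eq using that by (simp add: power_mult_distrib)
  have der: "((\<lambda>t. level (p \<sigma> t) t) has_real_derivative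
      eval2 Gt (p \<sigma> t) t / (weight (p \<sigma> t) t * (\<sigma> * sqrt (\<Delta> t)))) (at t)"
    if \<sigma>: "\<sigma>\<^sup>2 = 1" and t: "lo < t" "t < r" for \<sigma> t
  proof -
    have t0: "t < 0" using t r by simp
    have D: "\<Delta> t > 0" by (rule \<Delta>pos[OF t])
    let ?C' = "(\<mu>2 - 2 * \<mu>3) + 2 * \<mu>5 * t"
    have dB: "(B has_real_derivative \<mu>4) (at t)" unfolding B_def[abs_def] by (auto intro!: derivative_eq_intros)
    have d\<Delta>: "(\<Delta> has_real_derivative 2 * B t * \<mu>4 - 4 * \<mu>3 * ?C') (at t)"
      unfolding \<Delta>_def[abs_def] C_def
      by (auto intro!: derivative_eq_intros dB simp: algebra_simps)
    define d where "d = (2 * B t * \<mu>4 - 4 * \<mu>3 * ?C') / (2 * sqrt (\<Delta> t))"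
    have dsq: "((\<lambda>t. sqrt (\<Delta> t)) has_real_derivative d) (at t)"
    proof -
      have "((\<lambda>t. sqrt (\<Delta> t)) has_real_derivative
          inverse (sqrt (\<Delta> t)) / 2 * (2 * B t * \<mu>4 - 4 * \<mu>3 * ?C')) (at t)"
        by (rule DERIV_chain2[where f = sqrt and g = \<Delta>, OF DERIV_real_sqrt[OF D] d\<Delta>])
      moreover have "inverse (sqrt (\<Delta> t)) / 2 * (2 * B t * \<mu>4 - 4 * \<mu>3 * ?C') = d"
        unfolding d_def divide_inverse inverse_mult_distrib by (simp only: mult_ac)
      ultimately show ?thesis by simp
    qed
    have dp: "(p \<sigma> has_real_derivative (- \<mu>4 + \<sigma> * d) / (2 * \<mu>3)) (at t)"
      unfolding p_def[abs_def] by (rule DERIV_cdivide[OF DERIV_add[OF DERIV_minus[OF dB] DERIV_cmult[OF dsq]]])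
    have f0: "2 * \<mu>3 * p \<sigma> t + \<mu>1 + \<mu>4 * t = \<sigma> * sqrt (\<Delta> t)" using p_eq[of \<sigma> t] by (simp add: B_def)
    have sd: "sqrt (\<Delta> t) * d = B t * \<mu>4 - 2 * \<mu>3 * ?C'" using D by (simp add: d_def)
    define E where "E = (- \<mu>4 + \<sigma> * d) / (2 * \<mu>3)"
    have E: "2 * \<mu>3 * E = - \<mu>4 + \<sigma> * d" using m3 by (simp add: E_def)
    have "2 * \<mu>3 * (\<sigma> * sqrt (\<Delta> t) * E + (\<mu>4 * p \<sigma> t + (\<mu>2 - 2 * \<mu>3) + 2 * \<mu>5 * t))
      = \<sigma> * sqrt (\<Delta> t) * (2 * \<mu>3 * E) + \<mu>4 * (2 * \<mu>3 * p \<sigma> t) + 2 * \<mu>3 * ?C'"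
      by (simp add: algebra_simps)
    also have "2 * \<mu>3 * p \<sigma> t = \<sigma> * sqrt (\<Delta> t) - B t" using p_eq[of \<sigma> t] by simp
    also have "\<sigma> * sqrt (\<Delta> t) * (2 * \<mu>3 * E) = - \<mu>4 * (\<sigma> * sqrt (\<Delta> t)) + \<sigma>\<^sup>2 * (sqrt (\<Delta> t) * d)"
      unfolding E by (simp add: power2_eq_square algebra_simps)
    finally have "2 * \<mu>3 * (\<sigma> * sqrt (\<Delta> t) * E + (\<mu>4 * p \<sigma> t + (\<mu>2 - 2 * \<mu>3) + 2 * \<mu>5 * t)) = 0"
      unfolding sd \<sigma> by (simp add: algebra_simps)
    then have "\<sigma> * sqrt (\<Delta> t) * ((- \<mu>4 + \<sigma> * d) / (2 * \<mu>3)) + (\<mu>4 * p \<sigma> t + (\<mu>2 - 2 * \<mu>3) + 2 * \<mu>5 * t) = 0"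
      using m3 by (simp add: E_def)
    moreover have "\<sigma> * sqrt (\<Delta> t) \<noteq> 0" using \<sigma> D by auto
    ultimately show ?thesis by (rule level_deriv[OF t0 dp, unfolded f0])
  qed
  define g where "g \<sigma> t = eval2 Gt (p \<sigma> t) t" for \<sigma> t
  have contg: "continuous_on X (g \<sigma>)" for X \<sigma>
    unfolding g_def[abs_def] by (rule eval2_continuous[OF contp])
  define kk where "kk \<sigma> t = 1 / (weight (p \<sigma> t) t * sqrt (\<Delta> t))" for \<sigma> t
  have kk: "kk \<sigma> t > 0" if "lo < t" "t < r" for \<sigma> t
    unfolding kk_def using weight_pos[of t "p \<sigma> t"] \<Delta>pos[OF that] that r by simp
  define Zp where "Zp = {t. lo < t \<and> t < r \<and> g 1 t = 0}"
  define Zm where "Zm = {t. lo < t \<and> t < r \<and> g (- 1) t = 0}"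
  have root: "poly Res t = 0 \<and> t \<le> 0" if "t \<in> Zp \<union> Zm" for t
    using that common_zero_root[OF onp[of 1 t]] common_zero_root[OF onp[of "-1" t]] \<Delta>pos[of t] r
    by (auto simp: Zp_def Zm_def g_def)
  have root_r: "poly Res r = 0" if "g 1 r = 0"
    using common_zero_root[OF onp[of 1 r]] that r by (simp add: g_def)
  have fin: "finite Zp" "finite Zm"
    using root finite_subset[OF _ poly_roots_finite[OF Res_nonzero]] by blast+
  have "card S \<le> 1 + card Zp + card Zm + (if g 1 r = 0 then 1 else 0)"
    unfolding Zp_def Zm_def
  proof (rule two_arc_rolle[where hp = "\<lambda>t. level (p 1 t) t" and hm = "\<lambda>t. level (p (- 1) t) t"
        and kp = "kk 1" and km = "kk (- 1)" and c = c])
    show "level (p 1 r) r = level (p (- 1) r) r" "g 1 r = g (- 1) r"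
      using r by (simp_all add: p_def g_def)
    show "S \<subseteq> {lo..r}"
    proof
      fix t assume "t \<in> S"
      then have "lo \<le> t" "t \<le> hi" using S(1) by (simp_all add: lo_def hi_def)
      then show "t \<in> {lo..r}" using r by simp
    qed
    fix t assume "t \<in> S"
    then obtain Y where Y: "eval2 Ft Y t = 0" "level Y t = c" using S(2) by blast
    have on_arc: "Y = p \<sigma> t" if "2 * \<mu>3 * Y + B t = \<sigma> * sqrt (\<Delta> t)" for \<sigma>
    proof -
      have "2 * \<mu>3 * Y = 2 * \<mu>3 * p \<sigma> t" using that p_eq[of \<sigma> t] by linarith
      then show ?thesis using m3 by simp
    qed
    have "\<bar>2 * \<mu>3 * Y + B t\<bar> = sqrt (\<Delta> t)" using Y(1) unfolding ev0 by (metis real_sqrt_abs)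
    then have "2 * \<mu>3 * Y + B t = 1 * sqrt (\<Delta> t) \<or> 2 * \<mu>3 * Y + B t = - 1 * sqrt (\<Delta> t)" by linarith
    then have "Y = p 1 t \<or> Y = p (- 1) t" using on_arc by blast
    then show "level (p 1 t) t = c \<or> level (p (- 1) t) t = c" using Y by auto
  next
    fix t assume t: "lo < t" "t < r"
    show "((\<lambda>t. level (p 1 t) t) has_real_derivative kk 1 t * g 1 t) (at t)"
      using der[of 1 t] t by (simp add: kk_def g_def)
    show "((\<lambda>t. level (p (- 1) t) t) has_real_derivative - kk (- 1) t * g (- 1) t) (at t)"
      using der[of "- 1" t] t by (simp add: kk_def g_def)
  qed (fact S(1) level_continuous[OF contp] contg kk fin[unfolded Zp_def] fin[unfolded Zm_def])+
  also have "\<dots> \<le> 1 + root_count"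
  proof -
    define Z where "Z = Zp \<union> Zm \<union> (if g 1 r = 0 then {r} else {})"
    have "card Z = card (Zp \<union> Zm) + (if g 1 r = 0 then 1 else 0)"
      using fin by (auto simp: Z_def Zp_def Zm_def)
    \<comment> \<open>A zero of \<open>G\<close> on both arcs over the same \<open>Y1\<close> is a double root of the resultant.\<close>
    moreover have "card Z + card (Zp \<inter> Zm) \<le> root_count"
    proof (rule mset_roots_bound[OF Res_nonzero])
      show "finite Z" "Zp \<inter> Zm \<subseteq> Z" using fin by (auto simp: Z_def)
      show "t \<le> 0 \<and> poly Res t = 0" if "t \<in> Z" for t
        using that root root_r r by (auto simp: Z_def split: if_splits)
      fix t assume t: "t \<in> Zp \<inter> Zm"
      then have D: "\<Delta> t > 0" using \<Delta>pos by (auto simp: Zp_def)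
      have "p 1 t \<noteq> p (- 1) t" using p_eq[of 1 t] p_eq[of "- 1" t] D by auto
      from two_common_zeros_double_root[OF this b0 aL_nonzero onp[of 1 t] _ onp[of "- 1" t]]
      show "[:- t, 1:]\<^sup>2 dvd Res" using t D by (auto simp: Zp_def Zm_def g_def)
    qed
    ultimately show ?thesis using card_Un_Int[OF fin] by simp
  qed
  finally show ?thesis by simp
qed simp

end

section \<open>Counting the solutions of the matching equations\<close>

context focus_focus
begin

lemma curve_points_bound:
  assumes S: "finite S"
    "\<And>t. t \<in> S \<Longrightarrow> t < 0 \<and> (\<exists>Y. eval2 Ft Y t = 0 \<and> level Y t = c)"
  shows "card S \<le> root_count + 1"
  using curve_points_bound_line[OF _ assms] curve_points_bound_conic[OF _ assms] by blast

lemma \<Phi>_deriv: "(\<Phi> has_real_derivative y / W y) (at y)"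
  using focus_potential_deriv[OF focL] aL_nonzero by blast

text \<open>The left level curve is the graph of a decreasing function.\<close>

lemma left_curve_less:
  assumes "\<Phi> s - \<Phi> u = c" "\<Phi> t - \<Phi> v = c" "0 < s" "s < t" "u < 0" "v < 0"
  shows "v < u"
proof (rule ccontr)
  assume "\<not> v < u"
  then have "\<Phi> v \<le> \<Phi> u"
    using focus_potential_strict_antimono[OF focL, of u v "aL AL bL"] assms by (cases "u = v") auto
  moreover have "\<Phi> s < \<Phi> t" using focus_potential_strict_mono[OF focL] assms by simp
  ultimately show False using assms by linarith
qed

lemma \<Phi>_inj_neg:
  assumes "\<Phi> u = \<Phi> v" "u < 0" "v < 0"
  shows "u = v"
proof (cases u v rule: linorder_cases)
  case less
  from focus_potential_strict_antimono[OF focL less assms(3)] assms(1) show ?thesis by (metis less_irrefl)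
next
  case greater
  from focus_potential_strict_antimono[OF focL greater assms(2)] assms(1) show ?thesis by (metis less_irrefl)
qed

text \<open>Rolle's theorem for the right matching function, restricted to the left level curve between the two
  given points.\<close>

lemma left_curve_rolle:
  assumes left: "\<Phi> s - \<Phi> u = c" "\<Phi> t - \<Phi> v = c"
    and right: "\<Phi>R (s - b) - \<Phi>R (u - b) = d" "\<Phi>R (t - b) - \<Phi>R (v - b) = d"
    and pos: "max 0 b < s" "s < t" "u < min 0 b" "v < min 0 b"
  shows "\<exists>z y. s < z \<and> z < t \<and> y < min 0 b \<and> \<Phi> z - \<Phi> y = c \<and> F AL bL AR bR b z y = 0"
proof -
  have vu: "v < u" using left_curve_less[OF left] pos by simp
  have cont\<Phi>: "continuous_on X \<Phi>" for X by (rule focus_potential_continuous[OF focL aL_nonzero])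
  have anti: "\<Phi> y' < \<Phi> y" if "y < y'" "y' < 0" for y y'
    using focus_potential_strict_antimono[OF focL that] .
  have mono: "\<Phi> y < \<Phi> y'" if "0 < y" "y < y'" for y y'
    using focus_potential_strict_mono[OF focL that] .
  have inj: "inj_on \<Phi> {v..u}"
    by (rule inj_onI) (use \<Phi>_inj_neg pos in auto)
  \<comment> \<open>The local inverse of the negative branch of \<open>\<Phi>\<close> parametrises the left level curve by \<open>y0\<close>.\<close>
  define \<eta> where "\<eta> = the_inv_into {v..u} \<Phi>"
  have img: "\<Phi> ` {v..u} = {\<Phi> u..\<Phi> v}"
  proof
    show "\<Phi> ` {v..u} \<subseteq> {\<Phi> u..\<Phi> v}"
    proof
      fix w assume "w \<in> \<Phi> ` {v..u}"
      then obtain y where y: "v \<le> y" "y \<le> u" "w = \<Phi> y" by auto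
      have "\<Phi> u \<le> \<Phi> y" using anti[of y u] y pos by (cases "y = u") auto
      moreover have "\<Phi> y \<le> \<Phi> v" using anti[of v y] y pos by (cases "y = v") auto
      ultimately show "w \<in> {\<Phi> u..\<Phi> v}" using y by simp
    qed
    show "{\<Phi> u..\<Phi> v} \<subseteq> \<Phi> ` {v..u}"
    proof
      fix w assume "w \<in> {\<Phi> u..\<Phi> v}"
      then obtain y where "v \<le> y" "y \<le> u" "\<Phi> y = w"
        using IVT2'[of \<Phi> u w v] vu cont\<Phi> by auto
      then show "w \<in> \<Phi> ` {v..u}" by auto
    qed
  qed
  have \<eta>: "\<Phi> (\<eta> w) = w" "v \<le> \<eta> w" "\<eta> w \<le> u" if "w \<in> {\<Phi> u..\<Phi> v}" for w
    using f_the_inv_into_f[OF inj] the_inv_into_into[OF inj _ order.refl] that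
    unfolding img[symmetric] \<eta>_def by auto
  have \<eta>\<Phi>: "\<eta> (\<Phi> y) = y" if "y \<in> {v..u}" for y
    unfolding \<eta>_def using the_inv_into_f_f[OF inj that] .
  have cont\<eta>: "continuous_on {\<Phi> u..\<Phi> v} \<eta>"
    using continuous_on_inv[of "{v..u}" \<Phi> \<eta>] cont\<Phi> \<eta>\<Phi> by (simp add: img)
  define y where "y z = \<eta> (\<Phi> z - c)" for z
  have ran: "\<Phi> z - c \<in> {\<Phi> u..\<Phi> v}" if "s \<le> z" "z \<le> t" for z
  proof -
    have "\<Phi> s \<le> \<Phi> z" using mono[of s z] that pos by (cases "s = z") auto
    moreover have "\<Phi> z \<le> \<Phi> t" using mono[of z t] that pos by (cases "z = t") auto
    ultimately show ?thesis using left by auto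
  qed
  have y: "\<Phi> (y z) = \<Phi> z - c" "v \<le> y z" "y z \<le> u" if "s \<le> z" "z \<le> t" for z
    using \<eta>[OF ran[OF that]] by (auto simp: y_def)
  have yneg: "y z < 0" "y z < b" if "s \<le> z" "z \<le> t" for z
    using y[OF that] pos by auto
  have "\<Phi> s - c = \<Phi> u" "\<Phi> t - c = \<Phi> v" using left by linarith+
  then have y_ends: "y s = u" "y t = v" using \<eta>\<Phi>[of u] \<eta>\<Phi>[of v] vu by (auto simp: y_def)
  have conty: "continuous_on {s..t} y"
    unfolding y_def
    by (rule continuous_on_compose2[OF cont\<eta>]) (use ran in \<open>auto intro!: continuous_intros cont\<Phi>\<close>)
  have dery: "(y has_real_derivative inverse (y z / W (y z)) * (z / W z)) (at z)" if z: "s < z" "z < t" for z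
  proof -
    have "\<Phi> s < \<Phi> z" "\<Phi> z < \<Phi> t" using mono[of s z] mono[of z t] z pos by auto
    then have w: "\<Phi> u < \<Phi> z - c" "\<Phi> z - c < \<Phi> v" using left by auto
    have "(\<eta> has_real_derivative inverse (y z / W (y z))) (at (\<Phi> z - c))"
    proof (rule DERIV_inverse_function[OF _ _ w])
      show "(\<Phi> has_real_derivative y z / W (y z)) (at (\<eta> (\<Phi> z - c)))"
        using \<Phi>_deriv[of "y z"] by (simp add: y_def)
      show "y z / W (y z) \<noteq> 0" using yneg[of z] z W_pos[of "y z"] by simp
      show "\<Phi> (\<eta> x) = x" if "\<Phi> u < x" "x < \<Phi> v" for x using \<eta>(1) that by simp
      have "continuous_on {\<Phi> u<..<\<Phi> v} \<eta>" by (rule continuous_on_subset[OF cont\<eta>]) auto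
      then show "isCont \<eta> (\<Phi> z - c)"
        using w by (simp add: continuous_on_eq_continuous_at)
    qed
    moreover have "((\<lambda>z. \<Phi> z - c) has_real_derivative z / W z) (at z)"
      using DERIV_diff[OF \<Phi>_deriv DERIV_const[of c]] by simp
    ultimately show ?thesis unfolding y_def[abs_def] by (rule DERIV_chain2)
  qed
  have derR: "(\<Phi>R has_real_derivative x / WR x) (at x)" if "x \<noteq> 0" for x
    using focus_potential_deriv[OF focR] that by blast
  have contR: "continuous_on {x. x \<noteq> 0} \<Phi>R"
    using derR by (auto intro!: continuous_at_imp_continuous_on DERIV_isCont)
  define H where "H z = \<Phi>R (z - b) - \<Phi>R (y z - b)" for z
  define H' where "H' z = (z - b) / WR (z - b)
      - (y z - b) / WR (y z - b) * (inverse (y z / W (y z)) * (z / W z))" for z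
  have "\<exists>z. s < z \<and> z < t \<and> H t - H s = H' z * (t - s)"
  proof -
    have "continuous_on {s..t} H"
      unfolding H_def[abs_def]
    proof (rule continuous_on_diff)
      show "continuous_on {s..t} (\<lambda>z. \<Phi>R (z - b))"
        using pos by (intro continuous_on_compose2[OF contR] continuous_intros) auto
      show "continuous_on {s..t} (\<lambda>z. \<Phi>R (y z - b))"
        using yneg by (intro continuous_on_compose2[OF contR] continuous_intros conty) fastforce
    qed
    moreover have "(H has_derivative (\<lambda>h. H' z * h)) (at z)" if z: "s < z" "z < t" for z
    proof -
      have "((\<lambda>z. z - b) has_real_derivative 1) (at z)" by (auto intro!: derivative_eq_intros)
      from DERIV_chain2[where f = \<Phi>R and g = "\<lambda>z. z - b", OF derR this]
      have 1: "((\<lambda>z. \<Phi>R (z - b)) has_real_derivative (z - b) / WR (z - b)) (at z)"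
        using z pos by simp
      have "((\<lambda>z. y z - b) has_real_derivative inverse (y z / W (y z)) * (z / W z)) (at z)"
        using DERIV_diff[OF dery[OF z] DERIV_const[of b]] by simp
      from DERIV_chain2[where f = \<Phi>R and g = "\<lambda>z. y z - b", OF derR this]
      have 2: "((\<lambda>z. \<Phi>R (y z - b)) has_real_derivative
          (y z - b) / WR (y z - b) * (inverse (y z / W (y z)) * (z / W z))) (at z)"
        using yneg[of z] z by simp
      show ?thesis using DERIV_diff[OF 1 2]
        unfolding H_def[abs_def] H'_def has_field_derivative_def .
    qed
    ultimately show ?thesis using mvt[OF pos(2), of H "\<lambda>z h. H' z * h"] by metis
  qed
  moreover have "H t = H s" using right by (simp add: H_def y_ends)
  ultimately obtain z where z: "s < z" "z < t" "H' z = 0" using pos by auto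
  define x where "x = y z"
  have x: "x < 0" "x < b" using yneg[of z] z by (auto simp: x_def)
  have zp: "z > 0" "z > b" using z pos by auto
  have Wp: "W z > 0" "W x > 0" "WR (z - b) > 0" "WR (x - b) > 0"
    using W_pos focus_quadratic_pos[OF focR] zp x by auto
  have "(z - b) / WR (z - b) = (x - b) / WR (x - b) * (W x / x * (z / W z))"
    using z(3) by (simp add: H'_def x_def)
  then have "(z - b) * WR (x - b) * (x * W z) - (x - b) * WR (z - b) * (z * W x) = 0"
    using Wp x zp by (simp add: field_simps)
  then have "(z - x) * F AL bL AR bR b z x = 0" unfolding F_dynamical .
  then have "F AL bL AR bR b z x = 0" using x zp by simp
  then show ?thesis using z x y(1)[of z] by (intro exI[of _ z] exI[of _ x]) (auto simp: x_def)
qed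

text \<open>On the left level curve the product \<open>y0 y1\<close> is strictly decreasing in \<open>y0\<close>, so distinct zeros of \<open>F\<close> on it
  have distinct values of \<open>Y1\<close>, as \<open>curve_points_bound\<close> requires.\<close>

theorem matching_pairs_bound:
  fixes c d :: real
  defines "P \<equiv> {(y0, y1). max 0 b < y0 \<and> y1 < min 0 b \<and> \<Phi> y0 - \<Phi> y1 = c \<and> \<Phi>R (y0 - b) - \<Phi>R (y1 - b) = d}"
  shows "finite P \<and> card P \<le> root_count + 2"
proof (rule finite_if_finite_subsets_card_bdd)
  fix G assume G: "G \<subseteq> P" "finite G"
  have inj: "inj_on fst G"
  proof (rule inj_onI)
    fix p p' assume pp: "p \<in> G" "p' \<in> G" "fst p = fst p'"
    obtain s u u' where p: "p = (s, u)" "p' = (s, u')" using pp by (metis prod.collapse)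
    have "(s, u) \<in> P" "(s, u') \<in> P" using pp p G by auto
    then have "\<Phi> s - \<Phi> u = c" "\<Phi> s - \<Phi> u' = c" "u < 0" "u' < 0" unfolding P_def by auto
    then have "\<Phi> u = \<Phi> u'" by linarith
    then have "u = u'" using \<Phi>_inj_neg \<open>u < 0\<close> \<open>u' < 0\<close> by blast
    then show "p = p'" using p by simp
  qed
  define Q where "Q z = (\<exists>y. y < min 0 b \<and> \<Phi> z - \<Phi> y = c \<and> F AL bL AR bR b z y = 0)" for z
  have "\<exists>z. s < z \<and> z < t \<and> Q z" if st: "s \<in> fst ` G" "t \<in> fst ` G" "s < t" for s t
  proof -
    obtain u v where "(s, u) \<in> P" "(t, v) \<in> P" using st G by force
    then show ?thesis
      using left_curve_rolle[of s u c t v d] st unfolding P_def Q_def by auto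
  qed
  from separated_points_count[OF finite_imageI[OF G(2), of fst] this]
  obtain Z where Z: "finite Z" "card (fst ` G) \<le> card Z + 1" "\<And>z. z \<in> Z \<Longrightarrow> Q z \<and> (\<exists>s\<in>fst ` G. s < z)"
    by blast
  obtain y where y: "\<And>z. z \<in> Z \<Longrightarrow> y z < min 0 b \<and> \<Phi> z - \<Phi> (y z) = c \<and> F AL bL AR bR b z (y z) = 0"
    using Z(3) unfolding Q_def by metis
  have Zpos: "z > 0" if "z \<in> Z" for z using Z(3)[OF that] G by (auto simp: P_def)
  have anti: "z' * y z' < z * y z" if "z \<in> Z" "z' \<in> Z" "z < z'" for z z'
  proof -
    have "y z' < y z" using left_curve_less[of z "y z" c z' "y z'"] y that Zpos by auto
    then have "z' * y z' < z' * y z" using Zpos[OF that(2)] by simp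
    also have "\<dots> \<le> z * y z" using that y[OF that(1)] by (intro mult_right_mono_neg) auto
    finally show ?thesis .
  qed
  have injZ: "inj_on (\<lambda>z. z * y z) Z"
    by (rule inj_onI) (metis anti less_irrefl linorder_neqE)
  have "card ((\<lambda>z. z * y z) ` Z) \<le> root_count + 1"
  proof (rule curve_points_bound)
    fix t assume "t \<in> (\<lambda>z. z * y z) ` Z"
    then obtain z where z: "z \<in> Z" "t = z * y z" by blast
    have zy: "z > 0" "y z < 0" using y[OF z(1)] Zpos[OF z(1)] by auto
    have "(z + y z)\<^sup>2 - 4 * t = (z - y z)\<^sup>2" unfolding z by (simp add: power2_eq_square algebra_simps)
    then have "sqrt ((z + y z)\<^sup>2 - 4 * t) = z - y z" using zy by simp
    then have "level (z + y z) t = \<Phi> z - \<Phi> (y z)" by (simp add: level_def)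
    moreover have "eval2 Ft (z + y z) t = 0" unfolding z eval2_Ftilde using y[OF z(1)] by simp
    ultimately show "t < 0 \<and> (\<exists>Y. eval2 Ft Y t = 0 \<and> level Y t = c)"
      using y[OF z(1)] zy z by (auto simp: mult_pos_neg)
  qed (use Z in simp)
  then show "card G \<le> root_count + 2"
    using Z(2) card_image[OF inj] card_image[OF injZ] by simp
qed

end

section \<open>Crossing periodic orbits as solutions of the matching equations\<close>

lemma maximal_negative_interval:
  fixes x :: "real \<Rightarrow> real"
  assumes cont: "continuous_on UNIV x" and t: "t1 < t" "t < t2" "x t1 \<ge> 0" "x t < 0" "x t2 \<ge> 0"
  shows "\<exists>s e. t1 \<le> s \<and> s < t \<and> t < e \<and> e \<le> t2 \<and> x s = 0 \<and> x e = 0 \<and> (\<forall>u. s < u \<longrightarrow> u < e \<longrightarrow> x u < 0)"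
proof -
  have c: "continuous_on X x" for X using cont continuous_on_subset by blast
  have comp: "compact {u \<in> {p..q}. x u = 0}" for p q
    using continuous_closed_preimage_constant[OF c closed_atLeastAtMost, of p q 0]
      bounded_subset[OF bounded_closed_interval[of p q], of "{u \<in> {p..q}. x u = 0}"]
    by (simp add: compact_eq_bounded_closed subset_iff)
  have "{u \<in> {t1..t}. x u = 0} \<noteq> {}" using IVT2'[of x t 0 t1] c t by fastforce
  then obtain s where s: "s \<in> {u \<in> {t1..t}. x u = 0}" "\<And>u. u \<in> {u \<in> {t1..t}. x u = 0} \<Longrightarrow> u \<le> s"
    using compact_attains_sup[OF comp] by meson
  have "{u \<in> {t..t2}. x u = 0} \<noteq> {}" using IVT'[of x t 0 t2] c t by fastforce
  then obtain e where e: "e \<in> {u \<in> {t..t2}. x u = 0}" "\<And>u. u \<in> {u \<in> {t..t2}. x u = 0} \<Longrightarrow> e \<le> u"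
    using compact_attains_inf[OF comp] by meson
  have "s \<noteq> t" "e \<noteq> t" using s e t by auto
  then have st: "s < t" "t < e" using s(1) e(1) by auto
  have "x u < 0" if u: "s < u" "u < e" for u
  proof (rule ccontr)
    assume n: "\<not> x u < 0"
    show False
    proof (cases "u \<le> t")
      case True
      then obtain z where "u \<le> z" "z \<le> t" "x z = 0" using IVT2'[of x t 0 u] c t n by fastforce
      then show False using s(2)[of z] s(1) u by auto
    next
      case False
      then obtain z where "t \<le> z" "z \<le> u" "x z = 0" using IVT'[of x t 0 u] c t n by fastforce
      then show False using e(2)[of z] e(1) u by auto
    qed
  qed
  then show ?thesis using s(1) e(1) st by (intro exI[of _ s] exI[of _ e]) auto
qed

context focus_focus
begin

abbreviation "\<kappa> \<equiv> - (AL$1$2 / AR$1$2)"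
abbreviation "ht \<equiv> side_coord 1 AL bL"
abbreviation "left_arc \<equiv> side_arc 1 AL bL"
abbreviation "right_arc \<equiv> side_arc \<kappa> AR bR"
abbreviation "cL \<equiv> flight_const (TL AL) (DL AL) (aL AL bL)"
abbreviation "cR \<equiv> - flight_const (TR AR) (DR AR) (- aR AL AR bR)"

lemma \<kappa>_neg: "\<kappa> < 0"
  using a12 by (auto simp: zero_less_mult_iff intro: divide_pos_pos divide_neg_neg)

lemma a12_nonzero: "AL$1$2 \<noteq> 0" "AR$1$2 \<noteq> 0" using a12 by auto

lemma side_coord_right: "z$1 = 0 \<Longrightarrow> side_coord \<kappa> AR bR z = - (ht z - b)"
  using a12_nonzero by (simp add: side_coord_def bstar_def field_simps)

lemma left_field_switch: "z$1 = 0 \<Longrightarrow> (AL *v z + bL) $ 1 = - ht z"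
  unfolding affine_component side_coord_def by simp

lemma right_field_switch: "z$1 = 0 \<Longrightarrow> \<kappa> * (AR *v z + bR) $ 1 = ht z - b"
  using side_coord_right[of z] unfolding affine_component side_coord_def by (simp add: algebra_simps)

lemma left_arc_matching:
  assumes "left_arc \<gamma> s e" "ht (\<gamma> s) > 0" "ht (\<gamma> e) < 0"
  shows "\<Phi> (ht (\<gamma> s)) - \<Phi> (ht (\<gamma> e)) = cL"
  using side_arc_flight[OF assms(1) focL[unfolded TL_def DL_def] assms(2,3)]
  by (simp add: TL_def DL_def aL_def)

lemma right_arc_matching:
  assumes arc: "right_arc \<gamma> e s" and y: "ht (\<gamma> e) < b" "ht (\<gamma> s) > b"
  shows "\<Phi>R (ht (\<gamma> s) - b) - \<Phi>R (ht (\<gamma> e) - b) = cR"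
proof -
  have z: "\<gamma> e $ 1 = 0" "\<gamma> s $ 1 = 0" using arc by (auto simp: side_arc_def)
  have a: "\<kappa> * (AR$1$2 * bR$2 - AR$2$2 * bR$1) = - aR AL AR bR" by (simp add: aR_def)
  have "focus_potential (TR AR) (DR AR) (- aR AL AR bR) (- (ht (\<gamma> e) - b))
    - focus_potential (TR AR) (DR AR) (- aR AL AR bR) (- (ht (\<gamma> s) - b))
    = flight_const (TR AR) (DR AR) (- aR AL AR bR)"
    using side_arc_flight[OF arc focR[unfolded TR_def DR_def]] y
    unfolding side_coord_right[OF z(1)] side_coord_right[OF z(2)] a by (simp add: TR_def DR_def)
  then show ?thesis unfolding focus_potential_reflect by simp
qed

end

locale crossing_orbit = focus_focus +
  fixes \<gamma> :: "real \<Rightarrow> real^2" and T :: real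
  assumes sol: "filippov_solution AL bL AR bR \<gamma>" and T_pos: "T > 0"
    and periodic: "\<And>t. \<gamma> (t + T) = \<gamma> t"
    and both: "\<exists>t. \<gamma> t $ 1 < 0" "\<exists>t. \<gamma> t $ 1 > 0"
    and crossing: "\<And>t. \<gamma> t $ 1 = 0 \<Longrightarrow> crossing_point AL bL AR bR (\<gamma> t)"
begin

lemma periodic_nat: "\<gamma> (t + real n * T) = \<gamma> t"
proof (induction n)
  case (Suc n)
  have "t + real (Suc n) * T = (t + real n * T) + T" by (simp add: algebra_simps)
  then show ?case using periodic Suc by metis
qed simp

lemma periodic_shift: "\<exists>t'. \<gamma> t' = \<gamma> t \<and> t' < u" "\<exists>t'. \<gamma> t' = \<gamma> t \<and> t' > u"
proof -
  obtain n :: nat where n: "real n * T > \<bar>t\<bar> + \<bar>u\<bar>" using ex_less_of_nat_mult[OF T_pos] by blast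
  have "\<gamma> (t - real n * T) = \<gamma> t" using periodic_nat[of "t - real n * T" n] by simp
  then show "\<exists>t'. \<gamma> t' = \<gamma> t \<and> t' < u" using n by (intro exI[of _ "t - real n * T"]) auto
  show "\<exists>t'. \<gamma> t' = \<gamma> t \<and> t' > u" using n periodic_nat[of t n] by (intro exI[of _ "t + real n * T"]) auto
qed

lemma ac: "abs_cont_on p q \<gamma>" using sol by (simp add: filippov_solution_def)

lemma ac_component: "abs_cont_on p q (\<lambda>t. \<gamma> t $ i)"
  by (rule abs_cont_on_mono_dist[OF ac]) (rule dist_vec_nth_le)

lemma cont: "continuous_on X \<gamma>"
proof -
  have "isCont \<gamma> t" for t
    using continuous_on_interior[OF abs_cont_on_imp_continuous_on[OF ac, of "t - 1" "t + 1"], of t] by simp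
  then show ?thesis by (auto intro: continuous_at_imp_continuous_on)
qed

lemma cont_field:
  fixes A :: "real^2^2"
  shows "continuous_on X (\<lambda>t. (A *v \<gamma> t + \<beta>) $ i)"
  unfolding affine_component by (intro continuous_intros cont)

lemma ae_derivative:
  "AE t in lebesgue. \<exists>v\<in>filippov_field AL bL AR bR (\<gamma> t). \<forall>i. ((\<lambda>t. \<gamma> t $ i) has_real_derivative v $ i) (at t)"
proof -
  have "AE t in lebesgue. \<exists>v\<in>filippov_field AL bL AR bR (\<gamma> t). (\<gamma> has_vector_derivative v) (at t)"
    using sol by (simp add: filippov_solution_def)
  then show ?thesis
  proof eventually_elim
    case (elim t)
    then obtain v where v: "v \<in> filippov_field AL bL AR bR (\<gamma> t)" "(\<gamma> has_vector_derivative v) (at t)" by blast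
    have "((\<lambda>t. \<gamma> t $ i) has_real_derivative v $ i) (at t)" for i
      using bounded_linear.has_vector_derivative[OF bounded_linear_vec_nth v(2)]
      by (simp add: has_real_derivative_iff_has_vector_derivative)
    then show ?case using v(1) by blast
  qed
qed

lemma arc_left:
  assumes "s < e" "\<gamma> s $ 1 = 0" "\<gamma> e $ 1 = 0" "\<And>t. s < t \<Longrightarrow> t < e \<Longrightarrow> \<gamma> t $ 1 < 0"
  shows "left_arc \<gamma> s e"
  unfolding side_arc_def
proof (intro conjI allI impI ballI)
  fix t i assume t: "t \<in> {s..e}"
  show "((\<lambda>t. \<gamma> t $ i) has_real_derivative (AL *v \<gamma> t + bL) $ i) (at t within {s..e})"
  proof (rule abs_cont_on_deriv_within[OF ac_component cont_field _ t])
    show "AE t in lebesgue. s < t \<and> t < e \<longrightarrow>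
        ((\<lambda>t. \<gamma> t $ i) has_real_derivative (AL *v \<gamma> t + bL) $ i) (at t)"
      using ae_derivative by eventually_elim (use assms(4) in \<open>auto simp: filippov_field_def\<close>)
  qed
qed (use assms in auto)

lemma arc_right:
  assumes "s < e" "\<gamma> s $ 1 = 0" "\<gamma> e $ 1 = 0" "\<And>t. s < t \<Longrightarrow> t < e \<Longrightarrow> \<gamma> t $ 1 > 0"
  shows "right_arc \<gamma> s e"
  unfolding side_arc_def
proof (intro conjI allI impI ballI)
  fix t i assume t: "t \<in> {s..e}"
  show "((\<lambda>t. \<gamma> t $ i) has_real_derivative (AR *v \<gamma> t + bR) $ i) (at t within {s..e})"
  proof (rule abs_cont_on_deriv_within[OF ac_component cont_field _ t])
    show "AE t in lebesgue. s < t \<and> t < e \<longrightarrow>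
        ((\<lambda>t. \<gamma> t $ i) has_real_derivative (AR *v \<gamma> t + bR) $ i) (at t)"
      using ae_derivative by eventually_elim (use assms(4) in \<open>force simp: filippov_field_def\<close>)
  qed
next
  fix t assume "s < t" "t < e"
  then show "\<kappa> * \<gamma> t $ 1 < 0" using assms(4) \<kappa>_neg by (intro mult_neg_pos) auto
qed (use assms in auto)

text \<open>The product of the two normal velocities is \<open>y (y - b)\<close> up to a positive factor.\<close>

lemma cross_height:
  assumes "\<gamma> t $ 1 = 0"
  shows "ht (\<gamma> t) > max 0 b \<or> ht (\<gamma> t) < min 0 b"
proof -
  let ?L = "(AL *v \<gamma> t + bL) $ 1" let ?R = "(AR *v \<gamma> t + bR) $ 1"
  have "?L * ?R > 0" using crossing[OF assms] by (simp add: crossing_point_def)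
  then have "\<kappa> * (?L * ?R) < 0" using \<kappa>_neg by (rule mult_neg_pos[rotated])
  then have "?L * (\<kappa> * ?R) < 0" by (simp only: mult.left_commute)
  then have "ht (\<gamma> t) * (ht (\<gamma> t) - b) > 0"
    unfolding left_field_switch[OF assms] right_field_switch[OF assms] by simp
  then show ?thesis by (auto simp: zero_less_mult_iff)
qed

text \<open>Near a point at which both fields cross the line in direction \<open>\<sigma>\<close>, every Filippov velocity, being a convex
  combination of the two, has a first component of that sign bounded away from zero.\<close>

lemma strict_crossing:
  assumes \<sigma>: "\<sigma> = 1 \<or> \<sigma> = (- 1 :: real)"
    and L: "\<sigma> * (AL *v \<gamma> t0 + bL) $ 1 > 0" and R: "\<sigma> * (AR *v \<gamma> t0 + bR) $ 1 > 0"
  shows "\<exists>\<epsilon>>0. \<forall>u v. t0 - \<epsilon> < u \<longrightarrow> u < v \<longrightarrow> v < t0 + \<epsilon> \<longrightarrow> \<sigma> * \<gamma> u $ 1 < \<sigma> * \<gamma> v $ 1"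
proof -
  define gL where "gL t = \<sigma> * (AL *v \<gamma> t + bL) $ 1" for t
  define gR where "gR t = \<sigma> * (AR *v \<gamma> t + bR) $ 1" for t
  have c: "continuous_on UNIV gL" "continuous_on UNIV gR"
    unfolding gL_def gR_def by (intro continuous_intros cont_field)+
  define m where "m = min (gL t0) (gR t0) / 2"
  have m: "m > 0" "m < gL t0" "m < gR t0" using L R by (auto simp: m_def gL_def gR_def)
  have "isCont gL t0" "isCont gR t0" using c by (auto simp: continuous_on_eq_continuous_at)
  then have "eventually (\<lambda>t. gL t > m) (at t0)" "eventually (\<lambda>t. gR t > m) (at t0)"
    using m by (auto simp: isCont_def intro: order_tendstoD)
  then have "eventually (\<lambda>t. gL t > m \<and> gR t > m) (at t0)" by (rule eventually_conj)
  then obtain \<epsilon> where \<epsilon>: "\<epsilon> > 0" and near: "\<And>t. t \<noteq> t0 \<Longrightarrow> dist t t0 < \<epsilon> \<Longrightarrow> gL t > m \<and> gR t > m"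
    unfolding eventually_at by auto
  have near: "gL t > m \<and> gR t > m" if "\<bar>t - t0\<bar> < \<epsilon>" for t
    using near[of t] that m by (cases "t = t0") (auto simp: dist_real_def)
  have ac\<sigma>: "abs_cont_on p q (\<lambda>t. \<sigma> * \<gamma> t $ 1)" for p q
    by (rule abs_cont_on_mono_dist[OF ac_component[of p q 1]]) (use \<sigma> in \<open>auto simp: dist_minus\<close>)
  have "\<sigma> * \<gamma> u $ 1 < \<sigma> * \<gamma> v $ 1" if uv: "t0 - \<epsilon> < u" "u < v" "v < t0 + \<epsilon>" for u v
  proof -
    have "AE t in lebesgue. u < t \<and> t < v \<longrightarrow> (\<exists>d\<ge>m. ((\<lambda>t. \<sigma> * \<gamma> t $ 1) has_real_derivative d) (at t))"
      using ae_derivative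
    proof eventually_elim
      case (elim t)
      show ?case
      proof
        assume t: "u < t \<and> t < v"
        then have g: "gL t > m" "gR t > m" using near[of t] uv by auto
        obtain w where w: "w \<in> filippov_field AL bL AR bR (\<gamma> t)"
          and d: "((\<lambda>t. \<gamma> t $ 1) has_real_derivative w $ 1) (at t)" using elim by blast
        have "\<sigma> * w $ 1 \<ge> m"
        proof (cases "\<gamma> t $ 1 = 0")
          case True
          then have "w \<in> convex hull {AL *v \<gamma> t + bL, AR *v \<gamma> t + bR}" using w by (simp add: filippov_field_def)
          then obtain p q where pq: "0 \<le> p" "0 \<le> q" "p + q = 1"
            "w = p *\<^sub>R (AL *v \<gamma> t + bL) + q *\<^sub>R (AR *v \<gamma> t + bR)" unfolding convex_hull_2 by auto
          have "\<sigma> * w $ 1 = p * gL t + q * gR t" unfolding pq gL_def gR_def by (simp add: algebra_simps)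
          moreover have "p * m \<le> p * gL t" "q * m \<le> q * gR t" using pq g by (auto intro: mult_left_mono)
          moreover have "p * m + q * m = m" using pq by (simp add: distrib_right[symmetric])
          ultimately show ?thesis by linarith
        next
          case False
          then have "w = AL *v \<gamma> t + bL \<or> w = AR *v \<gamma> t + bR"
            using w by (auto simp: filippov_field_def split: if_splits)
          then show ?thesis using g unfolding gL_def gR_def by auto
        qed
        then show "\<exists>d\<ge>m. ((\<lambda>t. \<sigma> * \<gamma> t $ 1) has_real_derivative d) (at t)"
          using DERIV_cmult[OF d, of \<sigma>] by blast
      qed
    qed
    from abs_cont_on_growth[OF ac\<sigma> less_imp_le[OF uv(2)] this]
    have "m * (v - u) \<le> \<sigma> * \<gamma> v $ 1 - \<sigma> * \<gamma> u $ 1" .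
    moreover have "m * (v - u) > 0" using m uv by simp
    ultimately show ?thesis by linarith
  qed
  then show ?thesis using \<epsilon> by blast
qed

lemma down_crossing:
  assumes x: "\<gamma> t0 $ 1 = 0" and y: "ht (\<gamma> t0) > max 0 b"
  shows "\<exists>\<epsilon>>0. (\<forall>t. t0 - \<epsilon> < t \<longrightarrow> t < t0 \<longrightarrow> \<gamma> t $ 1 > 0) \<and> (\<forall>t. t0 < t \<longrightarrow> t < t0 + \<epsilon> \<longrightarrow> \<gamma> t $ 1 < 0)"
proof -
  have "\<kappa> * (AR *v \<gamma> t0 + bR) $ 1 > 0" unfolding right_field_switch[OF x] using y by simp
  then have "(AR *v \<gamma> t0 + bR) $ 1 < 0" using \<kappa>_neg by (metis less_le_not_le mult_nonneg_nonpos2 not_le_imp_less)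
  moreover have "(AL *v \<gamma> t0 + bL) $ 1 < 0" unfolding left_field_switch[OF x] using y by simp
  ultimately obtain \<epsilon> where \<epsilon>: "\<epsilon> > 0"
    "\<And>u v. t0 - \<epsilon> < u \<Longrightarrow> u < v \<Longrightarrow> v < t0 + \<epsilon> \<Longrightarrow> - 1 * \<gamma> u $ 1 < - 1 * \<gamma> v $ 1"
    using strict_crossing[of "- 1" t0] by auto
  have "\<gamma> t $ 1 > 0" if "t0 - \<epsilon> < t" "t < t0" for t using \<epsilon>(2)[of t t0] \<epsilon>(1) that x by simp
  moreover have "\<gamma> t $ 1 < 0" if "t0 < t" "t < t0 + \<epsilon>" for t using \<epsilon>(2)[of t0 t] \<epsilon>(1) that x by simp
  ultimately show ?thesis using \<epsilon>(1) by blast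
qed

lemma up_crossing:
  assumes x: "\<gamma> t0 $ 1 = 0" and y: "ht (\<gamma> t0) < min 0 b"
  shows "\<exists>\<epsilon>>0. (\<forall>t. t0 - \<epsilon> < t \<longrightarrow> t < t0 \<longrightarrow> \<gamma> t $ 1 < 0) \<and> (\<forall>t. t0 < t \<longrightarrow> t < t0 + \<epsilon> \<longrightarrow> \<gamma> t $ 1 > 0)"
proof -
  have "\<kappa> * (AR *v \<gamma> t0 + bR) $ 1 < 0" unfolding right_field_switch[OF x] using y by simp
  then have "(AR *v \<gamma> t0 + bR) $ 1 > 0" using \<kappa>_neg by (metis less_le_not_le mult_nonpos_nonpos not_le_imp_less less_imp_le)
  moreover have "(AL *v \<gamma> t0 + bL) $ 1 > 0" unfolding left_field_switch[OF x] using y by simp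
  ultimately obtain \<epsilon> where \<epsilon>: "\<epsilon> > 0"
    "\<And>u v. t0 - \<epsilon> < u \<Longrightarrow> u < v \<Longrightarrow> v < t0 + \<epsilon> \<Longrightarrow> 1 * \<gamma> u $ 1 < 1 * \<gamma> v $ 1"
    using strict_crossing[of 1 t0] by auto
  have "\<gamma> t $ 1 < 0" if "t0 - \<epsilon> < t" "t < t0" for t using \<epsilon>(2)[of t t0] \<epsilon>(1) that x by simp
  moreover have "\<gamma> t $ 1 > 0" if "t0 < t" "t < t0 + \<epsilon>" for t using \<epsilon>(2)[of t0 t] \<epsilon>(1) that x by simp
  ultimately show ?thesis using \<epsilon>(1) by blast
qed

text \<open>By periodicity the orbit is on the other side before and after \<open>t\<close>, so the maximal interval with
  negative first coordinate is bounded.\<close>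

lemma negative_in_left_arc:
  assumes t: "\<gamma> t $ 1 < 0"
  shows "\<exists>s e. s < t \<and> t < e \<and> left_arc \<gamma> s e \<and> ht (\<gamma> s) > max 0 b \<and> ht (\<gamma> e) < min 0 b"
proof -
  obtain tp where tp: "\<gamma> tp $ 1 > 0" using both by blast
  obtain t1 t2 where t12: "t1 < t" "\<gamma> t1 = \<gamma> tp" "t < t2" "\<gamma> t2 = \<gamma> tp"
    using periodic_shift[of tp t] by blast
  obtain s e where se: "s < t" "t < e" "\<gamma> s $ 1 = 0" "\<gamma> e $ 1 = 0"
    "\<And>u. s < u \<Longrightarrow> u < e \<Longrightarrow> \<gamma> u $ 1 < 0"
    using maximal_negative_interval[of "\<lambda>t. \<gamma> t $ 1" t1 t t2] t12 tp t
    by (auto intro: continuous_intros cont)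
  have "\<not> ht (\<gamma> s) < min 0 b"
  proof
    assume "ht (\<gamma> s) < min 0 b"
    then obtain \<epsilon> where \<epsilon>: "\<epsilon> > 0" "\<And>u. s < u \<Longrightarrow> u < s + \<epsilon> \<Longrightarrow> \<gamma> u $ 1 > 0" using up_crossing[OF se(3)] by blast
    obtain u where "s < u" "u < min (s + \<epsilon>) t" using dense[of s "min (s + \<epsilon>) t"] \<epsilon>(1) se(1) by auto
    then show False using \<epsilon>(2)[of u] se(5)[of u] se(2) by auto
  qed
  moreover have "\<not> ht (\<gamma> e) > max 0 b"
  proof
    assume "ht (\<gamma> e) > max 0 b"
    then obtain \<epsilon> where \<epsilon>: "\<epsilon> > 0" "\<And>u. e - \<epsilon> < u \<Longrightarrow> u < e \<Longrightarrow> \<gamma> u $ 1 > 0" using down_crossing[OF se(4)] by blast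
    obtain u where "max (e - \<epsilon>) t < u" "u < e" using dense[of "max (e - \<epsilon>) t" e] \<epsilon>(1) se(2) by auto
    then show False using \<epsilon>(2)[of u] se(5)[of u] se(1) by auto
  qed
  ultimately have "ht (\<gamma> s) > max 0 b" "ht (\<gamma> e) < min 0 b"
    using cross_height[OF se(3)] cross_height[OF se(4)] by blast+
  moreover have "left_arc \<gamma> s e" using se by (intro arc_left) auto
  ultimately show ?thesis using se by blast
qed

lemma positive_in_right_arc:
  assumes t: "\<gamma> t $ 1 > 0"
  shows "\<exists>s e. s < t \<and> t < e \<and> right_arc \<gamma> s e \<and> ht (\<gamma> s) < min 0 b \<and> ht (\<gamma> e) > max 0 b"
proof -
  obtain tp where tp: "\<gamma> tp $ 1 < 0" using both by blast
  obtain t1 t2 where t12: "t1 < t" "\<gamma> t1 = \<gamma> tp" "t < t2" "\<gamma> t2 = \<gamma> tp"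
    using periodic_shift[of tp t] by blast
  have contn: "continuous_on UNIV (\<lambda>t. - \<gamma> t $ 1)" by (intro continuous_intros cont)
  obtain s e where se: "s < t" "t < e" "\<gamma> s $ 1 = 0" "\<gamma> e $ 1 = 0"
    "\<And>u. s < u \<Longrightarrow> u < e \<Longrightarrow> \<gamma> u $ 1 > 0"
    using maximal_negative_interval[OF contn, of t1 t t2] t12 tp t by auto
  have "\<not> ht (\<gamma> s) > max 0 b"
  proof
    assume "ht (\<gamma> s) > max 0 b"
    then obtain \<epsilon> where \<epsilon>: "\<epsilon> > 0" "\<And>u. s < u \<Longrightarrow> u < s + \<epsilon> \<Longrightarrow> \<gamma> u $ 1 < 0" using down_crossing[OF se(3)] by blast
    obtain u where "s < u" "u < min (s + \<epsilon>) t" using dense[of s "min (s + \<epsilon>) t"] \<epsilon>(1) se(1) by auto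
    then show False using \<epsilon>(2)[of u] se(5)[of u] se(2) by auto
  qed
  moreover have "\<not> ht (\<gamma> e) < min 0 b"
  proof
    assume "ht (\<gamma> e) < min 0 b"
    then obtain \<epsilon> where \<epsilon>: "\<epsilon> > 0" "\<And>u. e - \<epsilon> < u \<Longrightarrow> u < e \<Longrightarrow> \<gamma> u $ 1 < 0" using up_crossing[OF se(4)] by blast
    obtain u where "max (e - \<epsilon>) t < u" "u < e" using dense[of "max (e - \<epsilon>) t" e] \<epsilon>(1) se(2) by auto
    then show False using \<epsilon>(2)[of u] se(5)[of u] se(1) by auto
  qed
  ultimately have "ht (\<gamma> s) < min 0 b" "ht (\<gamma> e) > max 0 b"
    using cross_height[OF se(3)] cross_height[OF se(4)] by blast+
  moreover have "right_arc \<gamma> s e" using se by (intro arc_right) auto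
  ultimately show ?thesis using se by blast
qed

lemma left_arc_from:
  assumes x: "\<gamma> d $ 1 = 0" and y: "ht (\<gamma> d) > max 0 b"
  shows "\<exists>e. left_arc \<gamma> d e \<and> ht (\<gamma> e) < min 0 b"
proof -
  obtain \<epsilon> where \<epsilon>: "\<epsilon> > 0" "\<And>t. d < t \<Longrightarrow> t < d + \<epsilon> \<Longrightarrow> \<gamma> t $ 1 < 0" using down_crossing[OF x y] by blast
  then obtain s e where se: "s < d + \<epsilon> / 2" "d + \<epsilon> / 2 < e" "left_arc \<gamma> s e" "ht (\<gamma> e) < min 0 b"
    using negative_in_left_arc[of "d + \<epsilon> / 2"] by auto
  have sx: "\<gamma> s $ 1 = 0" "\<And>t. s < t \<Longrightarrow> t < e \<Longrightarrow> \<gamma> t $ 1 < 0" using se(3) by (auto simp: side_arc_def)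
  have "\<not> s < d" using sx(2)[of d] x se \<epsilon>(1) by auto
  moreover have "\<not> d < s" using \<epsilon>(2)[of s] sx(1) se(1) \<epsilon>(1) by auto
  ultimately have "s = d" by simp
  then show ?thesis using se by blast
qed

lemma right_arc_from:
  assumes x: "\<gamma> d $ 1 = 0" and y: "ht (\<gamma> d) < min 0 b"
  shows "\<exists>e. right_arc \<gamma> d e \<and> ht (\<gamma> e) > max 0 b"
proof -
  obtain \<epsilon> where \<epsilon>: "\<epsilon> > 0" "\<And>t. d < t \<Longrightarrow> t < d + \<epsilon> \<Longrightarrow> \<gamma> t $ 1 > 0" using up_crossing[OF x y] by blast
  then obtain s e where se: "s < d + \<epsilon> / 2" "d + \<epsilon> / 2 < e" "right_arc \<gamma> s e" "ht (\<gamma> e) > max 0 b"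
    using positive_in_right_arc[of "d + \<epsilon> / 2"] by auto
  have sx: "\<gamma> s $ 1 = 0" "\<And>t. s < t \<Longrightarrow> t < e \<Longrightarrow> \<gamma> t $ 1 \<noteq> 0" using se(3) by (auto simp: side_arc_def)
  have "\<not> s < d" using sx(2)[of d] x se \<epsilon>(1) by auto
  moreover have "\<not> d < s" using \<epsilon>(2)[of s] sx(1) se(1) \<epsilon>(1) by auto
  ultimately have "s = d" by simp
  then show ?thesis using se by blast
qed

lemma left_arc_to:
  assumes x: "\<gamma> d $ 1 = 0" and y: "ht (\<gamma> d) < min 0 b"
  shows "\<exists>s. left_arc \<gamma> s d \<and> ht (\<gamma> s) > max 0 b"
proof -
  obtain \<epsilon> where \<epsilon>: "\<epsilon> > 0" "\<And>t. d - \<epsilon> < t \<Longrightarrow> t < d \<Longrightarrow> \<gamma> t $ 1 < 0" using up_crossing[OF x y] by blast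
  then obtain s e where se: "s < d - \<epsilon> / 2" "d - \<epsilon> / 2 < e" "left_arc \<gamma> s e" "ht (\<gamma> s) > max 0 b"
    using negative_in_left_arc[of "d - \<epsilon> / 2"] by auto
  have sx: "\<gamma> e $ 1 = 0" "\<And>t. s < t \<Longrightarrow> t < e \<Longrightarrow> \<gamma> t $ 1 < 0" using se(3) by (auto simp: side_arc_def)
  have "\<not> d < e" using sx(2)[of d] x se \<epsilon>(1) by auto
  moreover have "\<not> e < d" using \<epsilon>(2)[of e] sx(1) se(2) \<epsilon>(1) by auto
  ultimately have "e = d" by simp
  then show ?thesis using se by blast
qed

lemma right_arc_to:
  assumes x: "\<gamma> d $ 1 = 0" and y: "ht (\<gamma> d) > max 0 b"
  shows "\<exists>s. right_arc \<gamma> s d \<and> ht (\<gamma> s) < min 0 b"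
proof -
  obtain \<epsilon> where \<epsilon>: "\<epsilon> > 0" "\<And>t. d - \<epsilon> < t \<Longrightarrow> t < d \<Longrightarrow> \<gamma> t $ 1 > 0" using down_crossing[OF x y] by blast
  then obtain s e where se: "s < d - \<epsilon> / 2" "d - \<epsilon> / 2 < e" "right_arc \<gamma> s e" "ht (\<gamma> s) < min 0 b"
    using positive_in_right_arc[of "d - \<epsilon> / 2"] by auto
  have sx: "\<gamma> e $ 1 = 0" "\<And>t. s < t \<Longrightarrow> t < e \<Longrightarrow> \<gamma> t $ 1 \<noteq> 0" using se(3) by (auto simp: side_arc_def)
  have "\<not> d < e" using sx(2)[of d] x se \<epsilon>(1) by auto
  moreover have "\<not> e < d" using \<epsilon>(2)[of e] sx(1) se(2) \<epsilon>(1) by auto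
  ultimately have "e = d" by simp
  then show ?thesis using se by blast
qed

definition Down :: "real set" where
  "Down = {t. \<gamma> t $ 1 = 0 \<and> ht (\<gamma> t) > max 0 b}"

text \<open>One turn of the orbit, from a downward crossing to the next one.\<close>

definition loop :: "real \<Rightarrow> real \<Rightarrow> real \<Rightarrow> bool" where
  "loop d e d' \<longleftrightarrow> d \<in> Down \<and> d' \<in> Down \<and> left_arc \<gamma> d e \<and> right_arc \<gamma> e d' \<and> ht (\<gamma> e) < min 0 b"

lemma loop_from: "d \<in> Down \<Longrightarrow> \<exists>e d'. loop d e d'"
proof -
  assume d: "d \<in> Down"
  obtain e where e: "left_arc \<gamma> d e" "ht (\<gamma> e) < min 0 b"
    using left_arc_from[of d] d unfolding Down_def by blast
  have "\<gamma> e $ 1 = 0" using e(1) by (simp add: side_arc_def)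
  then obtain d' where d': "right_arc \<gamma> e d'" "ht (\<gamma> d') > max 0 b"
    using right_arc_from e(2) by blast
  then have "d' \<in> Down" unfolding Down_def by (simp add: side_arc_def)
  then show ?thesis unfolding loop_def using d d' e by blast
qed

lemma loop_to: "d' \<in> Down \<Longrightarrow> \<exists>d e. loop d e d'"
proof -
  assume d': "d' \<in> Down"
  obtain e where e: "right_arc \<gamma> e d'" "ht (\<gamma> e) < min 0 b"
    using right_arc_to[of d'] d' unfolding Down_def by blast
  have "\<gamma> e $ 1 = 0" using e(1) by (simp add: side_arc_def)
  then obtain d where d: "left_arc \<gamma> d e" "ht (\<gamma> d) > max 0 b"
    using left_arc_to e(2) by blast
  then have "d \<in> Down" unfolding Down_def by (simp add: side_arc_def)
  then show ?thesis unfolding loop_def using d d' e by blast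
qed

lemma loop_less: "loop d e d' \<Longrightarrow> d < d'"
  by (auto simp: loop_def side_arc_def)

lemma loop_no_between: "loop d e d' \<Longrightarrow> t \<in> Down \<Longrightarrow> \<not> (d < t \<and> t < d')"
proof
  assume l: "loop d e d'" "t \<in> Down" "d < t \<and> t < d'"
  consider "t < e" | "t = e" | "e < t" by linarith
  then show False
    using l by cases (auto simp: loop_def side_arc_def Down_def)
qed

text \<open>A crossing point is isolated among the times spent on the switching line.\<close>

lemma Down_finite: "finite ({p..q} \<inter> Down)"
proof (rule finite_not_islimpt_in_compact)
  fix z
  have "\<exists>\<epsilon>>0. \<forall>t. t \<noteq> z \<longrightarrow> dist t z < \<epsilon> \<longrightarrow> \<gamma> t $ 1 \<noteq> 0"
  proof (cases "\<gamma> z $ 1 = 0")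
    case True
    then consider "ht (\<gamma> z) > max 0 b" | "ht (\<gamma> z) < min 0 b" using cross_height by blast
    then obtain \<epsilon> where "\<epsilon> > 0" "\<And>t. z - \<epsilon> < t \<Longrightarrow> t < z \<Longrightarrow> \<gamma> t $ 1 \<noteq> 0" "\<And>t. z < t \<Longrightarrow> t < z + \<epsilon> \<Longrightarrow> \<gamma> t $ 1 \<noteq> 0"
    proof cases
      case 1
      then show ?thesis using down_crossing[OF True] that by (metis less_irrefl)
    next
      case 2
      then show ?thesis using up_crossing[OF True] that by (metis less_irrefl)
    qed
    then show ?thesis by (intro exI[of _ \<epsilon>]) (force simp: dist_real_def neq_iff)
  next
    case False
    have "isCont (\<lambda>t. \<gamma> t $ 1) z"
      using cont[of UNIV] by (intro continuous_intros) (simp add: continuous_on_eq_continuous_at)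
    then have "eventually (\<lambda>t. \<gamma> t $ 1 \<noteq> 0) (at z)"
      using False unfolding isCont_def by (intro tendsto_imp_eventually_ne)
    then show ?thesis unfolding eventually_at by auto
  qed
  then show "\<not> z islimpt Down" unfolding islimpt_approachable Down_def by blast
qed simp

text \<open>Induction over successive downward crossings; it reaches every one of them because they are
  discrete.\<close>

lemma Down_induct:
  assumes d1: "d1 \<in> Down" "P d1"
    and step: "\<And>p e d. d1 \<le> p \<Longrightarrow> loop p e d \<Longrightarrow> P p \<Longrightarrow> P d"
    and d: "d \<in> Down" "d1 \<le> d"
  shows "P d"
proof (rule ccontr)
  assume n: "\<not> P d"
  define C where "C = {t \<in> {d1..d} \<inter> Down. \<not> P t}"
  have fC: "finite C" unfolding C_def using Down_finite by (rule rev_finite_subset) auto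
  have "d \<in> C" using n d by (simp add: C_def)
  define m where "m = Min C"
  have m: "m \<in> C" "\<And>t. t \<in> C \<Longrightarrow> m \<le> t" using Min_in[OF fC] Min_le[OF fC] \<open>d \<in> C\<close> by (auto simp: m_def)
  then have mD: "m \<in> Down" "d1 \<le> m" "m \<le> d" "\<not> P m" by (auto simp: C_def)
  then have "d1 < m" using d1 by (cases "d1 = m") auto
  obtain p e where p: "loop p e m" using loop_to[OF mD(1)] by blast
  have "d1 \<le> p" using loop_no_between[OF p d1(1)] \<open>d1 < m\<close> by linarith
  moreover have "P p"
  proof (rule ccontr)
    assume "\<not> P p"
    then have "p \<in> C" using p loop_less[OF p] \<open>d1 \<le> p\<close> mD by (auto simp: C_def loop_def)
    then show False using m(2) loop_less[OF p] by fastforce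
  qed
  ultimately show False using step[OF _ p] mD by blast
qed

lemma loop_matching:
  assumes "loop d e d'"
  shows "\<Phi> (ht (\<gamma> d)) - \<Phi> (ht (\<gamma> e)) = cL" "\<Phi>R (ht (\<gamma> d') - b) - \<Phi>R (ht (\<gamma> e) - b) = cR"
    and "ht (\<gamma> d) > max 0 b" "ht (\<gamma> e) < min 0 b" "ht (\<gamma> d') > max 0 b"
  using assms left_arc_matching[of \<gamma> d e] right_arc_matching[of \<gamma> e d'] by (auto simp: loop_def Down_def)

text \<open>Each half return map is decreasing, so the return map is increasing.\<close>

lemma loop_mono:
  assumes l: "loop d e d'" "loop f g f'" and less: "ht (\<gamma> d) < ht (\<gamma> f)"
  shows "ht (\<gamma> d') < ht (\<gamma> f')"
proof -
  note m = loop_matching[OF l(1)] and n = loop_matching[OF l(2)]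
  have "ht (\<gamma> g) < ht (\<gamma> e)" using left_curve_less[OF m(1) n(1)] m n less by auto
  then have "\<Phi>R (ht (\<gamma> e) - b) < \<Phi>R (ht (\<gamma> g) - b)"
    using m n by (intro focus_potential_strict_antimono[OF focR]) auto
  then have gt: "\<Phi>R (ht (\<gamma> d') - b) < \<Phi>R (ht (\<gamma> f') - b)" using m(2) n(2) by linarith
  show ?thesis
  proof (rule ccontr)
    assume "\<not> ?thesis"
    then have "\<Phi>R (ht (\<gamma> f') - b) \<le> \<Phi>R (ht (\<gamma> d') - b)"
      using focus_potential_strict_mono[OF focR, of "ht (\<gamma> f') - b" "ht (\<gamma> d') - b"] n
      by (cases "ht (\<gamma> f') = ht (\<gamma> d')") (auto intro: less_imp_le)
    then show False using gt by simp
  qed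
qed

lemma Down_shift: "d \<in> Down \<Longrightarrow> d + T \<in> Down"
  unfolding Down_def using periodic by simp

text \<open>If the height changed during one turn, it would, as the return map is increasing, move further away in
  the same direction at every later crossing, and could not come back after a period.\<close>

lemma loop_closed:
  assumes l: "loop d e d'"
  shows "ht (\<gamma> d') = ht (\<gamma> d)"
proof (rule ccontr)
  assume "ht (\<gamma> d') \<noteq> ht (\<gamma> d)"
  then consider "ht (\<gamma> d') < ht (\<gamma> d)" | "ht (\<gamma> d') > ht (\<gamma> d)" by linarith
  moreover have dD: "d \<in> Down" "d + T \<in> Down" using l Down_shift by (auto simp: loop_def)
  moreover have uniq: "f = d'" if "loop d g f" for g f
    using loop_no_between[OF l, of f] loop_no_between[OF that, of d'] loop_less[OF l] loop_less[OF that] l that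
    by (auto simp: loop_def)
  ultimately show False
  proof cases
    case 1
    \<comment> \<open>The first alternative only serves to start the induction.\<close>
    have "d + T = d \<or> ht (\<gamma> (d + T)) < ht (\<gamma> d)"
    proof (rule Down_induct[OF dD(1) _ _ dD(2)])
      fix p g f assume h: "loop p g f" "p = d \<or> ht (\<gamma> p) < ht (\<gamma> d)"
      show "f = d \<or> ht (\<gamma> f) < ht (\<gamma> d)"
      proof (cases "p = d")
        case True
        then show ?thesis using uniq h(1) 1 by auto
      next
        case False
        then show ?thesis using loop_mono[OF h(1) l] h(2) 1 by auto
      qed
    qed (use T_pos in auto)
    then show False using periodic T_pos by auto
  next
    case 2
    have "d + T = d \<or> ht (\<gamma> (d + T)) > ht (\<gamma> d)"
    proof (rule Down_induct[OF dD(1) _ _ dD(2)])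
      fix p g f assume h: "loop p g f" "p = d \<or> ht (\<gamma> p) > ht (\<gamma> d)"
      show "f = d \<or> ht (\<gamma> f) > ht (\<gamma> d)"
      proof (cases "p = d")
        case True
        then show ?thesis using uniq h(1) 2 by auto
      next
        case False
        then show ?thesis using loop_mono[OF l h(1)] h(2) 2 by auto
      qed
    qed (use T_pos in auto)
    then show False using periodic T_pos by auto
  qed
qed

lemma Down_height_unique:
  assumes "d \<in> Down" "d' \<in> Down"
  shows "ht (\<gamma> d) = ht (\<gamma> d')"
proof -
  have "ht (\<gamma> f) = ht (\<gamma> p)" if "p \<in> Down" "f \<in> Down" "p \<le> f" for p f
    by (rule Down_induct[where P = "\<lambda>f. ht (\<gamma> f) = ht (\<gamma> p)", OF that(1) _ _ that(2,3)]) (auto dest: loop_closed)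
  then show ?thesis using assms by (metis linear)
qed

end

context crossing_orbit
begin

text \<open>All downward crossings have the same height, and the left matching equation then fixes the height of
  the upward crossings.\<close>

theorem orbit_heights:
  "\<exists>y0 y1. max 0 b < y0 \<and> y1 < min 0 b \<and> \<Phi> y0 - \<Phi> y1 = cL \<and> \<Phi>R (y0 - b) - \<Phi>R (y1 - b) = cR \<and>
     (\<forall>t. \<gamma> t $ 1 = 0 \<longrightarrow> ht (\<gamma> t) = y0 \<or> ht (\<gamma> t) = y1)"
proof -
  obtain t where "\<gamma> t $ 1 < 0" using both by blast
  then obtain d e where "left_arc \<gamma> d e" "ht (\<gamma> d) > max 0 b" using negative_in_left_arc by blast
  then have d: "d \<in> Down" by (simp add: Down_def side_arc_def)
  obtain e d' where l: "loop d e d'" using loop_from[OF d] by (elim exE)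
  note m = loop_matching[OF l]
  have "ht (\<gamma> t) = ht (\<gamma> d) \<or> ht (\<gamma> t) = ht (\<gamma> e)" if t: "\<gamma> t $ 1 = 0" for t
  proof (cases "ht (\<gamma> t) > max 0 b")
    case True
    then have "t \<in> Down" using t by (simp add: Down_def)
    then show ?thesis using Down_height_unique d by blast
  next
    case False
    then have neg: "ht (\<gamma> t) < min 0 b" using cross_height[OF t] by blast
    then obtain s where s: "left_arc \<gamma> s t" "ht (\<gamma> s) > max 0 b" using left_arc_to[OF t] by blast
    then have "s \<in> Down" by (simp add: Down_def side_arc_def)
    then have eq: "ht (\<gamma> s) = ht (\<gamma> d)" using Down_height_unique d by blast
    have "\<Phi> (ht (\<gamma> s)) - \<Phi> (ht (\<gamma> t)) = cL" using left_arc_matching[OF s(1)] s(2) neg by simp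
    then have "\<Phi> (ht (\<gamma> t)) = \<Phi> (ht (\<gamma> e))" using m(1) eq by simp
    then have "ht (\<gamma> t) = ht (\<gamma> e)" by (rule \<Phi>_inj_neg) (use neg m(4) in simp_all)
    then show ?thesis by simp
  qed
  moreover have "\<Phi>R (ht (\<gamma> d) - b) - \<Phi>R (ht (\<gamma> e) - b) = cR"
    using m(2) unfolding loop_closed[OF l] .
  ultimately show ?thesis
    using m(1,3,4) by (intro exI[of _ "ht (\<gamma> d)"] exI[of _ "ht (\<gamma> e)"]) blast
qed

lemma in_some_arc:
  "(\<exists>s e. left_arc \<gamma> s e \<and> t \<in> {s..e} \<and> ht (\<gamma> s) > max 0 b)
     \<or> (\<exists>s e. right_arc \<gamma> s e \<and> t \<in> {s..e} \<and> ht (\<gamma> s) < min 0 b)"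
proof (cases "\<gamma> t $ 1" "0 :: real" rule: linorder_cases)
  case less
  then obtain s e where "s < t" "t < e" "left_arc \<gamma> s e" "ht (\<gamma> s) > max 0 b"
    using negative_in_left_arc by blast
  moreover from this have "t \<in> {s..e}" by simp
  ultimately show ?thesis by blast
next
  case greater
  then obtain s e where "s < t" "t < e" "right_arc \<gamma> s e" "ht (\<gamma> s) < min 0 b"
    using positive_in_right_arc by blast
  moreover from this have "t \<in> {s..e}" by simp
  ultimately show ?thesis by blast
next
  case equal
  have start: "t \<in> {t..e}" if "side_arc \<sigma> A \<beta> \<gamma> t e" for \<sigma> A \<beta> e
    using that by (simp add: side_arc_def)
  from cross_height[OF equal] show ?thesis
  proof
    assume h: "ht (\<gamma> t) > max 0 b"
    then obtain e where "left_arc \<gamma> t e" using left_arc_from[OF equal] by blast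
    then show ?thesis using start h by blast
  next
    assume h: "ht (\<gamma> t) < min 0 b"
    then obtain e where "right_arc \<gamma> t e" using right_arc_from[OF equal] by blast
    then show ?thesis using start h by blast
  qed
qed

end

context focus_focus
begin

text \<open>Each arc of the first orbit starts at the same point as some arc of the second one on the same side,
  hence coincides with it.\<close>

lemma orbit_subset:
  assumes o: "crossing_orbit AL AR bL bR \<gamma> T" "crossing_orbit AL AR bL bR \<gamma>' T'"
    and y: "max 0 b < y0" "y1 < min 0 b"
    and h: "\<And>t. \<gamma> t $ 1 = 0 \<Longrightarrow> ht (\<gamma> t) = y0 \<or> ht (\<gamma> t) = y1"
    and h': "\<And>t. \<gamma>' t $ 1 = 0 \<Longrightarrow> ht (\<gamma>' t) = y0 \<or> ht (\<gamma>' t) = y1"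
  shows "range \<gamma> \<subseteq> range \<gamma>'"
proof safe
  interpret A: crossing_orbit AL AR bL bR \<gamma> T by (rule o(1))
  interpret B: crossing_orbit AL AR bL bR \<gamma>' T' by (rule o(2))
  fix t
  from A.in_some_arc[of t] show "\<gamma> t \<in> range \<gamma>'"
  proof (elim disjE exE conjE)
    fix s e assume l: "left_arc \<gamma> s e" "t \<in> {s..e}" "ht (\<gamma> s) > max 0 b"
    obtain u where "\<gamma>' u $ 1 < 0" using B.both by blast
    then obtain s' e' where l': "left_arc \<gamma>' s' e'" "ht (\<gamma>' s') > max 0 b"
      using B.negative_in_left_arc by blast
    have "ht (\<gamma> s) = y0" "ht (\<gamma>' s') = y0"
      using h[of s] h'[of s'] l l' y by (auto simp: side_arc_def)
    then show ?thesis
      using side_arc_determined[OF l(1) l'(1) focL[unfolded TL_def DL_def] _ _ _ l(2)] a12_nonzero by simp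
  next
    fix s e assume l: "right_arc \<gamma> s e" "t \<in> {s..e}" "ht (\<gamma> s) < min 0 b"
    obtain u where "\<gamma>' u $ 1 > 0" using B.both by blast
    then obtain s' e' where l': "right_arc \<gamma>' s' e'" "ht (\<gamma>' s') < min 0 b"
      using B.positive_in_right_arc by blast
    have z: "\<gamma> s $ 1 = 0" "\<gamma>' s' $ 1 = 0" using l l' by (auto simp: side_arc_def)
    have "ht (\<gamma> s) = y1" "ht (\<gamma>' s') = y1"
      using h[OF z(1)] h'[OF z(2)] l l' y by auto
    then have "side_coord \<kappa> AR bR (\<gamma> s) = side_coord \<kappa> AR bR (\<gamma>' s')"
      unfolding side_coord_right[OF z(1)] side_coord_right[OF z(2)] by simp
    then show ?thesis
      using side_arc_determined[OF l(1) l'(1) focR[unfolded TR_def DR_def] _ _ _ l(2)] a12_nonzero \<kappa>_neg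
      by simp
  qed
qed

lemma crossing_periodic_orbit_obtains:
  assumes "crossing_periodic_orbit AL bL AR bR \<Gamma>"
  obtains \<gamma> T where "crossing_orbit AL AR bL bR \<gamma> T" "\<Gamma> = range \<gamma>"
proof -
  obtain \<gamma> T where g: "filippov_solution AL bL AR bR \<gamma>" "T > 0" "\<And>t. \<gamma> (t + T) = \<gamma> t" "\<Gamma> = range \<gamma>"
    and s: "\<exists>x\<in>\<Gamma>. x$1 < 0" "\<exists>x\<in>\<Gamma>. x$1 > 0" "\<forall>x\<in>\<Gamma>. x$1 = 0 \<longrightarrow> crossing_point AL bL AR bR x"
    using assms unfolding crossing_periodic_orbit_def by blast
  have "crossing_orbit AL AR bL bR \<gamma> T"
    by unfold_locales (use g s in auto)
  then show thesis using that g by blast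
qed

theorem crossing_periodic_orbits_bound:
  "finite {\<Gamma>. crossing_periodic_orbit AL bL AR bR \<Gamma>} \<and> card {\<Gamma>. crossing_periodic_orbit AL bL AR bR \<Gamma>} \<le> root_count + 2"
proof -
  define P where "P = {(y0, y1). max 0 b < y0 \<and> y1 < min 0 b \<and> \<Phi> y0 - \<Phi> y1 = cL \<and> \<Phi>R (y0 - b) - \<Phi>R (y1 - b) = cR}"
  define rel where "rel \<Gamma> q \<longleftrightarrow> q \<in> P \<and> (\<exists>\<gamma> T. crossing_orbit AL AR bL bR \<gamma> T \<and> \<Gamma> = range \<gamma> \<and>
      (\<forall>t. \<gamma> t $ 1 = 0 \<longrightarrow> ht (\<gamma> t) = fst q \<or> ht (\<gamma> t) = snd q))" for \<Gamma> q
  let ?O = "{\<Gamma>. crossing_periodic_orbit AL bL AR bR \<Gamma>}"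
  have ex: "\<exists>q. rel \<Gamma> q" if G: "\<Gamma> \<in> ?O" for \<Gamma>
  proof -
    obtain \<gamma> T where g: "crossing_orbit AL AR bL bR \<gamma> T" "\<Gamma> = range \<gamma>"
      using crossing_periodic_orbit_obtains G by blast
    obtain y0 y1 where "(y0, y1) \<in> P" "\<forall>t. \<gamma> t $ 1 = 0 \<longrightarrow> ht (\<gamma> t) = y0 \<or> ht (\<gamma> t) = y1"
      using crossing_orbit.orbit_heights[OF g(1)] unfolding P_def by blast
    then show ?thesis unfolding rel_def using g by (intro exI[of _ "(y0, y1)"]) auto
  qed
  define f where "f \<Gamma> = (SOME q. rel \<Gamma> q)" for \<Gamma>
  have f: "rel \<Gamma> (f \<Gamma>)" if "\<Gamma> \<in> ?O" for \<Gamma> unfolding f_def using ex[OF that] by (rule someI_ex)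
  have "inj_on f ?O"
  proof (rule inj_onI)
    fix \<Gamma> \<Gamma>' assume G: "\<Gamma> \<in> ?O" "\<Gamma>' \<in> ?O" "f \<Gamma> = f \<Gamma>'"
    obtain y0 y1 where q: "f \<Gamma> = (y0, y1)" by (cases "f \<Gamma>")
    have r: "rel \<Gamma> (y0, y1)" "rel \<Gamma>' (y0, y1)" using f[OF G(1)] f[OF G(2)] G(3) q by simp_all
    have y: "max 0 b < y0" "y1 < min 0 b" using r(1) by (auto simp: rel_def P_def)
    show "\<Gamma> = \<Gamma>'"
      using r orbit_subset[OF _ _ y] unfolding rel_def by (metis fst_conv snd_conv subset_antisym)
  qed
  moreover have "f ` ?O \<subseteq> P" using f by (auto simp: rel_def)
  moreover have P: "finite P" "card P \<le> root_count + 2"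
    using matching_pairs_bound[of cL cR] unfolding P_def by blast+
  ultimately show ?thesis
    using card_inj_on_le[of f ?O P] inj_on_finite[of f ?O P] by linarith
qed

end

theorem theorem6:
  fixes AL AR :: "real^2^2" and bL bR :: "real^2" and k :: nat
  assumes "AL$1$2 * AR$1$2 > 0"
    and "(TL AL)\<^sup>2 - 4 * DL AL < 0"
    and "(TR AR)\<^sup>2 - 4 * DR AR < 0"
    and "coeff (R AL bL AR bR) 6 \<noteq> 0"
    and "k = size (filter_mset (\<lambda>y. y \<le> 0) (proots (R AL bL AR bR)))"
  shows "finite {\<Gamma>. crossing_limit_cycle AL bL AR bR \<Gamma>} \<and>
         card {\<Gamma>. crossing_limit_cycle AL bL AR bR \<Gamma>} \<le> k + 2"
proof -
  interpret focus_focus AL AR bL bR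
    using assms by unfold_locales auto
  let ?O = "{\<Gamma>. crossing_periodic_orbit AL bL AR bR \<Gamma>}"
  have sub: "{\<Gamma>. crossing_limit_cycle AL bL AR bR \<Gamma>} \<subseteq> ?O"
    by (auto simp: crossing_limit_cycle_def)
  have fin: "finite ?O" and le: "card ?O \<le> k + 2"
    using crossing_periodic_orbits_bound unfolding assms(5) by blast+
  show ?thesis
    using finite_subset[OF sub fin] card_mono[OF fin sub] le by linarith
qed

end
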